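(* Let $w=w_1\cdots w_n\in K(B_n)$ be a separable signed permutation with separating tree $T_w$. (1) If $w_1<w_n$, then $$F(\Lambda_w^B,q)=\frac{\prod_{V\in S^-(w)}[N(V)]!}{\prod_{V\in S^+(w)}[N(V)]!}\prod_{i\in\mathrm{Neg}(w)}(i),\qquad F(V_w^B,q)=\frac{\prod_{V\in S^+(w)}[N(V)]!}{\prod_{V\in S^-(w)}[N(V)]!}\,[n]!\prod_{i\in[n]\setminus\mathrm{Neg}(w)}(i).$$ (2) If $w_1>w_n$, then $$F(\Lambda_w^B,q)=\frac{\prod_{V\in S^-(w)}[N(V)]!}{\prod_{V\in S^+(w)}[N(V)]!}\,[n]!\prod_{i\in\mathrm{Neg}(w)}(i),\qquad F(V_w^B,q)=\frac{\prod_{V\in S^+(w)}[N(V)]!}{\prod_{V\in S^-(w)}[N(V)]!}\prod_{i\in[n]\setminus\mathrm{Neg}(w)}(i).$$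
   Context: Signed permutations. $[n]=\{1,\dots,n\}$ as a set, $\bar a=-a$. $B_n$ is the group of signed permutations: bijections $w$ of $\{\pm1,\dots,\pm n\}$ with $w(-i)=-w(i)$, written $w=w_1\cdots w_n$, $w_i=w(i)$. $\mathrm{Neg}(w)=\{i\in[n]:w_i<0\}$. For a word $a=a_1\cdots a_m$ of nonzero integers with distinct absolute values, $\mathrm{sts}(a)\in B_m$ is the signed permutation whose $i$-th entry has the sign of $a_i$ and whose absolute values have the same relative order as $|a_1|,\dots,|a_m|$. $w$ contains the pattern $u\in B_m$ if $\mathrm{sts}(w_{i_1}\cdots w_{i_m})=u$ for some $i_1<\cdots<i_m$; otherwise it avoids $u$. $K(B_n)$ is the set of separable $w\in B_n$, i.e. those avoiding $\bar21$, $2\bar1$, $3142$, $2413$, $\bar3\,\bar1\,\bar4\,\bar2$, $\bar2\,\bar4\,\bar1\,\bar3$. For $u\in B_p$, $v\in B_q$: $u\oplus v\in B_{p+q}$ has $(u\oplus v)_i=u_i$ for $i\le p$ and $v_{i-p}+(\mathrm{sgn}\,v_{i-p})p$ for $i>p$; when all entries of $u,v$ have the same sign, $u\ominus v\in B_{p+q}$ has $(u\ominus v)_i=u_i+(\mathrm{sgn}\,u_i)q$ for $i\le p$ and $v_{i-p}$ for $i>p$. Weak order ideals. On $B_n$, $u\le_L w$ iff $\ell(w)=\ell(u)+\ell(wu^{-1})$, with $\ell$ the Coxeter length for the generators $s_0=\bar1\,2\cdots n$ and adjacent transpositions $s_1,\dots,s_{n-1}$, and $(uv)(i)=u(v(i))$;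 explicitly $\ell(w)=\#\{i:w_i<0\}+\#\{i<j:w_i>w_j\}+\#\{i<j:w_i+w_j<0\}$. $\Lambda_w^B=\{u\in B_n:u\le_L w\}$, $V_w^B=\{u\in B_n:w\le_L u\}$, with rank generating functions $F(\Lambda_w^B,q)=\sum_{u\in\Lambda_w^B}q^{\ell(u)}$ and $F(V_w^B,q)=\sum_{u\in V_w^B}q^{\ell(u)-\ell(w)}$. $q$-notation: for an integer $i\ge1$, $[i]=1+q+\cdots+q^{i-1}$, $[m]!=[1][2]\cdots[m]$, $(i)=1+q^i$. Empty products are $1$. Separating tree $T_w$ of a separable $w\in B_n$ (a binary tree with leaves labeled, left to right, by $w_1,\dots,w_n$). If $n=1$, $T_w$ is a single node (a leaf) labeled $w_1$. If $n\ge2$, let $p\in[n-1]$ be the largest index such that $w_{p+1},\dots,w_n$ have the same sign and either $w=w_1\cdots w_p\oplus\mathrm{sts}(w_{p+1}\cdots w_n)$ with both summands separable, or $w=\mathrm{sts}(w_1\cdots w_p)\ominus w_{p+1}\cdots w_n$ with both summands separable (such $p$ exists). Then $T_w$ has a root whose left subtree is $T_{\mathrm{sts}(w_1\cdots w_p)}$ (with leaves relabeled $w_1,\dots,w_p$) and whose right subtree is $T_{\mathrm{sts}(w_{p+1}\cdots w_n)}$ (with leaves relabeled $w_{p+1},\dots,w_n$); the root is labeled $\oplus$ (a positive node) if $w_p<w_{p+1}$, and $\ominus$ (a negative node) if $w_p>w_{p+1}$. Leaves are neither positive nor negative nodes. $S^+(w)$ is the set of positive nodes of $T_w$ whose parent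 is negative, $S^-(w)$ is the set of negative nodes whose parent is positive (the root belongs to neither). For a node $V$, $N(V)$ is the number of leaves in the subtree rooted at $V$. *)

theory Defs
  imports
    "HOL-Computational_Algebra.Computational_Algebra"
    "HOL-Combinatorics.Combinatorics"
    "HOL-Library.Sublist"
begin

section \<open>Signed permutations and patterns\<close>

text \<open>
  A signed permutation of rank n is extended by the identity outside
  the set of nonzero integers of absolute value at most n, as is usual for \<open>permutes\<close>.
  The product of the group is function composition.
\<close>

definition signed_perms :: "nat \<Rightarrow> (int \<Rightarrow> int) set" where
  "signed_perms n = {w. w permutes {i. i \<noteq> 0 \<and> \<bar>i\<bar> \<le> int n} \<and> (\<forall>i. w (- i) = - w i)}"

definition one_line :: "nat \<Rightarrow> (int \<Rightarrow> int) \<Rightarrow> int list" where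
  "one_line n w = map w [1..int n]"

definition Neg :: "nat \<Rightarrow> (int \<Rightarrow> int) \<Rightarrow> nat set" where
  "Neg n w = {i \<in> {1..n}. w (int i) < 0}"

definition sts :: "int list \<Rightarrow> int list" where
  "sts a = map (\<lambda>x. sgn x * int (card {y \<in> set a. \<bar>y\<bar> \<le> \<bar>x\<bar>})) a"

definition contains_pattern :: "int list \<Rightarrow> int list \<Rightarrow> bool" where
  "contains_pattern a u \<longleftrightarrow> (\<exists>b. subseq b a \<and> sts b = u)"

definition separable_patterns :: "int list set" where
  "separable_patterns =
     {[-2, 1], [2, -1], [3, 1, 4, 2], [2, 4, 1, 3], [-3, -1, -4, -2], [-2, -4, -1, -3]}"

definition K :: "nat \<Rightarrow> (int \<Rightarrow> int) set" where
  "K n = {w \<in> signed_perms n. \<forall>u \<in> separable_patterns. \<not> contains_pattern (one_line n w) u}"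

definition separable_word :: "int list \<Rightarrow> bool" where
  "separable_word a \<longleftrightarrow> a \<in> one_line (length a) ` K (length a)"

definition same_sign :: "int list \<Rightarrow> bool" where
  "same_sign a \<longleftrightarrow> (\<forall>x \<in> set a. \<forall>y \<in> set a. sgn x = sgn y)"

definition osum :: "int list \<Rightarrow> int list \<Rightarrow> int list" where
  "osum u v = u @ map (\<lambda>x. x + sgn x * int (length u)) v"

text \<open>Only meaningful when all entries of both words have the same sign.\<close>

definition ominus :: "int list \<Rightarrow> int list \<Rightarrow> int list" where
  "ominus u v = map (\<lambda>x. x + sgn x * int (length v)) u @ v"

section \<open>Left weak order\<close>

definition simple_refl :: "nat \<Rightarrow> int \<Rightarrow> int" where
  "simple_refl i =
     (if i = 0 then transpose 1 (- 1)
      else transpose (int i) (int i + 1) \<circ> transpose (- int i) (- int i - 1))"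

definition cox_length :: "nat \<Rightarrow> (int \<Rightarrow> int) \<Rightarrow> nat" where
  "cox_length n w =
     (LEAST k. \<exists>rs. length rs = k \<and> set rs \<subseteq> simple_refl ` {..<n} \<and> w = foldr (\<circ>) rs id)"

definition left_weak_le :: "nat \<Rightarrow> (int \<Rightarrow> int) \<Rightarrow> (int \<Rightarrow> int) \<Rightarrow> bool" where
  "left_weak_le n u w \<longleftrightarrow> cox_length n w = cox_length n u + cox_length n (w \<circ> inv u)"

definition lower_ideal :: "nat \<Rightarrow> (int \<Rightarrow> int) \<Rightarrow> (int \<Rightarrow> int) set" where
  "lower_ideal n w = {u \<in> signed_perms n. left_weak_le n u w}"

definition upper_ideal :: "nat \<Rightarrow> (int \<Rightarrow> int) \<Rightarrow> (int \<Rightarrow> int) set" where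
  "upper_ideal n w = {u \<in> signed_perms n. left_weak_le n w u}"

text \<open>The polynomial \<open>monom 1 k\<close> is the \<open>k\<close>-th power of the indeterminate \<open>q\<close>.\<close>

definition F_lower :: "nat \<Rightarrow> (int \<Rightarrow> int) \<Rightarrow> int poly" where
  "F_lower n w = (\<Sum>u \<in> lower_ideal n w. monom 1 (cox_length n u))"

definition F_upper :: "nat \<Rightarrow> (int \<Rightarrow> int) \<Rightarrow> int poly" where
  "F_upper n w = (\<Sum>u \<in> upper_ideal n w. monom 1 (cox_length n u - cox_length n w))"

definition qint :: "nat \<Rightarrow> int poly" where
  "qint i = (\<Sum>j<i. monom 1 j)"

definition qfact :: "nat \<Rightarrow> int poly" where
  "qfact m = (\<Prod>i = 1..m. qint i)"

definition qpar :: "nat \<Rightarrow> int poly" where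
  "qpar i = 1 + monom 1 i"

section \<open>Separating trees\<close>

datatype node_sign = Oplus | Ominus

datatype sep_tree = Leaf int | Node node_sign sep_tree sep_tree

primrec num_leaves :: "sep_tree \<Rightarrow> nat" where
  "num_leaves (Leaf x) = 1"
| "num_leaves (Node s l r) = num_leaves l + num_leaves r"

primrec relabel :: "sep_tree \<Rightarrow> int list \<Rightarrow> sep_tree" where
  "relabel (Leaf x) a = Leaf (hd a)"
| "relabel (Node s l r) a =
     Node s (relabel l (take (num_leaves l) a)) (relabel r (drop (num_leaves l) a))"

definition split_positions :: "int list \<Rightarrow> nat set" where
  "split_positions w = {p \<in> {1..<length w}. same_sign (drop p w) \<and>
     (w = osum (take p w) (sts (drop p w)) \<and>
        separable_word (take p w) \<and> separable_word (sts (drop p w)) \<or>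
      same_sign w \<and> w = ominus (sts (take p w)) (drop p w) \<and>
        separable_word (sts (take p w)) \<and> separable_word (drop p w))}"

text \<open>
  The test for emptiness of \<open>split_positions\<close> only makes the function total: a separable
  word of length at least two has a split position. The entries written
  \<open>w\<^sub>p\<close> and \<open>w\<^sub>p\<^sub>+\<^sub>1\<close> in one-line notation are \<open>w ! (p - 1)\<close> and \<open>w ! p\<close>.
\<close>

function separating_tree :: "int list \<Rightarrow> sep_tree" where
  "separating_tree w =
     (if length w \<le> 1 \<or> split_positions w = {} then Leaf (hd w)
      else let p = Max (split_positions w) in
        Node (if w ! (p - 1) < w ! p then Oplus else Ominus)
          (relabel (separating_tree (sts (take p w))) (take p w))
          (relabel (separating_tree (sts (drop p w))) (drop p w)))"
  by auto

lemma Max_split_positions: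
  assumes "split_positions w \<noteq> {}"
  shows "Max (split_positions w) \<in> {1..<length w}"
proof -
  have "split_positions w \<subseteq> {1..<length w}"
    by (auto simp: split_positions_def)
  moreover from this have "finite (split_positions w)"
    by (rule finite_subset) simp
  ultimately show ?thesis
    using Max_in[OF _ assms] by blast
qed

termination separating_tree
proof (relation "measure length")
  fix w :: "int list" and p
  assume "\<not> (length w \<le> 1 \<or> split_positions w = {})" "p = Max (split_positions w)"
  then have "1 \<le> p" "p < length w"
    using Max_split_positions[of w] by auto
  then show "(sts (take p w), w) \<in> measure length" "(sts (drop p w), w) \<in> measure length"
    by (auto simp: sts_def)
qed simp

declare separating_tree.simps [simp del]

text \<open>
  A node of a tree is the path leading to it from the root, so that the parent of the node
  \<open>V \<noteq> []\<close> is \<open>butlast V\<close>.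
\<close>

datatype dir = Left | Right

fun subtree_at :: "sep_tree \<Rightarrow> dir list \<Rightarrow> sep_tree option" where
  "subtree_at t [] = Some t"
| "subtree_at (Leaf x) (d # V) = None"
| "subtree_at (Node s l r) (Left # V) = subtree_at l V"
| "subtree_at (Node s l r) (Right # V) = subtree_at r V"

definition has_sign :: "sep_tree \<Rightarrow> node_sign \<Rightarrow> dir list \<Rightarrow> bool" where
  "has_sign t s V \<longleftrightarrow> (\<exists>l r. subtree_at t V = Some (Node s l r))"

definition S_plus :: "sep_tree \<Rightarrow> dir list set" where
  "S_plus t = {V. V \<noteq> [] \<and> has_sign t Oplus V \<and> has_sign t Ominus (butlast V)}"

definition S_minus :: "sep_tree \<Rightarrow> dir list set" where
  "S_minus t = {V. V \<noteq> [] \<and> has_sign t Ominus V \<and> has_sign t Oplus (butlast V)}"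

definition N_leaves :: "sep_tree \<Rightarrow> dir list \<Rightarrow> nat" where
  "N_leaves t V = num_leaves (the (subtree_at t V))"

definition qfact_prod :: "sep_tree \<Rightarrow> dir list set \<Rightarrow> int poly fract" where
  "qfact_prod t S = to_fract (\<Prod>V \<in> S. qfact (N_leaves t V))"

end

theory Submission
  imports Defs
begin

text \<open>
  The ideal below \<open>w\<close> in the left weak order consists of the \<open>u\<close> whose inversion set is contained in
  that of \<open>w\<close>. Comparing inversion sets only involves the relative order of entries (and of
  their negatives), so a split of the word \<open>w\<close> into two parts
  either forces the same split on the words below it, and the rank generating function is a product,
  or imposes no condition between the two parts, and a Gaussian binomial coefficient (or its signed
  analogue) appears as an additional factor. Every separable word splits, the kind of split is the
  label of the root, and the recursion over the separating tree telescopes to the quotient of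
  \<open>q\<close>-factorials. The upper ideal of \<open>w\<close> is the order dual of the lower ideal of \<open>- w\<close>,
  and negation exchanges the labels of the tree; as all factors are palindromic, the reversal of
  ranks has no effect on the formula.
\<close>

section \<open>Inversions and the left weak order\<close>

text \<open>In a split only the right block is sure to have constant sign. So the left block is
  treated in type B and the right one in type A, which is the reason for the pair \<open>ZA\<close>,
  \<open>ZB\<close>. A negative right block with the largest absolute values, at positions
  \<open>p + 1..p + q\<close>, contributes a sum over signed shuffles, and this is the Gaussian
  binomial times the product of the (i) over exactly these positions, because [2k] = [k](k). The
  factors (i) thus depend on positions only and separate as the product over Neg; what remains is of
  type A: a Gaussian binomial at each node of one sign and 1 at each node of the other.

  The Gaussian binomial at a node with children of sizes a and b is [a + b]! / ([a]! [b]!). Between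
  a node and a child of the same sign the factorials cancel. Numerators survive at nodes without a
  parent of the same sign, denominators at children of the other sign; leaves give 1. So [n]! is the
  numerator of the root, present exactly if the root carries a binomial. As all comparisons between
  the two blocks agree, the first and the last entry reveal the root label.\<close>

text \<open>
  The pair \<open>(i, j)\<close> stands for the positive root \<open>e\<^sub>j - e\<^sub>i\<close>, where \<open>e\<^sub>-\<^sub>i = - e\<^sub>i\<close>; each root is
  represented by its pair with \<open>\<bar>i\<bar> \<le> j\<close>, the short root by \<open>(- j, j)\<close>. So \<open>i = - i'\<close>
  with \<open>0 < i' < j\<close> encodes the inversions counted by \<open>w i' + w j < 0\<close>.
\<close>

definition roots :: "nat \<Rightarrow> (int \<times> int) set" where
  "roots n = {(i, j). 0 < j \<and> j \<le> int n \<and> i \<noteq> 0 \<and> - j \<le> i \<and> i < j}"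

definition Inv :: "nat \<Rightarrow> (int \<Rightarrow> int) \<Rightarrow> (int \<times> int) set" where
  "Inv n w = {(i, j) \<in> roots n. w j < w i}"

text \<open>The root e_b - e_a up to sign: of the pairs \<open>(a, b)\<close>,
  \<open>(b, a)\<close>, \<open>(- a, - b)\<close>, \<open>(- b, - a)\<close>, which all encode it,
  the one that lies in \<open>roots\<close>. It describes the action of signed permutations on roots
  modulo sign.\<close>

definition root_rep :: "int \<Rightarrow> int \<Rightarrow> int \<times> int" where
  "root_rep a b =
     (if \<bar>a\<bar> \<le> \<bar>b\<bar> then (if 0 < b then (a, b) else (- a, - b))
      else (if 0 < a then (b, a) else (- b, - a)))"

lemma finite_roots [simp]: "finite (roots n)"
proof (rule finite_subset)
  show "roots n \<subseteq> {- int n..int n} \<times> {- int n..int n}"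
    by (auto simp: roots_def)
qed simp

lemma finite_Inv [simp]: "finite (Inv n w)"
  by (rule finite_subset[OF _ finite_roots[of n]]) (auto simp: Inv_def)

lemma Inv_iff: "(i, j) \<in> Inv n w \<longleftrightarrow> (i, j) \<in> roots n \<and> w j < w i"
  by (simp add: Inv_def)

section \<open>Signed permutations and their action on roots\<close>

lemma signed_perms_minus: "w \<in> signed_perms n \<Longrightarrow> w (- i) = - w i"
  by (simp add: signed_perms_def)

lemma signed_perms_permutes:
  "w \<in> signed_perms n \<Longrightarrow> w permutes {i. i \<noteq> 0 \<and> \<bar>i\<bar> \<le> int n}"
  by (simp add: signed_perms_def)

lemma signed_perms_inj: "w \<in> signed_perms n \<Longrightarrow> w i = w j \<longleftrightarrow> i = j"
  using permutes_inj[OF signed_perms_permutes] by (auto dest: injD)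

lemma signed_perms_range:
  "w \<in> signed_perms n \<Longrightarrow> i \<noteq> 0 \<Longrightarrow> \<bar>i\<bar> \<le> int n \<Longrightarrow> w i \<noteq> 0 \<and> \<bar>w i\<bar> \<le> int n"
  using permutes_in_image[OF signed_perms_permutes, of w n i] by simp

lemma signed_perms_outside: "w \<in> signed_perms n \<Longrightarrow> int n < \<bar>i\<bar> \<Longrightarrow> w i = i"
  using permutes_not_in[OF signed_perms_permutes, of w n i] by simp

lemma signed_perms_0: "w \<in> signed_perms n \<Longrightarrow> w 0 = 0"
  using permutes_not_in[OF signed_perms_permutes, of w n 0] by simp

lemma signed_perms_eq_0: "w \<in> signed_perms n \<Longrightarrow> w i = 0 \<longleftrightarrow> i = 0"
  using signed_perms_inj[of w n i 0] signed_perms_0[of w n] by simp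

lemma signed_perms_id: "id \<in> signed_perms n"
  by (simp add: signed_perms_def permutes_id)

lemma signed_perms_comp: "v \<in> signed_perms n \<Longrightarrow> u \<in> signed_perms n \<Longrightarrow> v \<circ> u \<in> signed_perms n"
  by (auto simp: signed_perms_def intro: permutes_compose)

lemma signed_perms_inv:
  assumes "w \<in> signed_perms n"
  shows "inv w \<in> signed_perms n"
proof -
  have p: "w permutes {i. i \<noteq> 0 \<and> \<bar>i\<bar> \<le> int n}"
    using assms by (rule signed_perms_permutes)
  have "inv w (- i) = - inv w i" for i
    using permutes_inverses[OF p] signed_perms_minus[OF assms] by metis
  then show ?thesis
    using permutes_inv[OF p] by (simp add: signed_perms_def)
qed

text \<open>Swapping a pair, or negating both entries, reverses the order of the pair and of its
  image under \<open>v\<close> alike. Whether \<open>v\<close> reverses the order is therefore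
  independent of the representative and can be tested on \<open>(u i, u j)\<close> itself.\<close>

lemma root_rep_in_Inv_iff:
  assumes "u \<in> signed_perms n" "v \<in> signed_perms n" "(i, j) \<in> roots n"
  shows "root_rep (u i) (u j) \<in> Inv n v \<longleftrightarrow> (u j < u i) \<noteq> (v (u j) < v (u i))"
proof -
  have ij: "i \<noteq> 0" "j \<noteq> 0" "\<bar>i\<bar> \<le> int n" "\<bar>j\<bar> \<le> int n" "i \<noteq> j"
    using assms(3) by (auto simp: roots_def)
  have "u i \<noteq> u j" "v (u i) \<noteq> v (u j)"
    using ij assms by (auto simp: signed_perms_inj)
  moreover have "u i \<noteq> 0" "\<bar>u i\<bar> \<le> int n" "u j \<noteq> 0" "\<bar>u j\<bar> \<le> int n"
    using signed_perms_range[OF assms(1)] ij by auto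
  ultimately show ?thesis
    by (auto simp: root_rep_def Inv_def roots_def signed_perms_minus[OF assms(2)])
qed

lemma root_rep_in_roots:
  assumes "u \<in> signed_perms n" "(i, j) \<in> roots n"
  shows "root_rep (u i) (u j) \<in> roots n"
proof -
  have ij: "i \<noteq> 0" "j \<noteq> 0" "\<bar>i\<bar> \<le> int n" "\<bar>j\<bar> \<le> int n" "i \<noteq> j"
    using assms(2) by (auto simp: roots_def)
  have "u i \<noteq> u j"
    using ij assms by (auto simp: signed_perms_inj)
  moreover have "u i \<noteq> 0" "\<bar>u i\<bar> \<le> int n" "u j \<noteq> 0" "\<bar>u j\<bar> \<le> int n"
    using signed_perms_range[OF assms(1)] ij by auto
  ultimately show ?thesis
    by (auto simp: root_rep_def roots_def)
qed

text \<open>If two representatives coincide, the image pairs differ by a swap or a joint negation.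
  As \<open>u\<close> is odd and injective, the original pairs differ in the same way, and
  \<open>roots\<close> contains only one such pair. Surjectivity follows by finiteness.\<close>

lemma root_rep_bij:
  assumes u: "u \<in> signed_perms n"
  shows "bij_betw (\<lambda>(i, j). root_rep (u i) (u j)) (roots n) (roots n)"
proof -
  have rep: "(c, d) \<in> {(a, b), (b, a), (- a, - b), (- b, - a)}" if "root_rep a b = root_rep c d"
    for a b c d
    using that by (auto simp: root_rep_def split: if_splits)
  have inj: "inj_on (\<lambda>(i, j). root_rep (u i) (u j)) (roots n)"
  proof (rule inj_onI, clarify)
    fix i j k l
    assume *: "(i, j) \<in> roots n" "(k, l) \<in> roots n"
      "root_rep (u i) (u j) = root_rep (u k) (u l)"
    have "(u k, u l) \<in> {(u i, u j), (u j, u i), (u (- i), u (- j)), (u (- j), u (- i))}"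
      using rep[OF *(3)] by (simp add: signed_perms_minus[OF u])
    then have "(k, l) \<in> {(i, j), (j, i), (- i, - j), (- j, - i)}"
      by (simp add: signed_perms_inj[OF u])
    then show "i = k \<and> j = l"
      using *(1,2) by (auto simp: roots_def)
  qed
  moreover have "(\<lambda>(i, j). root_rep (u i) (u j)) ` roots n \<subseteq> roots n"
    using root_rep_in_roots[OF u] by auto
  ultimately show ?thesis
    by (simp add: bij_betw_def endo_inj_surj)
qed

text \<open>
  The root sent by \<open>u\<close> to an inversion of \<open>v\<close> is an inversion of exactly one of \<open>u\<close> and \<open>v \<circ> u\<close>.
\<close>

lemma card_Inv_comp:
  assumes "u \<in> signed_perms n" "v \<in> signed_perms n"
  shows "card (sym_diff (Inv n u) (Inv n (v \<circ> u))) = card (Inv n v)"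
proof -
  let ?f = "\<lambda>(i, j). root_rep (u i) (u j)"
  have "bij_betw ?f {r \<in> roots n. ?f r \<in> Inv n v} {r \<in> roots n. r \<in> Inv n v}"
    by (rule bij_betw_Collect[OF root_rep_bij[OF assms(1)]]) simp
  moreover have "{r \<in> roots n. r \<in> Inv n v} = Inv n v"
    by (auto simp: Inv_def)
  moreover have "{r \<in> roots n. ?f r \<in> Inv n v} = sym_diff (Inv n u) (Inv n (v \<circ> u))"
  proof (rule set_eqI)
    fix r :: "int \<times> int"
    obtain i j where r: "r = (i, j)" by fastforce
    show "r \<in> {r \<in> roots n. ?f r \<in> Inv n v} \<longleftrightarrow> r \<in> sym_diff (Inv n u) (Inv n (v \<circ> u))"
      using root_rep_in_Inv_iff[OF assms, of i j] unfolding r by (auto simp: Inv_iff)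
  qed
  ultimately have "bij_betw ?f (sym_diff (Inv n u) (Inv n (v \<circ> u))) (Inv n v)"
    by (simp only:)
  then show ?thesis
    by (rule bij_betw_same_card)
qed

text \<open>After cancellation the equation reads 2 |A - B| = 0. This is how additivity of lengths
  becomes inclusion of inversion sets.\<close>

lemma card_sym_diff_eq_add_iff:
  assumes "finite A" "finite B"
  shows "card B = card A + card (sym_diff A B) \<longleftrightarrow> A \<subseteq> B"
proof -
  have 1: "card (sym_diff A B) = card (A - B) + card (B - A)"
    using assms by (intro card_Un_disjoint) auto
  have 2: "card A = card (A \<inter> B) + card (A - B)" "card B = card (A \<inter> B) + card (B - A)"
    using card_Int_Diff[OF assms(1), of B] card_Int_Diff[OF assms(2), of A] by (simp_all add: Int_commute)
  have "A \<subseteq> B \<longleftrightarrow> card (A - B) = 0"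
    using assms by auto
  then show ?thesis
    using 1 2 by linarith
qed

section \<open>Simple reflections, reduced words and the length\<close>

lemma simple_refl_0: "simple_refl 0 = (\<lambda>j. if j = 1 then - 1 else if j = - 1 then 1 else j)"
  by (auto simp: simple_refl_def transpose_def fun_eq_iff)

lemma simple_refl_pos:
  "0 < i \<Longrightarrow> simple_refl i = (\<lambda>j. if j = int i then int i + 1 else if j = int i + 1 then int i
     else if j = - int i then - int i - 1 else if j = - int i - 1 then - int i else j)"
  by (auto simp: simple_refl_def transpose_def fun_eq_iff)

lemma simple_refl_invol: "simple_refl i \<circ> simple_refl i = id"
  by (cases "i = 0") (auto simp: simple_refl_0 simple_refl_pos fun_eq_iff)

lemma simple_refl_signed_perms:
  assumes "i < n"
  shows "simple_refl i \<in> signed_perms n"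
proof -
  have "bij (simple_refl i)"
    using simple_refl_invol by (rule o_bij) (rule simple_refl_invol)
  then have "\<exists>!x. simple_refl i x = y" for y
    by (metis bij_def inj_eq surjD)
  moreover have "simple_refl i x = x" if "\<not> (x \<noteq> 0 \<and> \<bar>x\<bar> \<le> int n)" for x
    using that assms by (cases "i = 0") (auto simp: simple_refl_0 simple_refl_pos)
  moreover have "simple_refl i (- x) = - simple_refl i x" for x
    by (cases "i = 0") (auto simp: simple_refl_0 simple_refl_pos)
  ultimately show ?thesis
    by (auto simp: signed_perms_def permutes_def)
qed

definition simple_root :: "nat \<Rightarrow> int \<times> int" where
  "simple_root i = (if i = 0 then (- 1, 1) else (int i, int i + 1))"

lemma Inv_simple_refl:
  assumes "i < n"
  shows "Inv n (simple_refl i) = {simple_root i}"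
proof -
  have "(a, b) \<in> Inv n (simple_refl i) \<longleftrightarrow> (a, b) = simple_root i" for a b
  proof (cases "i = 0")
    case True
    then show ?thesis
      using assms unfolding Inv_iff simple_root_def roots_def
      by (simp add: simple_refl_0)
  next
    case False
    then show ?thesis
      using assms unfolding Inv_iff simple_root_def roots_def
      by (simp add: simple_refl_pos)
  qed
  then show ?thesis
    by auto
qed

lemma simple_root_in_roots: "i < n \<Longrightarrow> simple_root i \<in> roots n"
  by (auto simp: simple_root_def roots_def)

lemma simple_root_descent_iff:
  assumes "w \<in> signed_perms n" "i < n"
  shows "simple_root i \<in> Inv n (w \<circ> simple_refl i) \<longleftrightarrow> simple_root i \<notin> Inv n w"
proof -
  have "w (int i) \<noteq> w (int i + 1)" "w (- 1) \<noteq> w 1"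
    using assms(1) by (auto simp: signed_perms_inj)
  then show ?thesis
    using simple_root_in_roots[OF assms(2)]
    by (cases "i = 0") (auto simp: Inv_def simple_root_def simple_refl_0 simple_refl_pos)
qed

text \<open>\<open>card_Inv_comp\<close> with the simple reflection as inner factor compares a
  singleton with the inversion set of \<open>w \<circ> simple_refl i\<close>. At a descent the two
  are disjoint, so the symmetric difference is a union and has one element more.\<close>

lemma card_Inv_descent:
  assumes "w \<in> signed_perms n" "i < n" "simple_root i \<in> Inv n w"
  shows "card (Inv n w) = Suc (card (Inv n (w \<circ> simple_refl i)))"
proof -
  have "simple_root i \<notin> Inv n (w \<circ> simple_refl i)"
    using assms simple_root_descent_iff by blast
  then have "sym_diff {simple_root i} (Inv n (w \<circ> simple_refl i))
      = insert (simple_root i) (Inv n (w \<circ> simple_refl i))"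
    by blast
  moreover have "card (insert (simple_root i) (Inv n (w \<circ> simple_refl i)))
      = Suc (card (Inv n (w \<circ> simple_refl i)))"
    using \<open>simple_root i \<notin> _\<close> by (rule card_insert_disjoint[OF finite_Inv])
  moreover have "card (sym_diff {simple_root i} (Inv n (w \<circ> simple_refl i))) = card (Inv n w)"
    using card_Inv_comp[OF simple_refl_signed_perms[OF assms(2)] assms(1)]
    by (simp only: Inv_simple_refl[OF assms(2)])
  ultimately show ?thesis
    by (simp only:)
qed

text \<open>Without descents the values satisfy 0 < w 1 < ... < w n; the first inequality comes from
  the short simple root, as \<open>w (- 1) = - w 1\<close>. Counting up from 0 and down from
  \<open>n\<close> squeezes every value to its index.\<close>

lemma signed_perm_eq_idI:
  assumes w: "w \<in> signed_perms n" and no_descent: "\<And>i. i < n \<Longrightarrow> simple_root i \<notin> Inv n w"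
  shows "w = id"
proof -
  have step: "w (int i) < w (int i + 1)" if "i < n" for i
  proof (cases "i = 0")
    case True
    have "w (- 1) \<le> w 1"
      using no_descent[of i] simple_root_in_roots[of i n] that True
      by (auto simp: Inv_def simple_root_def)
    moreover have "w (- 1) = - w 1" "w 1 \<noteq> 0" "w 0 = 0"
      using signed_perms_0[OF w] signed_perms_minus[OF w] signed_perms_range[OF w, of 1] \<open>i < n\<close> by simp_all
    ultimately show ?thesis
      using True by simp
  next
    case False
    have "w (int i) \<le> w (int i + 1)" "w (int i) \<noteq> w (int i + 1)"
      using no_descent[of i] simple_root_in_roots[of i n] that False
      by (auto simp: Inv_def simple_root_def signed_perms_inj[OF w])
    then show ?thesis by simp
  qed
  have ge: "int i \<le> w (int i)" if "i \<le> n" for i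
    using that
  proof (induction i)
    case 0
    then show ?case using signed_perms_0[OF w] by simp
  next
    case (Suc i)
    then show ?case using step[of i] by (simp add: add.commute)
  qed
  have le: "w (int i) \<le> int i" if "i \<le> n" for i
    using that
  proof (induction rule: inc_induct)
    case base
    then show ?case
      using signed_perms_range[OF w, of "int n"] signed_perms_0[OF w] by (cases "n = 0") auto
  next
    case (step m)
    then show ?case using \<open>\<And>i. i < n \<Longrightarrow> w (int i) < w (int i + 1)\<close>[of m] by (simp add: add.commute)
  qed
  have *: "w (int i) = int i" for i
    using ge[of i] le[of i] signed_perms_outside[OF w, of "int i"] by (cases "i \<le> n") auto
  have "w j = j" for j
    using *[of "nat j"] *[of "nat (- j)"] signed_perms_minus[OF w, of j]
    by (cases "0 \<le> j") auto
  then show ?thesis by auto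
qed

lemma foldr_simple_refl_signed_perms:
  "set rs \<subseteq> simple_refl ` {..<n} \<Longrightarrow> foldr (\<circ>) rs id \<in> signed_perms n"
  by (induction rs) (auto simp: signed_perms_id intro!: signed_perms_comp simple_refl_signed_perms)

text \<open>A generator multiplied from the left changes the inversion set in exactly one root,
  since \<open>card_Inv_comp\<close> measures the change by the inversions of the left
  factor.\<close>

lemma card_Inv_foldr_le:
  "set rs \<subseteq> simple_refl ` {..<n} \<Longrightarrow> card (Inv n (foldr (\<circ>) rs id)) \<le> length rs"
proof (induction rs)
  case Nil
  have "Inv n (\<lambda>x. x) = {}"
    by (auto simp: Inv_def roots_def)
  then show ?case by (simp add: id_def)
next
  case (Cons r rs)
  let ?u = "foldr (\<circ>) rs id"
  obtain i where i: "i < n" "r = simple_refl i"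
    using Cons.prems by auto
  have "Inv n (r \<circ> ?u) \<subseteq> Inv n ?u \<union> sym_diff (Inv n ?u) (Inv n (r \<circ> ?u))"
    by auto
  then have "card (Inv n (r \<circ> ?u)) \<le> card (Inv n ?u \<union> sym_diff (Inv n ?u) (Inv n (r \<circ> ?u)))"
    by (intro card_mono) auto
  also have "\<dots> \<le> card (Inv n ?u) + card (sym_diff (Inv n ?u) (Inv n (r \<circ> ?u)))"
    by (rule card_Un_le)
  also have "card (sym_diff (Inv n ?u) (Inv n (r \<circ> ?u))) = 1"
    using card_Inv_comp[of ?u n r] foldr_simple_refl_signed_perms[of rs n] Cons.prems i
      simple_refl_signed_perms Inv_simple_refl by simp
  finally show ?case
    using Cons by simp
qed

text \<open>Sorting: as long as a descent exists, a simple reflection on the right removes exactly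
  one inversion, and only the identity has no descent.\<close>

lemma reduced_word_exists:
  assumes "w \<in> signed_perms n"
  shows "\<exists>rs. length rs = card (Inv n w) \<and> set rs \<subseteq> simple_refl ` {..<n} \<and> w = foldr (\<circ>) rs id"
  using assms
proof (induction "card (Inv n w)" arbitrary: w)
  case 0
  then have "Inv n w = {}" by simp
  then have "w = id"
    using signed_perm_eq_idI[OF 0(2)] by auto
  with 0 show ?case by (intro exI[of _ "[]"]) auto
next
  case (Suc k)
  have "\<exists>i<n. simple_root i \<in> Inv n w"
  proof (rule ccontr)
    assume "\<not> (\<exists>i<n. simple_root i \<in> Inv n w)"
    then have "w = id"
      using signed_perm_eq_idI[OF Suc(3)] by auto
    then have "Inv n w = {}"
      by (auto simp: Inv_def roots_def)
    with Suc(2) show False by simp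
  qed
  then obtain i where i: "i < n" "simple_root i \<in> Inv n w"
    by auto
  have "card (Inv n w) = Suc (card (Inv n (w \<circ> simple_refl i)))"
    using card_Inv_descent Suc(3) i by blast
  then obtain rs where rs: "length rs = k" "set rs \<subseteq> simple_refl ` {..<n}"
    "w \<circ> simple_refl i = foldr (\<circ>) rs id"
    using Suc(1)[of "w \<circ> simple_refl i"] Suc(2) signed_perms_comp[OF Suc(3) simple_refl_signed_perms[OF i(1)]]
    by auto
  have fold: "foldr (\<circ>) rs f = foldr (\<circ>) rs id \<circ> f" for f :: "int \<Rightarrow> int"
    by (induction rs) auto
  have "w = w \<circ> simple_refl i \<circ> simple_refl i"
    unfolding comp_assoc simple_refl_invol by simp
  also have "\<dots> = foldr (\<circ>) rs id \<circ> simple_refl i"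
    unfolding rs(3) ..
  also have "\<dots> = foldr (\<circ>) (rs @ [simple_refl i]) id"
    using fold[of "simple_refl i"] by simp
  finally have "w = foldr (\<circ>) (rs @ [simple_refl i]) id" .
  moreover have "length (rs @ [simple_refl i]) = card (Inv n w)"
    using rs(1) Suc(2) by simp
  moreover have "set (rs @ [simple_refl i]) \<subseteq> simple_refl ` {..<n}"
    using rs(2) i(1) by auto
  ultimately show ?case
    by blast
qed

lemma cox_length_eq_card_Inv:
  assumes "w \<in> signed_perms n"
  shows "cox_length n w = card (Inv n w)"
  unfolding cox_length_def
proof (rule Least_equality)
  show "\<exists>rs. length rs = card (Inv n w) \<and> set rs \<subseteq> simple_refl ` {..<n} \<and> w = foldr (\<circ>) rs id"
    using assms by (rule reduced_word_exists)
qed (use card_Inv_foldr_le in blast)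

text \<open>The length of \<open>w \<circ> inv u\<close> is the size of the symmetric difference of
  the two inversion sets, so additivity of lengths is the equation of
  \<open>card_sym_diff_eq_add_iff\<close>.\<close>

lemma left_weak_le_iff_Inv_subset:
  assumes "u \<in> signed_perms n" "w \<in> signed_perms n"
  shows "left_weak_le n u w \<longleftrightarrow> Inv n u \<subseteq> Inv n w"
proof -
  have v: "w \<circ> inv u \<in> signed_perms n"
    using assms by (intro signed_perms_comp signed_perms_inv)
  have "w \<circ> inv u \<circ> u = w"
    using permutes_inv_o(2)[OF signed_perms_permutes[OF assms(1)]] by (simp add: comp_assoc)
  then have "card (Inv n (w \<circ> inv u)) = card (sym_diff (Inv n u) (Inv n w))"
    using card_Inv_comp[OF assms(1) v] by simp
  then show ?thesis
    using card_sym_diff_eq_add_iff[of "Inv n u" "Inv n w"] assms v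
    by (simp add: left_weak_le_def cox_length_eq_card_Inv)
qed

section \<open>Generating functions of words\<close>

text \<open>
  Suffix \<open>A\<close>: only inversions \<open>x\<^sub>i > x\<^sub>j\<close> count, as in the symmetric group; suffix \<open>B\<close>: all inversions
  of the hyperoctahedral group count. In \<open>ZA w\<close> and \<open>ZB w\<close> the word \<open>w\<close> need not be standardized.
\<close>

definition lenA :: "int list \<Rightarrow> nat" where
  "lenA x = (\<Sum>j<length x. \<Sum>i<j. of_bool (x ! j < x ! i))"

definition lenB :: "int list \<Rightarrow> nat" where
  "lenB x = (\<Sum>j<length x. of_bool (x ! j < 0)
     + (\<Sum>i<j. of_bool (x ! j < x ! i) + of_bool (x ! j < - (x ! i))))"

definition leA :: "int list \<Rightarrow> int list \<Rightarrow> bool" where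
  "leA x w \<longleftrightarrow> (\<forall>j<length x. \<forall>i<j. x ! j < x ! i \<longrightarrow> w ! j < w ! i)"

definition leB :: "int list \<Rightarrow> int list \<Rightarrow> bool" where
  "leB x w \<longleftrightarrow> (\<forall>j<length x. (x ! j < 0 \<longrightarrow> w ! j < 0)
     \<and> (\<forall>i<j. (x ! j < x ! i \<longrightarrow> w ! j < w ! i) \<and> (x ! j < - (x ! i) \<longrightarrow> w ! j < - (w ! i))))"

text \<open>For \<open>A = {1..n}\<close> these are the one-line words of B_n. Other alphabets arise
  as the absolute values left over once the letters of a right block are chosen.\<close>

definition signed_words :: "int set \<Rightarrow> int list set" where
  "signed_words A = {x. distinct (map abs x) \<and> abs ` set x = A}"

definition ZA :: "int list \<Rightarrow> int poly" where
  "ZA w = (\<Sum>x\<in>{x \<in> permutations_of_set {1..int (length w)}. leA x w}. monom 1 (lenA x))"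

definition ZB :: "int list \<Rightarrow> int poly" where
  "ZB w = (\<Sum>x\<in>{x \<in> signed_words {1..int (length w)}. leB x w}. monom 1 (lenB x))"

lemma sum_lessThan_add:
  fixes f :: "nat \<Rightarrow> 'a :: comm_monoid_add"
  shows "(\<Sum>j<p + q. f j) = (\<Sum>j<p. f j) + (\<Sum>j<q. f (p + j))"
  by (induction q) (simp_all add: add.assoc)

lemma sum_nth_distinct: "distinct x \<Longrightarrow> (\<Sum>i<length x. f (x ! i)) = (\<Sum>a\<in>set x. f a)"
  by (rule sum.reindex_bij_betw[OF bij_betw_nth]) auto

text \<open>The cross term is a sum over letters, not positions: it ignores how each block is
  arranged and becomes a constant once the letter sets of the blocks are fixed.\<close>

lemma lenA_append:
  assumes "distinct x" "distinct y"
  shows "lenA (x @ y) = lenA x + lenA y + (\<Sum>b\<in>set y. \<Sum>a\<in>set x. of_bool (b < a))"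
proof -
  have "(\<Sum>j<length y. \<Sum>i<length x. of_bool (y ! j < x ! i) :: nat)
      = (\<Sum>b\<in>set y. \<Sum>a\<in>set x. of_bool (b < a))"
    unfolding sum_nth_distinct[OF assms(1), of "\<lambda>a. of_bool (b < a)" for b]
    by (rule sum_nth_distinct[OF assms(2), of "\<lambda>b. \<Sum>a\<in>set x. of_bool (b < a)"])
  then show ?thesis
    by (simp add: lenA_def sum_lessThan_add nth_append sum.distrib del: sum_of_bool_eq)
qed

lemma lenB_append:
  assumes "distinct x" "distinct y"
  shows "lenB (x @ y) = lenB x + lenB y
    + (\<Sum>b\<in>set y. \<Sum>a\<in>set x. of_bool (b < a) + of_bool (b < - a))"
proof -
  have "(\<Sum>j<length y. \<Sum>i<length x. of_bool (y ! j < x ! i) + of_bool (y ! j < - (x ! i)) :: nat)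
      = (\<Sum>b\<in>set y. \<Sum>a\<in>set x. of_bool (b < a) + of_bool (b < - a))"
    unfolding sum_nth_distinct[OF assms(1), of "\<lambda>a. of_bool (b < a) + of_bool (b < - a)" for b]
    by (rule sum_nth_distinct[OF assms(2),
        of "\<lambda>b. \<Sum>a\<in>set x. of_bool (b < a) + of_bool (b < - a)"])
  then show ?thesis
    by (simp add: lenB_def sum_lessThan_add nth_append sum.distrib del: sum_of_bool_eq)
qed

text \<open>
  The pairs with negative sum depend only on the set of letters. Summing over all ordered pairs counts
  each of them twice and each negative letter once more, whence the division by two.
\<close>

definition neg_count :: "int set \<Rightarrow> nat" where
  "neg_count S = ((\<Sum>b\<in>S. \<Sum>a\<in>S. of_bool (b < - a)) + (\<Sum>b\<in>S. of_bool (b < 0))) div 2"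

text \<open>Doubling clears the division. A new last letter \<open>c\<close> meets every earlier
  letter in both orders of the double sum, and its diagonal term \<open>c < - c\<close> means
  \<open>c < 0\<close>, so each contribution occurs exactly twice.\<close>

lemma lenB_eq_lenA_add:
  assumes "distinct y"
  shows "lenB y = lenA y + neg_count (set y)"
proof -
  have "2 * lenB y = 2 * lenA y
      + ((\<Sum>b\<in>set y. \<Sum>a\<in>set y. of_bool (b < - a)) + (\<Sum>b\<in>set y. of_bool (b < 0)))"
    using assms
  proof (induction y rule: rev_induct)
    case Nil
    then show ?case by (simp add: lenA_def lenB_def)
  next
    case (snoc c y)
    have "lenA [c] = 0" "lenB [c] = of_bool (c < 0)"
      by (simp_all add: lenA_def lenB_def)
    moreover have "(\<Sum>b\<in>set y. of_bool (b < - c)) = (\<Sum>b\<in>set y. of_bool (c < - b) :: nat)"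
      by (intro sum.cong) auto
    moreover have "c < - c \<longleftrightarrow> c < 0"
      by auto
    ultimately show ?case
      using snoc by (simp add: lenA_append lenB_append sum.distrib del: sum_of_bool_eq)
  qed
  then show ?thesis
    by (simp add: neg_count_def)
qed

lemma leA_append:
  assumes "length u = length x"
  shows "leA (x @ y) (u @ v) \<longleftrightarrow> leA x u \<and> leA y v
    \<and> (\<forall>j<length y. \<forall>i<length x. y ! j < x ! i \<longrightarrow> v ! j < u ! i)" (is "?l \<longleftrightarrow> ?r")
proof
  assume l: ?l
  have "leA x u"
    unfolding leA_def
  proof (intro allI impI)
    fix j i
    assume "j < length x" "i < j" "x ! j < x ! i"
    then show "u ! j < u ! i"
      using l[unfolded leA_def, rule_format, of j i] assms by (simp add: nth_append)
  qed
  moreover have "leA y v"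
    unfolding leA_def
  proof (intro allI impI)
    fix j i
    assume "j < length y" "i < j" "y ! j < y ! i"
    then show "v ! j < v ! i"
      using l[unfolded leA_def, rule_format, of "length x + j" "length x + i"] assms
      by (simp add: nth_append)
  qed
  moreover have "v ! j < u ! i" if "j < length y" "i < length x" "y ! j < x ! i" for i j
    using l[unfolded leA_def, rule_format, of "length x + j" i] assms that
    by (simp add: nth_append)
  ultimately show ?r by blast
next
  assume r: ?r
  show ?l
    unfolding leA_def
  proof (intro allI impI)
    fix j i
    assume *: "j < length (x @ y)" "i < j" "(x @ y) ! j < (x @ y) ! i"
    consider "j < length x" | "\<not> j < length x" "i < length x" | "\<not> i < length x" "\<not> j < length x"
      using * by linarith
    then show "(u @ v) ! j < (u @ v) ! i"
    proof cases
      case 1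
      then show ?thesis using r * assms by (simp add: leA_def nth_append)
    next
      case 2
      then show ?thesis using r * assms by (simp add: nth_append)
    next
      case 3
      moreover have "j - length x < length y" "i - length x < j - length x"
        using * 3 by auto
      ultimately show ?thesis using r * assms by (simp add: leA_def nth_append)
    qed
  qed
qed

lemma leB_append:
  assumes "length u = length x"
  shows "leB (x @ y) (u @ v) \<longleftrightarrow> leB x u \<and> leB y v
    \<and> (\<forall>j<length y. \<forall>i<length x. (y ! j < x ! i \<longrightarrow> v ! j < u ! i)
          \<and> (y ! j < - (x ! i) \<longrightarrow> v ! j < - (u ! i)))" (is "?l \<longleftrightarrow> ?r")
proof
  assume l: ?l
  have "leB x u"
    unfolding leB_def
  proof (intro allI impI conjI)
    fix j
    assume j: "j < length x"
    then show "u ! j < 0" if "x ! j < 0"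
      using that l[unfolded leB_def, rule_format, of j] assms by (simp add: nth_append)
    fix i
    assume "i < j"
    then show "u ! j < u ! i" if "x ! j < x ! i"
      using that j l[unfolded leB_def, rule_format, of j] assms by (simp add: nth_append)
    show "u ! j < - (u ! i)" if "x ! j < - (x ! i)"
      using that j \<open>i < j\<close> l[unfolded leB_def, rule_format, of j] assms by (simp add: nth_append)
  qed
  moreover have "leB y v"
    unfolding leB_def
  proof (intro allI impI conjI)
    fix j
    assume j: "j < length y"
    have *: "(y ! j < 0 \<longrightarrow> v ! j < 0) \<and> (\<forall>i<length x + j.
        (y ! j < (x @ y) ! i \<longrightarrow> v ! j < (u @ v) ! i)
        \<and> (y ! j < - ((x @ y) ! i) \<longrightarrow> v ! j < - ((u @ v) ! i)))"
      using l[unfolded leB_def, rule_format, of "length x + j"] j assms by (simp add: nth_append)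
    show "v ! j < 0" if "y ! j < 0"
      using that * by simp
    fix i
    assume "i < j"
    show "v ! j < v ! i" if "y ! j < y ! i"
      using that \<open>i < j\<close> *[THEN conjunct2, rule_format, of "length x + i"] assms
      by (simp add: nth_append)
    show "v ! j < - (v ! i)" if "y ! j < - (y ! i)"
      using that \<open>i < j\<close> *[THEN conjunct2, rule_format, of "length x + i"] assms
      by (simp add: nth_append)
  qed
  moreover have "(y ! j < x ! i \<longrightarrow> v ! j < u ! i) \<and> (y ! j < - (x ! i) \<longrightarrow> v ! j < - (u ! i))"
    if "j < length y" "i < length x" for i j
    using l[unfolded leB_def, rule_format, of "length x + j", THEN conjunct2, rule_format, of i]
      assms that by (simp add: nth_append)
  ultimately show ?r by blast
next
  assume r: ?r
  have cases: "((x @ y) ! j < 0 \<longrightarrow> (u @ v) ! j < 0)" if "j < length (x @ y)" for j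
    using r that assms by (simp add: leB_def nth_append)
  have "((x @ y) ! j < (x @ y) ! i \<longrightarrow> (u @ v) ! j < (u @ v) ! i)
      \<and> ((x @ y) ! j < - ((x @ y) ! i) \<longrightarrow> (u @ v) ! j < - ((u @ v) ! i))"
    if *: "j < length (x @ y)" "i < j" for i j
  proof -
    consider "j < length x" | "\<not> j < length x" "i < length x" | "\<not> i < length x" "\<not> j < length x"
      using * by linarith
    then show ?thesis
    proof cases
      case 1
      then show ?thesis using r * assms by (simp add: leB_def nth_append)
    next
      case 2
      then show ?thesis using r * assms by (simp add: nth_append)
    next
      case 3
      moreover have "j - length x < length y" "i - length x < j - length x"
        using * 3 by auto
      ultimately show ?thesis using r * assms by (simp add: leB_def nth_append)
    qed
  qed
  with cases show ?l
    unfolding leB_def by blast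
qed

section \<open>Change of alphabet\<close>

lemma abs_mem_imp_signed:
  assumes "\<bar>t\<bar> \<in> A"
  shows "(t :: int) \<in> A \<union> uminus ` A"
proof (cases "0 \<le> t")
  case False
  then have "t = - \<bar>t\<bar>" by simp
  with assms show ?thesis by blast
qed (use assms in simp)

lemma finite_signed_words [simp]: "finite A \<Longrightarrow> finite (signed_words A)"
proof (rule finite_subset)
  assume "finite A"
  then show "finite {x. set x \<subseteq> A \<union> uminus ` A \<and> length x = card A}"
    by (intro finite_lists_length_eq) auto
  show "signed_words A \<subseteq> {x. set x \<subseteq> A \<union> uminus ` A \<and> length x = card A}"
  proof
    fix x
    assume x: "x \<in> signed_words A"
    have "t \<in> A \<union> uminus ` A" if "t \<in> set x" for t
      using that x by (intro abs_mem_imp_signed) (auto simp: signed_words_def)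
    moreover have "length x = card A"
      using x distinct_card[of "map abs x"] by (auto simp: signed_words_def)
    ultimately show "x \<in> {x. set x \<subseteq> A \<union> uminus ` A \<and> length x = card A}"
      by auto
  qed
qed

lemma signed_words_length: "x \<in> signed_words A \<Longrightarrow> length x = card A"
  using distinct_card[of "map abs x"] by (auto simp: signed_words_def)

lemma distinct_map_absD: "distinct (map abs (x :: int list)) \<Longrightarrow> distinct x"
  by (simp add: distinct_map)

lemma lenA_map:
  assumes "strict_mono_on S f" "set x \<subseteq> S"
  shows "lenA (map f x) = lenA x"
proof -
  have "f (x ! j) < f (x ! i) \<longleftrightarrow> x ! j < x ! i" if "i < length x" "j < length x" for i j
    using assms that by (intro strict_mono_on_less) (auto dest: nth_mem)
  then show ?thesis
    unfolding lenA_def by (intro sum.cong) auto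
qed

lemma leA_map_left:
  assumes "strict_mono_on S f" "set x \<subseteq> S"
  shows "leA (map f x) w \<longleftrightarrow> leA x w"
proof -
  have "f (x ! j) < f (x ! i) \<longleftrightarrow> x ! j < x ! i" if "i < length x" "j < length x" for i j
    using assms that by (intro strict_mono_on_less) (auto dest: nth_mem)
  then show ?thesis
    unfolding leA_def by auto
qed

definition rankA :: "int set \<Rightarrow> int \<Rightarrow> int" where
  "rankA S x = int (card {t \<in> S. t \<le> x})"

text \<open>For positive \<open>A\<close> this is the odd extension of \<open>rankA\<close>. Being
  odd, it preserves comparisons with negatives of letters as well, which is what type B inversions
  require.\<close>

definition rankB :: "int set \<Rightarrow> int \<Rightarrow> int" where
  "rankB A x = sgn x * int (card {t \<in> A. t \<le> \<bar>x\<bar>})"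

lemma strict_mono_on_rankA:
  assumes "finite S"
  shows "strict_mono_on S (rankA S)"
proof (rule strict_mono_onI)
  fix a b
  assume "a \<in> S" "b \<in> S" "a < b"
  then have "{t \<in> S. t \<le> a} \<subseteq> {t \<in> S. t \<le> b}" "b \<in> {t \<in> S. t \<le> b}" "b \<notin> {t \<in> S. t \<le> a}"
    by auto
  then have "{t \<in> S. t \<le> a} \<subset> {t \<in> S. t \<le> b}"
    by blast
  then show "rankA S a < rankA S b"
    using assms by (simp add: rankA_def psubset_card_mono)
qed

lemma rankA_image:
  assumes "finite S"
  shows "rankA S ` S = {1..int (card S)}"
proof (rule card_subset_eq)
  have "rankA S x \<in> {1..int (card S)}" if "x \<in> S" for x
  proof -
    have "card {t \<in> S. t \<le> x} \<le> card S"
      using assms by (intro card_mono) auto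
    moreover have "card {t \<in> S. t \<le> x} > 0"
      using assms that by (auto simp: card_gt_0_iff)
    ultimately show ?thesis
      by (simp add: rankA_def)
  qed
  then show "rankA S ` S \<subseteq> {1..int (card S)}"
    by auto
  show "card (rankA S ` S) = card {1..int (card S)}"
    using card_image[OF strict_mono_on_imp_inj_on[OF strict_mono_on_rankA[OF assms]]] by simp
qed simp

text \<open>The letters of a block are in general not consecutive. Relabelling them increasingly
  changes neither inversions nor the comparison with \<open>w\<close>, so the block sum does not
  depend on the letters.\<close>

lemma ZA_any_alphabet:
  assumes "finite S" "card S = length w"
  shows "(\<Sum>y\<in>{y \<in> permutations_of_set S. leA y w}. monom 1 (lenA y)) = ZA w"
proof -
  let ?f = "rankA S"
  have mono: "strict_mono_on S ?f"
    using assms(1) by (rule strict_mono_on_rankA)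
  then have inj: "inj_on ?f S"
    by (rule strict_mono_on_imp_inj_on)
  have perms: "permutations_of_set {1..int (length w)} = map ?f ` permutations_of_set S"
    using permutations_of_set_image_inj[OF inj] rankA_image[OF assms(1)] assms(2) by simp
  have "inj_on (map ?f) {y \<in> permutations_of_set S. leA y w}"
    by (rule inj_onI) (auto simp: permutations_of_set_def inj_on_map_eq_map inj)
  moreover have "{y \<in> permutations_of_set {1..int (length w)}. leA y w}
      = map ?f ` {y \<in> permutations_of_set S. leA y w}"
    unfolding perms using leA_map_left[OF mono] by (auto simp: permutations_of_set_def)
  ultimately show ?thesis
    using lenA_map[OF mono] by (simp add: ZA_def sum.reindex permutations_of_set_def)
qed

lemma rankB_minus: "rankB A (- x) = - rankB A x"
  by (simp add: rankB_def sgn_minus)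

lemma rankB_abs: "\<bar>rankB A x\<bar> = rankB A \<bar>x\<bar>"
  by (simp add: rankB_def abs_mult sgn_if)

lemma rankB_pos: "0 < x \<Longrightarrow> rankB A x = rankA A x"
  by (simp add: rankA_def rankB_def)

lemma strict_mono_on_rankB:
  assumes "finite A" "\<forall>a\<in>A. 0 < a"
  shows "strict_mono_on (A \<union> uminus ` A) (rankB A)"
proof (rule strict_mono_onI)
  have pos: "0 < rankB A a" if "a \<in> A" for a
  proof -
    have "rankA A a \<in> {1..int (card A)}"
      unfolding rankA_image[OF assms(1), symmetric] using that by (rule imageI)
    then show ?thesis
      using assms that by (simp add: rankB_pos)
  qed
  have less: "rankB A a < rankB A b" if "a \<in> A" "b \<in> A" "a < b" for a b
    using assms that strict_mono_onD[OF strict_mono_on_rankA[OF assms(1)]] by (simp add: rankB_pos)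
  fix a b
  assume ab: "a \<in> A \<union> uminus ` A" "b \<in> A \<union> uminus ` A" "a < b"
  consider "a \<in> A" "b \<in> A" | "- a \<in> A" "b \<in> A" | "- a \<in> A" "- b \<in> A" | "a \<in> A" "- b \<in> A"
    using ab by auto
  then show "rankB A a < rankB A b"
  proof cases
    case 1
    then show ?thesis using less ab by simp
  next
    case 2
    then show ?thesis using pos[of "- a"] pos[of b] by (simp add: rankB_minus)
  next
    case 3
    then show ?thesis using less[of "- b" "- a"] ab by (simp add: rankB_minus)
  next
    case 4
    then show ?thesis
      using ab assms(2)[rule_format, of a] assms(2)[rule_format, of "- b"] by linarith
  qed
qed

lemma rankB_less_iff:
  assumes "finite A" "\<forall>a\<in>A. 0 < a" "\<bar>s\<bar> \<in> A" "\<bar>t\<bar> \<in> A"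
  shows "rankB A s < rankB A t \<longleftrightarrow> s < t"
  by (rule strict_mono_on_less[OF strict_mono_on_rankB[OF assms(1,2)]])
    (intro abs_mem_imp_signed assms(3,4))+

lemma rankB_less_minus_iff:
  assumes "finite A" "\<forall>a\<in>A. 0 < a" "\<bar>s\<bar> \<in> A" "\<bar>t\<bar> \<in> A"
  shows "rankB A s < - rankB A t \<longleftrightarrow> s < - t"
  using rankB_less_iff[of A s "- t"] assms by (simp add: rankB_minus)

lemma rankB_neg_iff:
  assumes "finite A" "\<bar>s\<bar> \<in> A"
  shows "rankB A s < 0 \<longleftrightarrow> s < 0"
proof -
  have "card {t \<in> A. t \<le> \<bar>s\<bar>} > 0"
    using assms by (auto simp: card_gt_0_iff)
  then show ?thesis
    by (auto simp: rankB_def sgn_if)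
qed

lemmas rankB_less_iffs = rankB_less_iff rankB_less_minus_iff

lemma lenB_map_rankB:
  assumes "finite A" "\<forall>a\<in>A. 0 < a" "abs ` set x \<subseteq> A"
  shows "lenB (map (rankB A) x) = lenB x"
proof -
  have "\<bar>x ! i\<bar> \<in> A" if "i < length x" for i
    using assms(3) that by (auto dest: nth_mem)
  then show ?thesis
    unfolding lenB_def using rankB_less_iffs[OF assms(1,2)] rankB_neg_iff[OF assms(1)]
    by (intro sum.cong arg_cong2[where f = "(+)"]) auto
qed

lemma leB_map_rankB_left:
  assumes "finite A" "\<forall>a\<in>A. 0 < a" "abs ` set x \<subseteq> A"
  shows "leB (map (rankB A) x) w \<longleftrightarrow> leB x w"
proof -
  have "\<bar>x ! i\<bar> \<in> A" if "i < length x" for i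
    using assms(3) that by (auto dest: nth_mem)
  then show ?thesis
    unfolding leB_def using rankB_less_iffs[OF assms(1,2)] rankB_neg_iff[OF assms(1)] by auto
qed

lemma leB_map_rankB_right:
  assumes "finite A" "\<forall>a\<in>A. 0 < a" "abs ` set w \<subseteq> A" "length x \<le> length w"
  shows "leB x (map (rankB A) w) \<longleftrightarrow> leB x w"
proof -
  have "\<bar>w ! i\<bar> \<in> A" if "i < length w" for i
    using assms(3) that by (auto dest: nth_mem)
  then show ?thesis
    unfolding leB_def using assms(4) rankB_less_iffs[OF assms(1,2)] rankB_neg_iff[OF assms(1)]
    by auto
qed

text \<open>On absolute values the map acts as the injective \<open>rankA\<close>, so distinctness
  and the set of absolute values transfer. For surjectivity every letter is pulled back together
  with its sign.\<close>

lemma map_rankB_signed_words: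
  assumes "finite A" "\<forall>a\<in>A. 0 < a"
  shows "map (rankB A) ` signed_words A = signed_words {1..int (card A)}"
proof -
  have abs_map: "map abs (map (rankB A) x) = map (rankA A) (map abs x)" if "abs ` set x \<subseteq> A" for x
    using that assms(2) by (auto simp: rankB_abs intro!: rankB_pos)
  have inj: "inj_on (rankA A) A"
    by (intro strict_mono_on_imp_inj_on strict_mono_on_rankA assms(1))
  have A: "rankA A ` A = {1..int (card A)}"
    using assms(1) by (rule rankA_image)
  have iff: "map (rankB A) x \<in> signed_words {1..int (card A)} \<longleftrightarrow> x \<in> signed_words A"
    if "abs ` set x \<subseteq> A" for x
  proof -
    have "distinct (map abs (map (rankB A) x)) \<longleftrightarrow> distinct (map abs x)"
      unfolding abs_map[OF that] distinct_map[of "rankA A"]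
      using inj_on_subset[OF inj that] by auto
    moreover have "abs ` set (map (rankB A) x) = rankA A ` (abs ` set x)"
      using abs_map[OF that] by (metis list.set_map)
    moreover have "rankA A ` (abs ` set x) = rankA A ` A \<longleftrightarrow> abs ` set x = A"
      using inj_on_image_eq_iff[OF inj that] by simp
    ultimately show ?thesis
      by (simp add: signed_words_def flip: A)
  qed
  have "z \<in> map (rankB A) ` signed_words A" if z: "z \<in> signed_words {1..int (card A)}" for z
  proof -
    have "t \<in> rankB A ` {s. \<bar>s\<bar> \<in> A}" if "t \<in> set z" for t
    proof -
      have "\<bar>t\<bar> \<in> rankA A ` A"
        using that z A by (auto simp: signed_words_def)
      then obtain a where a: "a \<in> A" "\<bar>t\<bar> = rankB A a"
        using assms(2) by (auto simp: rankB_pos)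
      have "t = rankB A (if 0 \<le> t then a else - a)"
        using a by (auto simp: rankB_minus)
      then show ?thesis
        using a assms(2) by (intro image_eqI[where x = "if 0 \<le> t then a else - a"]) auto
    qed
    then have "z \<in> lists (rankB A ` {s. \<bar>s\<bar> \<in> A})"
      by auto
    then obtain x where "z = map (rankB A) x" "x \<in> lists {s. \<bar>s\<bar> \<in> A}"
      unfolding lists_image by auto
    then show ?thesis
      using iff[of x] z by auto
  qed
  moreover have "map (rankB A) x \<in> signed_words {1..int (card A)}" if "x \<in> signed_words A" for x
    using iff[of x] that by (auto simp: signed_words_def)
  ultimately show ?thesis
    by auto
qed

lemma ZB_any_alphabet:
  assumes "finite A" "\<forall>a\<in>A. 0 < a" "card A = length w"
  shows "(\<Sum>x\<in>{x \<in> signed_words A. leB x w}. monom 1 (lenB x)) = ZB w"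
proof -
  let ?f = "rankB A"
  have inj: "inj_on ?f (A \<union> uminus ` A)"
    by (intro strict_mono_on_imp_inj_on strict_mono_on_rankB assms)
  have sub: "set x \<subseteq> A \<union> uminus ` A" if "x \<in> signed_words A" for x
    using that by (auto simp: signed_words_def intro!: abs_mem_imp_signed)
  have "inj_on (map ?f) {x \<in> signed_words A. leB x w}"
  proof (rule inj_onI)
    fix x y
    assume "x \<in> {x \<in> signed_words A. leB x w}" "y \<in> {x \<in> signed_words A. leB x w}"
      and eq: "map ?f x = map ?f y"
    then have "set x \<union> set y \<subseteq> A \<union> uminus ` A"
      using sub by blast
    then show "x = y"
      using inj_on_map_eq_map[OF inj_on_subset[OF inj]] eq by blast
  qed
  moreover have "leB (map ?f x) w \<longleftrightarrow> leB x w" if "x \<in> signed_words A" for x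
    using that leB_map_rankB_left[OF assms(1,2)] by (simp add: signed_words_def)
  then have "{x \<in> signed_words {1..int (length w)}. leB x w}
      = map ?f ` {x \<in> signed_words A. leB x w}"
    unfolding assms(3)[symmetric] map_rankB_signed_words[OF assms(1,2), symmetric] by blast
  moreover have "lenB (map ?f x) = lenB x" if "x \<in> signed_words A" for x
    using that lenB_map_rankB[OF assms(1,2)] by (simp add: signed_words_def)
  ultimately show ?thesis
    by (simp add: ZB_def sum.reindex)
qed

section \<open>Splitting words\<close>

lemma sum_split_words:
  fixes len len' :: "int list \<Rightarrow> nat" and c :: "int set \<Rightarrow> nat" and F :: "int poly"
  assumes "finite SS"
    and SS: "\<And>S. S \<in> SS \<Longrightarrow> finite S \<and> card S = length v \<and> finite (L S)"
    and join: "\<And>S x y. S \<in> SS \<Longrightarrow> x \<in> L S \<Longrightarrow> y \<in> permutations_of_set S \<Longrightarrow> leA y v \<Longrightarrow>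
      x @ y \<in> X \<and> length x = p \<and> len (x @ y) = len' x + lenA y + c S"
    and cut: "\<And>z. z \<in> X \<Longrightarrow> set (drop p z) \<in> SS \<and> take p z \<in> L (set (drop p z))
      \<and> distinct (drop p z) \<and> leA (drop p z) v"
    and sum_L: "\<And>S. S \<in> SS \<Longrightarrow> (\<Sum>x\<in>L S. monom 1 (len' x)) = F"
  shows "(\<Sum>z\<in>X. monom 1 (len z)) = (\<Sum>S\<in>SS. monom 1 (c S)) * F * ZA v"
proof -
  let ?R = "\<lambda>S. {y \<in> permutations_of_set S. leA y v}"
  have "(\<Sum>z\<in>X. monom 1 (len z) :: int poly)
      = (\<Sum>(S, x, y)\<in>(SIGMA S:SS. L S \<times> ?R S). monom 1 (len (x @ y)))"
    by (rule sum.reindex_bij_witness[where i = "\<lambda>(S, x, y). x @ y"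
          and j = "\<lambda>z. (set (drop p z), take p z, drop p z)"])
      (use join cut in \<open>auto simp: permutations_of_set_def\<close>)
  also have "\<dots> = (\<Sum>S\<in>SS. \<Sum>(x, y)\<in>L S \<times> ?R S. monom 1 (len (x @ y)))"
    using assms(1) SS by (subst sum.Sigma) auto
  also have "\<dots> = (\<Sum>S\<in>SS. \<Sum>x\<in>L S. \<Sum>y\<in>?R S. monom 1 (len' x + lenA y + c S))"
    unfolding sum.cartesian_product[symmetric] using join by (intro sum.cong refl) auto
  also have "\<dots> = (\<Sum>S\<in>SS. \<Sum>x\<in>L S. \<Sum>y\<in>?R S. monom 1 (c S) * monom 1 (len' x) * monom 1 (lenA y))"
    by (simp add: mult_monom add_ac)
  also have "\<dots> = (\<Sum>S\<in>SS. monom 1 (c S) * (\<Sum>x\<in>L S. monom 1 (len' x)) * (\<Sum>y\<in>?R S. monom 1 (lenA y)))"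
    by (simp add: mult.assoc flip: sum_distrib_left sum_distrib_right)
  also have "\<dots> = (\<Sum>S\<in>SS. monom 1 (c S) * F * ZA v)"
    using SS sum_L ZA_any_alphabet by (intro sum.cong refl) simp
  also have "\<dots> = (\<Sum>S\<in>SS. monom 1 (c S)) * F * ZA v"
    by (simp add: sum_distrib_right)
  finally show ?thesis .
qed

lemma permutations_of_set_append_iff:
  "x @ y \<in> permutations_of_set A
    \<longleftrightarrow> distinct y \<and> set y \<subseteq> A \<and> x \<in> permutations_of_set (A - set y)"
  by (auto simp: permutations_of_set_def)

lemma signed_words_append_iff:
  "x @ y \<in> signed_words A
    \<longleftrightarrow> distinct (map abs y) \<and> abs ` set y \<subseteq> A \<and> x \<in> signed_words (A - abs ` set y)"
  by (auto simp: signed_words_def)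

text \<open>Gaussian binomial coefficient: \<open>S\<close> holds the letters of the last
  \<open>q\<close> positions, and the exponent counts the inversions between the two blocks.\<close>

definition gbin :: "nat \<Rightarrow> nat \<Rightarrow> int poly" where
  "gbin p q = (\<Sum>S\<in>{S. S \<subseteq> {1..int (p + q)} \<and> card S = q}.
     monom 1 (\<Sum>b\<in>S. \<Sum>a\<in>{1..int (p + q)} - S. of_bool (b < a)))"

text \<open>The analogue for the quotient of B_(p+q) by B_p x S_q, with \<open>S\<close> the signed
  letters of the last \<open>q\<close> positions. The left block enters through its absolute values,
  since the two indicators together do not see the sign of \<open>a\<close>.\<close>

definition gbinB :: "nat \<Rightarrow> nat \<Rightarrow> int poly" where
  "gbinB p q = (\<Sum>S\<in>{S. abs ` S \<subseteq> {1..int (p + q)} \<and> inj_on abs S \<and> card S = q}.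
     monom 1 (neg_count S
       + (\<Sum>b\<in>S. \<Sum>a\<in>{1..int (p + q)} - abs ` S. of_bool (b < a) + of_bool (b < - a))))"

text \<open>All cross pairs are inversions of \<open>u @ v\<close>, so a word below it may
  distribute the letters over the two blocks freely.\<close>

lemma ZA_append_above:
  assumes "\<forall>a\<in>set u. \<forall>b\<in>set v. b < a"
  shows "ZA (u @ v) = gbin (length u) (length v) * ZA u * ZA v"
proof -
  define p q where "p = length u" and "q = length v"
  let ?A = "{1..int (p + q)}"
  have le_iff: "leA (x @ y) (u @ v) \<longleftrightarrow> leA x u \<and> leA y v"
    if "length x = p" "length y = q" for x y
    using that assms by (subst leA_append) (auto simp: p_def q_def)
  show ?thesis
    unfolding ZA_def[of "u @ v"] gbin_def p_def[symmetric] q_def[symmetric] length_append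
  proof (rule sum_split_words[where L = "\<lambda>S. {x \<in> permutations_of_set (?A - S). leA x u}" and len' = lenA and p = p])
    show "finite {S. S \<subseteq> ?A \<and> card S = q}"
      by (rule finite_subset[of _ "Pow ?A"]) auto
  next
    fix S
    assume S: "S \<in> {S. S \<subseteq> ?A \<and> card S = q}"
    then have fin: "finite S"
      by (auto intro: finite_subset)
    with S show "finite S \<and> card S = length v \<and> finite {x \<in> permutations_of_set (?A - S). leA x u}"
      by (simp add: q_def)
    have card: "card (?A - S) = length u"
      using S fin by (simp add: card_Diff_subset p_def)
    then show "(\<Sum>x\<in>{x \<in> permutations_of_set (?A - S). leA x u}. monom 1 (lenA x)) = ZA u"
      by (intro ZA_any_alphabet) auto
    fix x y
    assume x: "x \<in> {x \<in> permutations_of_set (?A - S). leA x u}"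
      and y: "y \<in> permutations_of_set S" and "leA y v"
    have "length x = p" "length y = q"
      using x y card S by (auto simp: length_finite_permutations_of_set p_def)
    then show "x @ y \<in> {x \<in> permutations_of_set ?A. leA x (u @ v)} \<and> length x = p
        \<and> lenA (x @ y) = lenA x + lenA y + (\<Sum>b\<in>S. \<Sum>a\<in>?A - S. of_bool (b < a))"
      using x y S \<open>leA y v\<close> le_iff lenA_append[of x y]
      by (auto simp: permutations_of_set_append_iff) (auto simp: permutations_of_set_def)
  next
    fix z
    assume z: "z \<in> {x \<in> permutations_of_set ?A. leA x (u @ v)}"
    then have len: "length z = p + q"
      using length_finite_permutations_of_set[of z ?A] by simp
    have "take p z @ drop p z \<in> permutations_of_set ?A" "leA (take p z @ drop p z) (u @ v)"
      using z by simp_all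
    then show "set (drop p z) \<in> {S. S \<subseteq> ?A \<and> card S = q} \<and>
        take p z \<in> {x \<in> permutations_of_set (?A - set (drop p z)). leA x u} \<and>
        distinct (drop p z) \<and> leA (drop p z) v"
      using le_iff[of "take p z" "drop p z"] len distinct_card[of "drop p z"]
      unfolding permutations_of_set_append_iff by simp
  qed
qed

text \<open>\<open>A\<close> is closed downwards within the interval, so an element \<open>a\<close>
  brings the whole of \<open>{1..a}\<close> into \<open>A\<close>, and the cardinality bounds
  \<open>a\<close> by \<open>p\<close>.\<close>

lemma intervals_of_separated_sets:
  fixes A B :: "int set"
  assumes "A \<union> B = {1..int (p + q)}" "card A = p" "card B = q" "\<forall>a\<in>A. \<forall>b\<in>B. a < b"
  shows "A = {1..int p}" "B = {int p + 1..int (p + q)}"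
proof -
  have fin: "finite A" "finite B"
    using finite_Un[of A B] assms(1) by simp_all
  have "A \<subseteq> {1..int p}"
  proof
    fix a
    assume a: "a \<in> A"
    then have "a \<in> {1..int (p + q)}"
      using assms(1) by blast
    have "{1..a} \<subseteq> A"
    proof
      fix c
      assume c: "c \<in> {1..a}"
      then have "c \<in> A \<union> B"
        using \<open>a \<in> {1..int (p + q)}\<close> unfolding assms(1) by simp
      then show "c \<in> A"
        using assms(4) a c by fastforce
    qed
    then have "card {1..a} \<le> p"
      using card_mono[OF fin(1)] assms(2) by blast
    then show "a \<in> {1..int p}"
      using \<open>a \<in> {1..int (p + q)}\<close> by simp
  qed
  then show A: "A = {1..int p}"
    using assms(2) by (intro card_subset_eq) auto
  have "A \<inter> B = {}"
    using assms(4) by blast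
  then have "B = {1..int (p + q)} - {1..int p}"
    using assms(1) A by blast
  then show "B = {int p + 1..int (p + q)}"
    by auto
qed

text \<open>No cross pair is an inversion of \<open>u @ v\<close>, so the right block must consist
  of the largest letters. A single letter set remains, with no cross inversions.\<close>

lemma ZA_append_below:
  assumes "\<forall>a\<in>set u. \<forall>b\<in>set v. a < b"
  shows "ZA (u @ v) = ZA u * ZA v"
proof -
  define p q where "p = length u" and "q = length v"
  let ?A = "{1..int (p + q)}" and ?S = "{int p + 1..int (p + q)}"
  have le_iff: "leA (x @ y) (u @ v) \<longleftrightarrow> leA x u \<and> leA y v \<and> (\<forall>a\<in>set x. \<forall>b\<in>set y. a \<le> b)"
    if "length x = p" "length y = q" for x y
  proof -
    have "u ! i < v ! j" if "j < q" "i < p" for i j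
      using assms that by (simp add: p_def q_def)
    then have "(\<forall>j<q. \<forall>i<p. y ! j < x ! i \<longrightarrow> v ! j < u ! i) \<longleftrightarrow> (\<forall>j<q. \<forall>i<p. x ! i \<le> y ! j)"
      by (meson linorder_not_less order_less_asym)
    also have "\<dots> \<longleftrightarrow> (\<forall>a\<in>set x. \<forall>b\<in>set y. a \<le> b)"
      using that by (auto simp: all_set_conv_all_nth)
    finally show ?thesis
      using that by (subst leA_append) (auto simp: p_def q_def)
  qed
  have "(\<Sum>z\<in>{x \<in> permutations_of_set ?A. leA x (u @ v)}. monom 1 (lenA z))
      = (\<Sum>S\<in>{?S}. monom 1 0) * ZA u * ZA v"
  proof (rule sum_split_words[where L = "\<lambda>S. {x \<in> permutations_of_set {1..int p}. leA x u}"
        and len' = lenA and p = p and c = "\<lambda>_. 0"])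
    fix S
    assume S: "S \<in> {?S}"
    then show "finite S \<and> card S = length v \<and> finite {x \<in> permutations_of_set {1..int p}. leA x u}"
      by (simp add: q_def)
    show "(\<Sum>x\<in>{x \<in> permutations_of_set {1..int p}. leA x u}. monom 1 (lenA x)) = ZA u"
      by (simp add: ZA_def p_def)
    fix x y
    assume x: "x \<in> {x \<in> permutations_of_set {1..int p}. leA x u}"
      and y: "y \<in> permutations_of_set S" and "leA y v"
    have len: "length x = p" "length y = q"
      using x y S by (auto simp: length_finite_permutations_of_set p_def)
    have sets: "set x = {1..int p}" "set y = ?S" "distinct x" "distinct y"
      using x y S by (auto simp: permutations_of_set_def)
    have "(\<Sum>b\<in>set y. \<Sum>a\<in>set x. of_bool (b < a)) = (0 :: nat)"
      unfolding sets by (intro sum.neutral) auto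
    moreover have "set x \<union> set y = ?A" "set x \<inter> set y = {}"
      unfolding sets by auto
    moreover have "\<forall>a\<in>set x. \<forall>b\<in>set y. a \<le> b"
      unfolding sets by auto
    ultimately show "x @ y \<in> {x \<in> permutations_of_set ?A. leA x (u @ v)} \<and> length x = p
        \<and> lenA (x @ y) = lenA x + lenA y + 0"
      using x len \<open>leA y v\<close> le_iff[of x y] lenA_append[of x y] sets(3,4)
      by (simp add: permutations_of_set_def)
  next
    fix z
    assume z: "z \<in> {x \<in> permutations_of_set ?A. leA x (u @ v)}"
    then have len: "length (take p z) = p" "length (drop p z) = q"
      by (auto simp: length_finite_permutations_of_set)
    have z': "take p z @ drop p z \<in> permutations_of_set ?A" "leA (take p z @ drop p z) (u @ v)"
      using z by simp_all
    then have le: "leA (take p z) u" "leA (drop p z) v"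
        "\<forall>a\<in>set (take p z). \<forall>b\<in>set (drop p z). a \<le> b"
      using le_iff[OF len] by auto
    have d: "distinct (take p z)" "distinct (drop p z)" "set (take p z) \<inter> set (drop p z) = {}"
        "set (take p z) \<union> set (drop p z) = ?A"
      using z'(1) by (auto simp: permutations_of_set_def simp del: append_take_drop_id)
    have "\<forall>a\<in>set (take p z). \<forall>b\<in>set (drop p z). a < b"
      using le(3) d(3) by (metis disjoint_iff order_less_le)
    then have "set (take p z) = {1..int p}" "set (drop p z) = ?S"
      using intervals_of_separated_sets[OF d(4)] distinct_card[OF d(1)] distinct_card[OF d(2)] len
      by simp_all
    then show "set (drop p z) \<in> {?S} \<and>
        take p z \<in> {x \<in> permutations_of_set {1..int p}. leA x u} \<and>
        distinct (drop p z) \<and> leA (drop p z) v"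
      using le d by (simp add: permutations_of_set_def)
  qed simp
  then show ?thesis
    by (simp add: ZA_def[of "u @ v"] p_def q_def)
qed

text \<open>For negative \<open>v\<close> the conditions that type B adds have true
  conclusions.\<close>

lemma leB_iff_leA:
  assumes "\<forall>b\<in>set v. b < 0" "length y = length v"
  shows "leB y v \<longleftrightarrow> leA y v"
proof -
  have "v ! j < 0" if "j < length y" for j
    using assms that by (auto dest: nth_mem)
  then have "v ! j < 0 \<and> (\<forall>i<j. v ! j < - (v ! i))" if "j < length y" for j
    using that by (metis order_less_trans neg_0_less_iff_less)
  then show ?thesis
    unfolding leA_def leB_def by blast
qed

text \<open>For positive \<open>v\<close> the sign condition forces \<open>y\<close> to be positive,
  and then the premises of the conditions on negative sums fail.\<close>

lemma leB_pos_iff: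
  assumes "\<forall>b\<in>set v. 0 < b" "length y = length v" "0 \<notin> set y"
  shows "leB y v \<longleftrightarrow> leA y v \<and> (\<forall>b\<in>set y. 0 < b)"
proof -
  have pos: "0 < v ! j" if "j < length y" for j
    using assms that by (auto dest: nth_mem)
  have nz: "y ! j \<noteq> 0" if "j < length y" for j
    using assms(3) that by (metis nth_mem)
  show ?thesis
  proof
    assume "leB y v"
    then have "\<not> y ! j < 0" if "j < length y" for j
      using pos[OF that] that unfolding leB_def by force
    with nz have "0 < y ! j" if "j < length y" for j
      using that by (meson linorder_neqE)
    with \<open>leB y v\<close> show "leA y v \<and> (\<forall>b\<in>set y. 0 < b)"
      unfolding leA_def leB_def by (auto simp: in_set_conv_nth)
  next
    assume r: "leA y v \<and> (\<forall>b\<in>set y. 0 < b)"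
    then have "0 < y ! j" if "j < length y" for j
      using that by auto
    then have "\<not> y ! j < 0 \<and> (\<forall>i<j. \<not> y ! j < - (y ! i))" if "j < length y" for j
      using that by (smt (verit) less_trans)
    with r show "leB y v"
      unfolding leA_def leB_def by blast
  qed
qed

lemma sum_signed_word:
  assumes "x \<in> signed_words A"
  shows "(\<Sum>a\<in>set x. of_bool (b < a) + of_bool (b < - a) :: nat)
    = (\<Sum>a\<in>A. of_bool (b < a) + of_bool (b < - a))"
proof -
  have "inj_on abs (set x)"
    using assms by (auto simp: signed_words_def distinct_map)
  then have "(\<Sum>a\<in>abs ` set x. of_bool (b < a) + of_bool (b < - a) :: nat)
      = (\<Sum>a\<in>set x. of_bool (b < \<bar>a\<bar>) + of_bool (b < - \<bar>a\<bar>))"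
    by (simp add: sum.reindex del: sum_of_bool_eq)
  also have "\<dots> = (\<Sum>a\<in>set x. of_bool (b < a) + of_bool (b < - a))"
    by (intro sum.cong) (auto simp: abs_if)
  finally show ?thesis
    using assms by (simp add: signed_words_def)
qed

text \<open>The cross pairs are inversions of \<open>u @ v\<close> in both senses, and so are all
  sums and signs inside \<open>v\<close>. Letters and signs of the right block are therefore free,
  and \<open>v\<close> restricts only its internal order; this is why \<open>ZA v\<close> appears.
  The part of its type B length that depends on the letter set alone goes into
  \<open>gbinB\<close>.\<close>

lemma ZB_append_neg:
  assumes "\<forall>b\<in>set v. b < 0" "\<forall>a\<in>set u. \<forall>b\<in>set v. b < a \<and> b < - a"
  shows "ZB (u @ v) = gbinB (length u) (length v) * ZB u * ZA v"
proof -
  define p q where "p = length u" and "q = length v"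
  let ?A = "{1..int (p + q)}"
  let ?SS = "{S. abs ` S \<subseteq> ?A \<and> inj_on abs S \<and> card S = q}"
  have le_iff: "leB (x @ y) (u @ v) \<longleftrightarrow> leB x u \<and> leA y v"
    if "length x = p" "length y = q" for x y
    using that assms by (subst leB_append) (auto simp: p_def q_def leB_iff_leA)
  show ?thesis
    unfolding ZB_def[of "u @ v"] gbinB_def p_def[symmetric] q_def[symmetric] length_append
  proof (rule sum_split_words[where L = "\<lambda>S. {x \<in> signed_words (?A - abs ` S). leB x u}"
        and len' = lenB and p = p])
    have "?SS \<subseteq> Pow {- int (p + q)..int (p + q)}"
      by force
    then show "finite ?SS"
      by (rule finite_subset) simp
  next
    fix S
    assume S: "S \<in> ?SS"
    then have "finite (abs ` S)"
      by (metis (mono_tags) finite_subset finite_atLeastAtMost_int mem_Collect_eq)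
    then have fin: "finite S"
      using S by (auto intro: finite_imageD)
    with S show "finite S \<and> card S = length v \<and> finite {x \<in> signed_words (?A - abs ` S). leB x u}"
      by (simp add: q_def)
    have card: "card (?A - abs ` S) = length u"
      using S fin by (simp add: card_Diff_subset card_image p_def)
    then show "(\<Sum>x\<in>{x \<in> signed_words (?A - abs ` S). leB x u}. monom 1 (lenB x)) = ZB u"
      by (intro ZB_any_alphabet) auto
    fix x y
    assume x: "x \<in> {x \<in> signed_words (?A - abs ` S). leB x u}"
      and y: "y \<in> permutations_of_set S" and "leA y v"
    have len: "length x = p" "length y = q"
      using x y card S by (auto simp: length_finite_permutations_of_set p_def signed_words_length)
    have y': "set y = S" "distinct y"
      using y by (auto simp: permutations_of_set_def)
    then have "distinct (map abs y)"
      using S by (simp add: distinct_map)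
    then have "x @ y \<in> signed_words ?A"
      using x y' S by (auto simp: signed_words_append_iff)
    moreover have "distinct x"
      using x by (auto simp: signed_words_def intro: distinct_map_absD)
    moreover have "(\<Sum>b\<in>set y. \<Sum>a\<in>set x. of_bool (b < a) + of_bool (b < - a) :: nat)
        = (\<Sum>b\<in>S. \<Sum>a\<in>?A - abs ` S. of_bool (b < a) + of_bool (b < - a))"
      using x y' sum_signed_word[of x "?A - abs ` S"] by simp
    ultimately show "x @ y \<in> {x \<in> signed_words ?A. leB x (u @ v)} \<and> length x = p
        \<and> lenB (x @ y) = lenB x + lenA y + (neg_count S
          + (\<Sum>b\<in>S. \<Sum>a\<in>?A - abs ` S. of_bool (b < a) + of_bool (b < - a)))"
      using x y' len \<open>leA y v\<close> le_iff[OF len] lenB_append[of x y] lenB_eq_lenA_add[of y] by simp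
  next
    fix z
    assume z: "z \<in> {x \<in> signed_words ?A. leB x (u @ v)}"
    then have len: "length (take p z) = p" "length (drop p z) = q"
      by (auto dest: signed_words_length)
    have *: "take p z @ drop p z \<in> signed_words ?A" "leB (take p z @ drop p z) (u @ v)"
      using z by simp_all
    then have "distinct (map abs (drop p z))" "abs ` set (drop p z) \<subseteq> ?A"
        "take p z \<in> signed_words (?A - abs ` set (drop p z))"
      unfolding signed_words_append_iff by auto
    moreover from this have "inj_on abs (set (drop p z))" "distinct (drop p z)"
      by (simp_all add: distinct_map)
    ultimately show "set (drop p z) \<in> ?SS \<and>
        take p z \<in> {x \<in> signed_words (?A - abs ` set (drop p z)). leB x u} \<and>
        distinct (drop p z) \<and> leA (drop p z) v"
      using le_iff[OF len] len distinct_card[of "drop p z"] *(2) by simp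
  qed
qed

text \<open>The roots that involve a position of \<open>v\<close> can be inversions only if they are
  differences inside \<open>v\<close>. So the right block is positive and exceeds all absolute
  values of the left one, which determines its letters.\<close>

lemma ZB_append_pos:
  assumes "\<forall>b\<in>set v. 0 < b" "\<forall>a\<in>set u. \<forall>b\<in>set v. a < b \<and> - a < b"
  shows "ZB (u @ v) = ZB u * ZA v"
proof -
  define p q where "p = length u" and "q = length v"
  let ?A = "{1..int (p + q)}" and ?S = "{int p + 1..int (p + q)}"
  have le_iff: "leB (x @ y) (u @ v) \<longleftrightarrow> leB x u \<and> leA y v \<and> (\<forall>b\<in>set y. 0 < b)
      \<and> (\<forall>a\<in>set x. \<forall>b\<in>set y. \<bar>a\<bar> \<le> b)"
    if "length x = p" "length y = q" "0 \<notin> set y" for x y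
  proof -
    have "\<not> v ! j < u ! i \<and> \<not> v ! j < - (u ! i)" if "j < q" "i < p" for i j
      using assms(2) that nth_mem[of i u] nth_mem[of j v] by (fastforce simp: p_def q_def)
    then have "(\<forall>j<q. \<forall>i<p. (y ! j < x ! i \<longrightarrow> v ! j < u ! i) \<and> (y ! j < - (x ! i) \<longrightarrow> v ! j < - (u ! i)))
        \<longleftrightarrow> (\<forall>j<q. \<forall>i<p. \<bar>x ! i\<bar> \<le> y ! j)"
      by (meson abs_le_iff linorder_not_less)
    also have "\<dots> \<longleftrightarrow> (\<forall>a\<in>set x. \<forall>b\<in>set y. \<bar>a\<bar> \<le> b)"
      using that by (auto simp: all_set_conv_all_nth)
    finally show ?thesis
      using that leB_pos_iff[OF assms(1), of y] by (subst leB_append) (auto simp: p_def q_def)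
  qed
  have "(\<Sum>z\<in>{x \<in> signed_words ?A. leB x (u @ v)}. monom 1 (lenB z))
      = (\<Sum>S\<in>{?S}. monom 1 0) * ZB u * ZA v"
  proof (rule sum_split_words[where L = "\<lambda>S. {x \<in> signed_words {1..int p}. leB x u}"
        and len' = lenB and p = p and c = "\<lambda>_. 0"])
    fix S
    assume S: "S \<in> {?S}"
    then show "finite S \<and> card S = length v \<and> finite {x \<in> signed_words {1..int p}. leB x u}"
      by (simp add: q_def)
    show "(\<Sum>x\<in>{x \<in> signed_words {1..int p}. leB x u}. monom 1 (lenB x)) = ZB u"
      by (simp add: ZB_def p_def)
    fix x y
    assume x: "x \<in> {x \<in> signed_words {1..int p}. leB x u}"
      and y: "y \<in> permutations_of_set S" and "leA y v"
    have len: "length x = p" "length y = q"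
      using x y S by (auto simp: length_finite_permutations_of_set p_def signed_words_length)
    have sets: "abs ` set x = {1..int p}" "set y = ?S" "distinct (map abs x)" "distinct y"
      using x y S by (auto simp: permutations_of_set_def signed_words_def)
    have pos: "\<forall>b\<in>set y. 0 < b"
      unfolding sets by auto
    have absy: "map abs y = y"
      using pos by (intro map_idI) auto
    have le: "\<bar>a\<bar> < b" if "a \<in> set x" "b \<in> set y" for a b
    proof -
      have "\<bar>a\<bar> \<in> {1..int p}" "b \<in> ?S"
        using that sets by blast+
      then show ?thesis by simp
    qed
    have cross: "(\<Sum>b\<in>set y. \<Sum>a\<in>set x. of_bool (b < a) + of_bool (b < - a)) = (0 :: nat)"
      by (intro sum.neutral ballI) (use le in fastforce)
    have neg: "neg_count (set y) = 0"
    proof -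
      have "\<not> b < - a \<and> \<not> b < 0" if "a \<in> set y" "b \<in> set y" for a b
        using pos[rule_format, OF that(1)] pos[rule_format, OF that(2)] by linarith
      then have "(\<Sum>b\<in>set y. \<Sum>a\<in>set y. of_bool (b < - a)) = (0 :: nat)"
        "(\<Sum>b\<in>set y. of_bool (b < 0)) = (0 :: nat)"
        by (auto intro!: sum.neutral simp del: sum_of_bool_eq)
      then show ?thesis
        by (simp add: neg_count_def del: sum_of_bool_eq)
    qed
    have "?A - ?S = {1..int p}" "?S \<subseteq> ?A"
      by auto
    moreover have "abs ` set y = ?S"
      using absy sets(2) by (metis list.set_map)
    ultimately have "x @ y \<in> signed_words ?A"
      using x sets absy by (simp add: signed_words_append_iff)
    moreover have "distinct x"
      using sets(3) by (rule distinct_map_absD)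
    moreover have "0 \<notin> set y" "\<forall>a\<in>set x. \<forall>b\<in>set y. \<bar>a\<bar> \<le> b"
      using pos le by (auto simp: less_imp_le)
    ultimately show "x @ y \<in> {x \<in> signed_words ?A. leB x (u @ v)} \<and> length x = p
        \<and> lenB (x @ y) = lenB x + lenA y + 0"
      using x len \<open>leA y v\<close> le_iff[of x y] pos lenB_append[of x y] lenB_eq_lenA_add[of y]
        cross neg sets(4) by simp
  next
    fix z
    assume z: "z \<in> {x \<in> signed_words ?A. leB x (u @ v)}"
    then have len: "length (take p z) = p" "length (drop p z) = q"
      by (auto dest: signed_words_length)
    have z': "take p z @ drop p z \<in> signed_words ?A" "leB (take p z @ drop p z) (u @ v)"
      using z by simp_all
    have d: "distinct (map abs (take p z))" "distinct (map abs (drop p z))"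
        "abs ` set (take p z) \<inter> abs ` set (drop p z) = {}"
        "abs ` set (take p z) \<union> abs ` set (drop p z) = ?A"
      using z'(1) by (simp_all add: signed_words_def image_Un del: append_take_drop_id)
    have "0 \<notin> set (drop p z)"
      using d(4) by force
    then have le: "leB (take p z) u" "leA (drop p z) v" "\<forall>b\<in>set (drop p z). 0 < b"
        "\<forall>a\<in>set (take p z). \<forall>b\<in>set (drop p z). \<bar>a\<bar> \<le> b"
      using le_iff[OF len] z'(2) by auto
    have "map abs (drop p z) = drop p z"
      using le(3) by (intro map_idI) auto
    then have abs_drop: "abs ` set (drop p z) = set (drop p z)" "distinct (drop p z)"
      using d(2) by (metis list.set_map)+
    have "\<forall>a\<in>abs ` set (take p z). \<forall>b\<in>abs ` set (drop p z). a < b"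
      using le(4) d(3) unfolding abs_drop by (fastforce simp: order_less_le)
    then have "abs ` set (take p z) = {1..int p}" "abs ` set (drop p z) = ?S"
      using intervals_of_separated_sets[OF d(4)] distinct_card[OF d(1)] distinct_card[OF d(2)] len
      by simp_all
    then show "set (drop p z) \<in> {?S} \<and>
        take p z \<in> {x \<in> signed_words {1..int p}. leB x u} \<and>
        distinct (drop p z) \<and> leA (drop p z) v"
      using le d abs_drop by (simp add: signed_words_def)
  qed simp
  then show ?thesis
    by (simp add: ZB_def[of "u @ v"] p_def q_def)
qed

section \<open>Gaussian binomial coefficients\<close>

lemma ZA_Nil: "ZA [] = 1"
proof -
  have "{x \<in> permutations_of_set {1..int (length [])}. leA x []} = {[]}"
    by (auto simp: leA_def)
  then show ?thesis
    by (simp add: ZA_def lenA_def monom_0 flip: one_pCons)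
qed

lemma ZA_single: "ZA [b] = 1"
proof -
  have "{x \<in> permutations_of_set {1..int (length [b])}. leA x [b]} = {[1]}"
    by (auto simp: permutations_of_set_singleton leA_def)
  then show ?thesis
    by (simp add: ZA_def lenA_def monom_0 flip: one_pCons)
qed

lemma ZB_Nil: "ZB [] = 1"
proof -
  have "{x \<in> signed_words {1..int (length [])}. leB x []} = {[]}"
    by (auto simp: signed_words_def leB_def)
  then show ?thesis
    by (simp add: ZB_def lenB_def monom_0 flip: one_pCons)
qed

lemma qint_neq_0: "0 < n \<Longrightarrow> qint n \<noteq> 0"
proof
  assume "0 < n" "qint n = 0"
  then have "poly (qint n) 1 = 0" by simp
  then show False
    using \<open>0 < n\<close> by (simp add: qint_def poly_sum poly_monom)
qed

lemma qfact_neq_0 [simp]: "qfact n \<noteq> 0"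
  by (auto simp: qfact_def qint_neq_0)

lemma qpar_neq_0 [simp]: "qpar n \<noteq> 0"
proof
  assume "qpar n = 0"
  then have "poly (qpar n) 1 = 0" by simp
  then show False
    by (simp add: qpar_def poly_monom)
qed

lemma qfact_Suc: "qfact (Suc n) = qfact n * qint (Suc n)"
  by (simp add: qfact_def)

lemma qfact_0 [simp]: "qfact 0 = 1"
  by (simp add: qfact_def)

lemma qfact_1 [simp]: "qfact (Suc 0) = 1"
  by (simp add: qfact_def qint_def monom_0 flip: one_pCons)

lemma qint_double: "qint (n + n) = qint n * qpar n"
  by (simp add: qint_def qpar_def sum_lessThan_add distrib_left sum_distrib_right mult_monom add.commute)

lemma singletons_eq: "{S. S \<subseteq> A \<and> card S = 1} = (\<lambda>s. {s}) ` A"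
  by (auto simp: card_1_singleton_iff)

lemma gbin_1: "gbin n 1 = qint (Suc n)"
proof -
  let ?A = "{1..int (n + 1)}"
  have card: "(\<Sum>a\<in>?A - {s}. of_bool (s < a)) = nat (int (n + 1) - s)" if "s \<in> ?A" for s
  proof -
    have "(?A - {s}) \<inter> {a. s < a} = {s<..int (n + 1)}"
      using that by auto
    then show ?thesis by simp
  qed
  have "gbin n 1 = (\<Sum>s\<in>?A. monom 1 (nat (int (n + 1) - s)))"
    unfolding gbin_def singletons_eq using card
    by (simp add: sum.reindex del: sum_of_bool_eq)
  also have "\<dots> = qint (Suc n)"
    unfolding qint_def
    by (rule sum.reindex_bij_witness[where i = "\<lambda>j. int (n + 1) - int j"
          and j = "\<lambda>s. nat (int (n + 1) - s)"]) auto
  finally show ?thesis .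
qed

text \<open>The exponent takes each value 0, ..., 2n + 1 once. A positive last letter
  \<open>s\<close> gives \<open>n + 1 - s\<close>; a negative one gives \<open>n - s\<close>, namely
  \<open>n\<close> for the differences, \<open>- s - 1\<close> for the negative sums and 1 for its
  own sign.\<close>

lemma gbinB_1: "gbinB n 1 = qint (Suc n + Suc n)"
proof -
  let ?A = "{1..int (n + 1)}"
  have sets: "{S. abs ` S \<subseteq> ?A \<and> inj_on abs S \<and> card S = 1} = (\<lambda>s. {s}) ` {s. \<bar>s\<bar> \<in> ?A}"
    by (auto simp: card_1_singleton_iff)
  let ?c = "\<lambda>S. neg_count S
    + (\<Sum>b\<in>S. \<Sum>a\<in>?A - abs ` S. of_bool (b < a) + of_bool (b < - a))"
  let ?e = "\<lambda>s. nat (if 0 < s then int (n + 1) - s else int n - s)"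
  have c: "?c {s} = ?e s" if s: "\<bar>s\<bar> \<in> ?A" for s
  proof (cases "0 < s")
    case True
    have "(?A - {s}) \<inter> {a. s < a} = {s<..int (n + 1)}" "(?A - {s}) \<inter> {a. s < - a} = {}"
      using True s by auto
    then show ?thesis
      using True by (simp add: neg_count_def sum.distrib)
  next
    case False
    then have "(?A - {- s}) \<inter> {a. s < a} = ?A - {- s}" "(?A - {- s}) \<inter> {a. s < - a} = {1..<- s}"
      using s by auto
    moreover have "card (?A - {- s}) = n"
      using False s by (simp add: card_Diff_singleton)
    moreover have "s < 0"
      using False s by auto
    ultimately have "(\<Sum>a\<in>?A - {- s}. of_bool (s < a) + of_bool (s < - a)) = n + nat (- s - 1)"
      unfolding sum.distrib by (subst (1 2) sum_of_bool_eq) simp_all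
    then show ?thesis
      using \<open>s < 0\<close> s by (simp add: neg_count_def)
  qed
  have "gbinB n 1 = (\<Sum>s\<in>{s. \<bar>s\<bar> \<in> ?A}. monom 1 (?e s))"
  proof -
    have inj: "inj_on (\<lambda>s. {s}) {s :: int. \<bar>s\<bar> \<in> ?A}"
      by (auto simp: inj_on_def)
    have "gbinB n 1 = (\<Sum>s\<in>{s. \<bar>s\<bar> \<in> ?A}. monom 1 (?c {s}))"
      unfolding gbinB_def sets sum.reindex[OF inj] comp_def ..
    also have "\<dots> = (\<Sum>s\<in>{s. \<bar>s\<bar> \<in> ?A}. monom 1 (?e s))"
      by (intro sum.cong refl arg_cong[where f = "monom 1"] c) (simp only: mem_Collect_eq)
    finally show ?thesis .
  qed
  also have "\<dots> = qint (Suc n + Suc n)"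
    unfolding qint_def
    by (rule sum.reindex_bij_witness[where j = ?e and i = "\<lambda>e. if e \<le> n then int (n + 1) - int e else int n - int e"])
      (auto split: if_splits)
  finally show ?thesis .
qed

lemma ZA_decreasing:
  "sorted_wrt (>) v \<Longrightarrow> ZA v = qfact (length v)"
proof (induction v rule: rev_induct)
  case Nil
  then show ?case by (simp add: ZA_Nil)
next
  case (snoc b v)
  then have "ZA (v @ [b]) = gbin (length v) 1 * ZA v * ZA [b]"
    using ZA_append_above[of v "[b]"] by (simp add: sorted_wrt_append)
  then show ?case
    using snoc gbin_1 by (simp add: sorted_wrt_append ZA_single qfact_Suc)
qed

text \<open>The last of k letters contributes [2k] = [k](k). The product is the length generating
  function of the whole group.\<close>

lemma ZB_decreasing_neg:
  "sorted_wrt (>) v \<Longrightarrow> \<forall>b\<in>set v. b < 0 \<Longrightarrow> ZB v = qfact (length v) * (\<Prod>i = 1..length v. qpar i)"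
proof (induction v rule: rev_induct)
  case Nil
  then show ?case by (simp add: ZB_Nil)
next
  case (snoc b v)
  have "b < - a" if "a \<in> set v" for a
  proof -
    have "a < 0" "b < 0"
      using snoc.prems that by simp_all
    then show ?thesis by linarith
  qed
  then have "ZB (v @ [b]) = gbinB (length v) 1 * ZB v * ZA [b]"
    using ZB_append_neg[of "[b]" v] snoc.prems by (simp add: sorted_wrt_append)
  then show ?case
    using snoc gbinB_1[unfolded qint_double]
    by (simp add: sorted_wrt_append ZA_single qfact_Suc mult_ac)
qed

text \<open>
  Every word lies below the longest word, so splitting the latter evaluates \<open>gbin\<close> and \<open>gbinB\<close>.
\<close>

definition longest_word :: "nat \<Rightarrow> int list" where
  "longest_word n = map (\<lambda>i. - int (Suc i)) [0..<n]"

lemma longest_word: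
  "length (longest_word n) = n" "sorted_wrt (>) (longest_word n)" "\<forall>b\<in>set (longest_word n). b < 0"
  by (auto simp: longest_word_def sorted_wrt_map sorted_wrt_upt intro: sorted_wrt_mono_rel[OF _ sorted_wrt_upt])

lemma longest_word_split:
  obtains u v where "longest_word (p + q) = u @ v" "length u = p" "length v = q"
  using longest_word(1)[of "p + q"] that[of "take p _" "drop p _"] by (metis append_take_drop_id length_append add_diff_cancel_left' length_drop length_take min.absorb2 le_add1)

lemma gbin_qfact: "gbin p q * qfact p * qfact q = qfact (p + q)"
proof -
  obtain u v where uv: "longest_word (p + q) = u @ v" "length u = p" "length v = q"
    by (rule longest_word_split)
  have "sorted_wrt (>) (u @ v)"
    using longest_word(2)[of "p + q"] uv by simp
  then have "ZA (u @ v) = gbin p q * ZA u * ZA v" "ZA (u @ v) = qfact (p + q)"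
      "ZA u = qfact p" "ZA v = qfact q"
    using ZA_append_above[of u v] uv by (auto simp: sorted_wrt_append ZA_decreasing)
  then show ?thesis by simp
qed

text \<open>Obtained by cancelling the nonzero generating functions of the blocks. The additional
  product runs over the positions of the right block, which is what a negative block adds to the
  product over Neg.\<close>

lemma gbinB_eq: "gbinB p q = gbin p q * (\<Prod>i\<in>{p + 1..p + q}. qpar i)"
proof -
  obtain u v where uv: "longest_word (p + q) = u @ v" "length u = p" "length v = q"
    by (rule longest_word_split)
  have dec: "sorted_wrt (>) (u @ v)" and neg: "\<forall>b\<in>set (u @ v). b < 0"
    using longest_word(2,3)[of "p + q"] uv by simp_all
  have "b < - a" if "a \<in> set u" "b \<in> set v" for a b
  proof -
    have "a < 0" "b < 0"
      using neg that by simp_all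
    then show ?thesis by linarith
  qed
  then have *: "ZB (u @ v) = gbinB p q * ZB u * ZA v" "ZA v = qfact q"
      "ZB (u @ v) = qfact (p + q) * (\<Prod>i = 1..p + q. qpar i)"
      "ZB u = qfact p * (\<Prod>i = 1..p. qpar i)"
    using ZB_append_neg[of v u] uv dec neg
    by (auto simp: sorted_wrt_append ZA_decreasing ZB_decreasing_neg)
  have "(\<Prod>i = 1..p + q. qpar i) = (\<Prod>i = 1..p. qpar i) * (\<Prod>i = p + 1..p + q. qpar i)"
    by (rule prod.ub_add_nat) simp
  note P = this
  have "gbinB p q * (qfact p * (\<Prod>i = 1..p. qpar i) * qfact q)
      = gbin p q * (\<Prod>i = p + 1..p + q. qpar i) * (qfact p * (\<Prod>i = 1..p. qpar i) * qfact q)"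
  proof -
    have "gbinB p q * (qfact p * (\<Prod>i = 1..p. qpar i) * qfact q) = ZB (u @ v)"
      using *(1,2,4) by (simp only: mult_ac)
    also have "\<dots> = gbin p q * qfact p * qfact q
        * ((\<Prod>i = 1..p. qpar i) * (\<Prod>i = p + 1..p + q. qpar i))"
      unfolding *(3) gbin_qfact P ..
    finally show ?thesis
      by (simp only: mult_ac)
  qed
  moreover have "qfact p * (\<Prod>i = 1..p. qpar i) * qfact q \<noteq> 0"
    by simp
  ultimately show ?thesis
    using mult_right_cancel by blast
qed

section \<open>Ideals as sets of words\<close>

lemma length_one_line [simp]: "length (one_line n u) = n"
  by (simp add: one_line_def)

lemma one_line_nth [simp]: "i < n \<Longrightarrow> one_line n u ! i = u (int i + 1)"
  by (simp add: one_line_def nth_upto add.commute)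

lemma signed_perms_abs_inj:
  assumes u: "u \<in> signed_perms n" and "\<bar>u i\<bar> = \<bar>u j\<bar>"
  shows "\<bar>i\<bar> = \<bar>j\<bar>"
proof -
  have "u i = u j \<or> u i = u (- j)"
    using assms(2) by (auto simp: abs_eq_iff signed_perms_minus[OF u])
  then show ?thesis
    by (auto simp: signed_perms_inj[OF u])
qed

lemma one_line_in_signed_words:
  assumes u: "u \<in> signed_perms n"
  shows "one_line n u \<in> signed_words {1..int n}"
proof -
  have inj: "inj_on (\<lambda>i. \<bar>u i\<bar>) {1..int n}"
  proof (rule inj_onI)
    fix i j
    assume "i \<in> {1..int n}" "j \<in> {1..int n}" "\<bar>u i\<bar> = \<bar>u j\<bar>"
    then show "i = j"
      using signed_perms_abs_inj[OF u, of i j] by simp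
  qed
  moreover have "(\<lambda>i. \<bar>u i\<bar>) ` {1..int n} \<subseteq> {1..int n}"
  proof
    fix k
    assume "k \<in> (\<lambda>i. \<bar>u i\<bar>) ` {1..int n}"
    then obtain i where "k = \<bar>u i\<bar>" "1 \<le> i" "i \<le> int n"
      by auto
    then show "k \<in> {1..int n}"
      using signed_perms_range[OF u, of i] by auto
  qed
  ultimately have "(\<lambda>i. \<bar>u i\<bar>) ` {1..int n} = {1..int n}"
    by (intro endo_inj_surj) auto
  moreover have "map abs (one_line n u) = map (\<lambda>i. \<bar>u i\<bar>) [1..int n]"
    by (simp add: one_line_def)
  ultimately show ?thesis
    using inj unfolding signed_words_def mem_Collect_eq list.set_map[symmetric] by (simp add: distinct_map)
qed

lemma signed_perms_eqI:
  assumes u: "u \<in> signed_perms n" and v: "v \<in> signed_perms n"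
    and eq: "\<And>i. 1 \<le> i \<Longrightarrow> i \<le> int n \<Longrightarrow> u i = v i"
  shows "u = v"
proof
  fix i :: int
  consider "i = 0" | "int n < \<bar>i\<bar>" | "1 \<le> i" "i \<le> int n" | "1 \<le> - i" "- i \<le> int n"
    by linarith
  then show "u i = v i"
  proof cases
    case 4
    then have "u (- (- i)) = v (- (- i))"
      unfolding signed_perms_minus[OF u, of "- i"] signed_perms_minus[OF v, of "- i"]
      using eq[of "- i"] by simp
    then show ?thesis by simp
  qed (use eq in \<open>simp_all add: signed_perms_0[OF u] signed_perms_0[OF v]
      signed_perms_outside[OF u] signed_perms_outside[OF v]\<close>)
qed

lemma signed_word_is_one_line:
  assumes x: "x \<in> signed_words {1..int n}"
  shows "\<exists>u\<in>signed_perms n. one_line n u = x"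
proof -
  have len: "length x = n"
    using signed_words_length[OF x] by simp
  define u :: "int \<Rightarrow> int" where
    "u i = (if \<bar>i\<bar> \<le> int n \<and> i \<noteq> 0 then sgn i * x ! nat (\<bar>i\<bar> - 1) else i)" for i
  let ?I = "{i::int. i \<noteq> 0 \<and> \<bar>i\<bar> \<le> int n}"
  have nz: "x ! k \<noteq> 0 \<and> \<bar>x ! k\<bar> \<le> int n" if "k < n" for k
  proof -
    have "\<bar>x ! k\<bar> \<in> {1..int n}"
      using x that len by (auto simp: signed_words_def)
    then show ?thesis by auto
  qed
  have inj_x: "k = l" if "\<bar>x ! k\<bar> = \<bar>x ! l\<bar>" "k < n" "l < n" for k l
    using x that len nth_eq_iff_index_eq[of "map abs x" k l] by (simp add: signed_words_def)
  have range: "u i \<in> ?I" if "i \<in> ?I" for i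
  proof -
    have "nat (\<bar>i\<bar> - 1) < n"
      using that by auto
    then show ?thesis
      using that nz[of "nat (\<bar>i\<bar> - 1)"] by (cases "0 < i") (simp_all add: u_def abs_mult)
  qed
  have inj: "inj_on u ?I"
  proof (rule inj_onI)
    fix i j
    assume *: "i \<in> ?I" "j \<in> ?I" "u i = u j"
    have ij: "\<bar>u i\<bar> = \<bar>x ! nat (\<bar>i\<bar> - 1)\<bar>" "\<bar>u j\<bar> = \<bar>x ! nat (\<bar>j\<bar> - 1)\<bar>"
      using *(1,2) by (simp_all add: u_def abs_mult sgn_if)
    have "nat (\<bar>i\<bar> - 1) = nat (\<bar>j\<bar> - 1)"
    proof (rule inj_x)
      show "nat (\<bar>i\<bar> - 1) < n" "nat (\<bar>j\<bar> - 1) < n"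
        using *(1,2) by auto
      show "\<bar>x ! nat (\<bar>i\<bar> - 1)\<bar> = \<bar>x ! nat (\<bar>j\<bar> - 1)\<bar>"
        using ij *(3) by simp
    qed
    then have "\<bar>i\<bar> = \<bar>j\<bar>"
      using *(1,2) by auto
    then have "sgn i * x ! nat (\<bar>i\<bar> - 1) = sgn j * x ! nat (\<bar>i\<bar> - 1)"
      using * by (simp add: u_def)
    moreover have "x ! nat (\<bar>i\<bar> - 1) \<noteq> 0"
    proof -
      have "nat (\<bar>i\<bar> - 1) < n"
        using *(1) by auto
      then show ?thesis
        using nz by blast
    qed
    ultimately have "sgn i = sgn j"
      by simp
    with \<open>\<bar>i\<bar> = \<bar>j\<bar>\<close> show "i = j"
      by (auto simp: abs_if sgn_if split: if_splits)
  qed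
  have "finite ?I"
    by (rule finite_subset[of _ "{- int n..int n}"]) auto
  moreover have "u ` ?I \<subseteq> ?I"
    by (intro image_subsetI range)
  ultimately have "u ` ?I = ?I"
    using inj by (rule endo_inj_surj)
  with inj have "bij_betw u ?I ?I"
    by (simp add: bij_betw_def)
  then have "u permutes ?I"
    by (rule bij_imp_permutes) (auto simp: u_def)
  then have "u \<in> signed_perms n"
    by (auto simp: signed_perms_def u_def sgn_if)
  moreover have "one_line n u = x"
    using len by (intro nth_equalityI) (auto simp: u_def sgn_if)
  ultimately show ?thesis by blast
qed

lemma bij_betw_one_line: "bij_betw (one_line n) (signed_perms n) (signed_words {1..int n})"
proof (rule bij_betwI')
  fix u v
  assume uv: "u \<in> signed_perms n" "v \<in> signed_perms n"
  show "one_line n u = one_line n v \<longleftrightarrow> u = v"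
  proof
    assume "one_line n u = one_line n v"
    then have "\<forall>i\<in>{1..int n}. u i = v i"
      by (simp add: one_line_def)
    then show "u = v"
      using signed_perms_eqI[OF uv] by simp
  qed simp
qed (use one_line_in_signed_words signed_word_is_one_line in \<open>auto, metis\<close>)

text \<open>With the larger index fixed, the roots are the short one, the differences and the sums.
  The three sets are disjoint, so their sizes add up to one summand of \<open>lenB\<close>. List
  position \<open>j\<close> corresponds to index \<open>j + 1\<close>.\<close>

lemma Inv_column:
  assumes u: "u \<in> signed_perms n" and "j < n"
  shows "{i. (i, int j + 1) \<in> Inv n u} =
    (if u (int j + 1) < 0 then {- (int j + 1)} else {})
    \<union> (\<lambda>i. int i + 1) ` {i. i < j \<and> u (int j + 1) < u (int i + 1)}
    \<union> (\<lambda>i. - (int i + 1)) ` {i. i < j \<and> u (int j + 1) < - u (int i + 1)}" (is "?l = ?a \<union> ?b \<union> ?c")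
proof (rule set_eqI)
  fix i
  note minus = signed_perms_minus[OF u]
  consider "i = - (int j + 1)" | k where "k < j" "i = int k + 1" | k where "k < j" "i = - (int k + 1)"
    | "i = 0 \<or> i < - (int j + 1) \<or> int j + 1 \<le> i"
  proof -
    assume 1: "i = - (int j + 1) \<Longrightarrow> thesis" and 2: "\<And>k. k < j \<Longrightarrow> i = int k + 1 \<Longrightarrow> thesis"
      and 3: "\<And>k. k < j \<Longrightarrow> i = - (int k + 1) \<Longrightarrow> thesis"
      and 4: "i = 0 \<or> i < - (int j + 1) \<or> int j + 1 \<le> i \<Longrightarrow> thesis"
    show thesis
      using 1 2[of "nat (i - 1)"] 3[of "nat (- i - 1)"] 4 by linarith
  qed
  then show "i \<in> ?l \<longleftrightarrow> i \<in> ?a \<union> ?b \<union> ?c"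
  proof cases
    case 1
    have "u i = - u (int j + 1)"
      unfolding 1 by (rule minus)
    then show ?thesis
      using 1 \<open>j < n\<close> by (auto simp: Inv_iff roots_def)
  next
    case 2
    then show ?thesis
      using \<open>j < n\<close> by (auto simp: Inv_iff roots_def)
  next
    case 3
    have "u i = - u (int k + 1)"
      unfolding 3 by (rule minus)
    then show ?thesis
      using 3 \<open>j < n\<close> by (auto simp: Inv_iff roots_def)
  next
    case 4
    then show ?thesis
      by (auto simp: Inv_iff roots_def)
  qed
qed

lemma card_Inv_eq_lenB:
  assumes u: "u \<in> signed_perms n"
  shows "card (Inv n u) = lenB (one_line n u)"
proof -
  let ?col = "\<lambda>j. {i. (i, int j + 1) \<in> Inv n u}"
  have fin: "finite (?col j)" for j
    by (rule finite_subset[of _ "fst ` Inv n u"]) force+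
  have "Inv n u = (\<lambda>(j, i). (i, int j + 1)) ` (SIGMA j:{..<n}. ?col j)"
  proof (intro equalityI subsetI)
    fix r
    assume r: "r \<in> Inv n u"
    then obtain i J where "r = (i, J)" "0 < J" "J \<le> int n"
      by (auto simp: Inv_def roots_def)
    with r show "r \<in> (\<lambda>(j, i). (i, int j + 1)) ` (SIGMA j:{..<n}. ?col j)"
      by (intro image_eqI[of _ _ "(nat (J - 1), i)"]) auto
  qed auto
  moreover have "inj_on (\<lambda>(j, i). (i, int j + 1)) (SIGMA j:{..<n}. ?col j)"
    by (auto simp: inj_on_def)
  ultimately have "card (Inv n u) = card (SIGMA j:{..<n}. ?col j)"
    by (metis card_image)
  also have "\<dots> = (\<Sum>j<n. card (?col j))"
    using fin by simp
  also have "\<dots> = (\<Sum>j<n. of_bool (u (int j + 1) < 0)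
      + (\<Sum>i<j. of_bool (u (int j + 1) < u (int i + 1)) + of_bool (u (int j + 1) < - u (int i + 1))))"
  proof (rule sum.cong[OF refl])
    fix j
    assume j: "j \<in> {..<n}"
    let ?a = "if u (int j + 1) < 0 then {- (int j + 1)} else {}"
      and ?b = "(\<lambda>i. int i + 1) ` {i. i < j \<and> u (int j + 1) < u (int i + 1)}"
      and ?c = "(\<lambda>i. - (int i + 1)) ` {i. i < j \<and> u (int j + 1) < - u (int i + 1)}"
    have "card (?col j) = card (?a \<union> ?b \<union> ?c)"
      using Inv_column[OF u] j by simp
    also have "\<dots> = card (?a \<union> ?b) + card ?c"
      by (rule card_Un_disjoint) auto
    also have "card (?a \<union> ?b) = card ?a + card ?b"
      by (rule card_Un_disjoint) auto
    also have "card ?a = of_bool (u (int j + 1) < 0)"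
      by simp
    also have "card ?b = (\<Sum>i<j. of_bool (u (int j + 1) < u (int i + 1)))"
      by (subst card_image) (auto simp: inj_on_def intro!: arg_cong[where f = card])
    also have "card ?c = (\<Sum>i<j. of_bool (u (int j + 1) < - u (int i + 1)))"
      by (subst card_image) (auto simp: inj_on_def intro!: arg_cong[where f = card])
    finally show "card (?col j) = of_bool (u (int j + 1) < 0)
      + (\<Sum>i<j. of_bool (u (int j + 1) < u (int i + 1)) + of_bool (u (int j + 1) < - u (int i + 1)))"
      by (simp add: sum.distrib del: sum_of_bool_eq)
  qed
  also have "\<dots> = lenB (one_line n u)"
    unfolding lenB_def by (auto intro!: sum.cong arg_cong2[where f = "(+)"] simp del: sum_of_bool_eq)
  finally show ?thesis .
qed

lemma Inv_subset_iff_leB: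
  assumes u: "u \<in> signed_perms n" and w: "w \<in> signed_perms n"
  shows "Inv n u \<subseteq> Inv n w \<longleftrightarrow> leB (one_line n u) (one_line n w)"
proof -
  have "Inv n u \<subseteq> Inv n w
      \<longleftrightarrow> (\<forall>j<n. {i. (i, int j + 1) \<in> Inv n u} \<subseteq> {i. (i, int j + 1) \<in> Inv n w})" (is "_ \<longleftrightarrow> ?r")
  proof
    assume r: ?r
    show "Inv n u \<subseteq> Inv n w"
    proof (rule subrelI)
      fix i J
      assume iJ: "(i, J) \<in> Inv n u"
      then have "J = int (nat (J - 1)) + 1" "nat (J - 1) < n"
        by (auto simp: Inv_def roots_def)
      then show "(i, J) \<in> Inv n w"
        using r iJ by (metis mem_Collect_eq subsetD)
    qed
  qed blast
  also have "\<dots> \<longleftrightarrow> (\<forall>j<n. (u (int j + 1) < 0 \<longrightarrow> w (int j + 1) < 0)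
     \<and> (\<forall>i<j. (u (int j + 1) < u (int i + 1) \<longrightarrow> w (int j + 1) < w (int i + 1))
            \<and> (u (int j + 1) < - u (int i + 1) \<longrightarrow> w (int j + 1) < - w (int i + 1))))"
  proof (intro all_cong)
    fix j
    assume j: "j < n"
    have mem: "(i, int j + 1) \<in> Inv n v \<longleftrightarrow> i = - (int j + 1) \<and> v (int j + 1) < 0
        \<or> (\<exists>k<j. i = int k + 1 \<and> v (int j + 1) < v (int k + 1))
        \<or> (\<exists>k<j. i = - (int k + 1) \<and> v (int j + 1) < - v (int k + 1))"
      if "v \<in> signed_perms n" for v i
    proof -
      have "(i, int j + 1) \<in> Inv n v \<longleftrightarrow> i \<in> {i. (i, int j + 1) \<in> Inv n v}"
        by simp
      then show ?thesis
        unfolding Inv_column[OF that j] by auto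
    qed
    show "{i. (i, int j + 1) \<in> Inv n u} \<subseteq> {i. (i, int j + 1) \<in> Inv n w} \<longleftrightarrow>
        (u (int j + 1) < 0 \<longrightarrow> w (int j + 1) < 0)
         \<and> (\<forall>i<j. (u (int j + 1) < u (int i + 1) \<longrightarrow> w (int j + 1) < w (int i + 1))
                \<and> (u (int j + 1) < - u (int i + 1) \<longrightarrow> w (int j + 1) < - w (int i + 1)))"
      (is "?s \<longleftrightarrow> ?t")
    proof
      assume s: ?s
      have "w (int j + 1) < 0" if "u (int j + 1) < 0"
        using s that mem[OF u, of "- (int j + 1)"] mem[OF w, of "- (int j + 1)"] by auto
      moreover have "w (int j + 1) < w (int i + 1)" if "i < j" "u (int j + 1) < u (int i + 1)" for i
        using s that mem[OF u, of "int i + 1"] mem[OF w, of "int i + 1"] by auto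
      moreover have "w (int j + 1) < - w (int i + 1)" if "i < j" "u (int j + 1) < - u (int i + 1)" for i
        using s that mem[OF u, of "- (int i + 1)"] mem[OF w, of "- (int i + 1)"] by auto
      ultimately show ?t by blast
    next
      assume t: ?t
      show ?s
        unfolding mem[OF u] mem[OF w] using t by blast
    qed
  qed
  also have "\<dots> \<longleftrightarrow> leB (one_line n u) (one_line n w)"
    unfolding leB_def by simp
  finally show ?thesis .
qed

lemma F_lower_eq_ZB:
  assumes w: "w \<in> signed_perms n"
  shows "F_lower n w = ZB (one_line n w)"
proof -
  have "F_lower n w = (\<Sum>u\<in>{u \<in> signed_perms n. leB (one_line n u) (one_line n w)}.
      monom 1 (lenB (one_line n u)))"
    unfolding F_lower_def lower_ideal_def
    by (rule sum.cong) (auto simp: left_weak_le_iff_Inv_subset w Inv_subset_iff_leB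
        cox_length_eq_card_Inv card_Inv_eq_lenB)
  also have "\<dots> = ZB (one_line n w)"
    unfolding ZB_def length_one_line
    by (rule sum.reindex_bij_betw[OF bij_betw_Collect[OF bij_betw_one_line]]) simp
  finally show ?thesis .
qed

section \<open>Upper ideals by duality\<close>

lemma F_upper_eq_sum:
  assumes w: "w \<in> signed_perms n"
  shows "F_upper n w = (\<Sum>x\<in>{x \<in> signed_words {1..int n}. leB (one_line n w) x}.
    monom 1 (lenB x - lenB (one_line n w)))"
proof -
  have "F_upper n w = (\<Sum>u\<in>{u \<in> signed_perms n. leB (one_line n w) (one_line n u)}.
      monom 1 (lenB (one_line n u) - lenB (one_line n w)))"
    unfolding F_upper_def upper_ideal_def
    by (rule sum.cong) (auto simp: left_weak_le_iff_Inv_subset w Inv_subset_iff_leB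
        cox_length_eq_card_Inv card_Inv_eq_lenB)
  also have "\<dots> = (\<Sum>x\<in>{x \<in> signed_words {1..int n}. leB (one_line n w) x}.
    monom 1 (lenB x - lenB (one_line n w)))"
    by (rule sum.reindex_bij_betw[OF bij_betw_Collect[OF bij_betw_one_line]]) simp
  finally show ?thesis .
qed

text \<open>\<open>reflect_poly\<close> reverses the coefficients about the degree, so
  \<open>d\<close> has to be the degree. The witness \<open>x0\<close> attains it, and nothing
  cancels because the coefficients are cardinalities.\<close>

lemma reflect_poly_sum_monom:
  fixes f :: "'a \<Rightarrow> nat"
  assumes "finite X" "\<And>x. x \<in> X \<Longrightarrow> f x \<le> d" "x0 \<in> X" "f x0 = d"
  shows "reflect_poly (\<Sum>x\<in>X. monom (1::int) (f x)) = (\<Sum>x\<in>X. monom 1 (d - f x))"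
proof -
  let ?F = "\<Sum>x\<in>X. monom (1::int) (f x)"
  have coeff: "coeff (\<Sum>x\<in>X. monom (1::int) (g x)) k = int (card {x \<in> X. g x = k})" for g k
    using assms(1) by (simp add: coeff_sum sum.If_cases Int_def flip: sum.inter_filter)
  have "degree ?F = d"
  proof (rule antisym)
    show "degree ?F \<le> d"
    proof (rule degree_le, intro allI impI)
      fix i
      assume "d < i"
      then have "{x \<in> X. f x = i} = {}"
        using assms(2) by fastforce
      then show "coeff ?F i = 0"
        by (simp only: coeff card.empty of_nat_0)
    qed
    have "card {x \<in> X. f x = d} \<noteq> 0"
      using assms by auto
    then show "d \<le> degree ?F"
      by (intro le_degree) (simp only: coeff of_nat_eq_0_iff not_False_eq_True)
  qed
  then have "coeff (reflect_poly ?F) k = coeff (\<Sum>x\<in>X. monom 1 (d - f x)) k" for k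
  proof (cases "k \<le> d")
    case True
    then have "{x \<in> X. f x = d - k} = {x \<in> X. d - f x = k}"
      using assms(2) by fastforce
    then show ?thesis
      using True \<open>degree ?F = d\<close> unfolding coeff_reflect_poly coeff by simp
  next
    case False
    then have "{x \<in> X. d - f x = k} = {}"
      by auto
    then have "card {x \<in> X. d - f x = k} = 0"
      by (simp only: card.empty)
    then show ?thesis
      using False \<open>degree ?F = d\<close> unfolding coeff_reflect_poly coeff by simp
  qed
  then show ?thesis
    by (rule poly_eqI)
qed

lemma lenB_mono:
  assumes "leB x w" "length x = length w"
  shows "lenB x \<le> lenB w"
  unfolding lenB_def assms(2)
  by (intro sum_mono add_mono) (use assms in \<open>auto simp: leB_def\<close>)

lemma signed_words_neq:
  assumes "x \<in> signed_words A" "0 \<notin> A" "i < length x"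
  shows "x ! i \<noteq> 0"
    and "j < length x \<Longrightarrow> i \<noteq> j \<Longrightarrow> x ! j \<noteq> x ! i"
    and "j < length x \<Longrightarrow> i \<noteq> j \<Longrightarrow> x ! j \<noteq> - (x ! i)"
proof -
  have "\<bar>x ! i\<bar> \<in> A"
    using assms by (auto simp: signed_words_def)
  then show "x ! i \<noteq> 0"
    using assms(2) by auto
  have "\<bar>x ! j\<bar> \<noteq> \<bar>x ! i\<bar>" if "j < length x" "i \<noteq> j"
    using nth_eq_iff_index_eq[of "map abs x" i j] assms that by (simp add: signed_words_def)
  then show "j < length x \<Longrightarrow> i \<noteq> j \<Longrightarrow> x ! j \<noteq> x ! i"
    "j < length x \<Longrightarrow> i \<noteq> j \<Longrightarrow> x ! j \<noteq> - (x ! i)"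
    by fastforce+
qed

text \<open>Each positive root is an inversion of exactly one of a word and its negative. Position
  \<open>j\<close> accounts for one short root and \<open>2 * j\<close> long ones.\<close>

lemma lenB_uminus:
  assumes "x \<in> signed_words A" "0 \<notin> A"
  shows "lenB x + lenB (map uminus x) = (\<Sum>j<length x. 1 + 2 * j)"
proof -
  have neg: "of_bool (x ! j < 0) + of_bool (- (x ! j) < 0) = (1 :: nat)" if "j < length x" for j
    using signed_words_neq(1)[OF assms that] by auto
  have pair: "of_bool (x ! j < x ! i) + of_bool (x ! j < - (x ! i))
      + (of_bool (- (x ! j) < - (x ! i)) + of_bool (- (x ! j) < x ! i)) = (2 :: nat)"
    if "j < length x" "i < j" for i j
    using signed_words_neq(2,3)[OF assms, of i j] that by auto
  have "lenB x + lenB (map uminus x) = (\<Sum>j<length x. (of_bool (x ! j < 0) + of_bool (- (x ! j) < 0))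
      + (\<Sum>i<j. of_bool (x ! j < x ! i) + of_bool (x ! j < - (x ! i))
          + (of_bool (- (x ! j) < - (x ! i)) + of_bool (- (x ! j) < x ! i))))"
    unfolding lenB_def by (simp add: sum.distrib del: sum_of_bool_eq)
  also have "\<dots> = (\<Sum>j<length x. 1 + (\<Sum>i<j. 2))"
    using neg pair by (intro sum.cong refl arg_cong2[where f = "(+)"]) auto
  finally show ?thesis by (simp add: mult.commute)
qed

text \<open>No letter is 0 and no two agree up to sign, so a failing inequality is a strict one in
  the opposite direction, and every implication turns into its contrapositive.\<close>

lemma leB_uminus:
  assumes "x \<in> signed_words A" "w \<in> signed_words B" "0 \<notin> A" "0 \<notin> B" "length x = length w"
  shows "leB (map uminus x) (map uminus w) \<longleftrightarrow> leB w x"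
proof -
  have "(- (x ! j) < 0 \<longrightarrow> - (w ! j) < 0) \<longleftrightarrow> (w ! j < 0 \<longrightarrow> x ! j < 0)" if "j < length x" for j
    using signed_words_neq(1)[OF assms(1,3) that] signed_words_neq(1)[OF assms(2,4), of j] that assms(5)
    by auto
  moreover have "(- (x ! j) < - (x ! i) \<longrightarrow> - (w ! j) < - (w ! i))
      \<longleftrightarrow> (w ! j < w ! i \<longrightarrow> x ! j < x ! i)" if "j < length x" "i < j" for i j
    using signed_words_neq(2)[OF assms(1,3), of i j] signed_words_neq(2)[OF assms(2,4), of i j] that assms(5)
    by auto
  moreover have "(- (x ! j) < - (- (x ! i)) \<longrightarrow> - (w ! j) < - (- (w ! i)))
      \<longleftrightarrow> (w ! j < - (w ! i) \<longrightarrow> x ! j < - (x ! i))" if "j < length x" "i < j" for i j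
    using signed_words_neq(3)[OF assms(1,3), of i j] signed_words_neq(3)[OF assms(2,4), of i j] that assms(5)
    by auto
  ultimately show ?thesis
    unfolding leB_def length_map assms(5)[symmetric]
    by (intro all_cong) (auto simp: assms(5))
qed

lemma map_uminus_signed_words: "map uminus x \<in> signed_words A \<longleftrightarrow> x \<in> signed_words A"
  by (simp add: signed_words_def comp_def image_image)

text \<open>Negation is multiplication by the longest element: it reverses the order and complements
  lengths. Rank above \<open>w\<close> becomes corank below the negative of \<open>w\<close>, and
  this top element of the lower ideal attains the degree.\<close>

lemma F_upper_eq_reflect:
  assumes w: "w \<in> signed_perms n"
  shows "F_upper n w = reflect_poly (ZB (map uminus (one_line n w)))"
proof -
  let ?w = "one_line n w" and ?A = "{1..int n}"
  have wA: "?w \<in> signed_words ?A"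
    using w by (rule one_line_in_signed_words)
  let ?X = "{x \<in> signed_words ?A. leB x (map uminus ?w)}"
  have "leB ?w ?w"
    by (simp add: leB_def)
  then have top: "map uminus ?w \<in> ?X"
    using wA leB_uminus[of ?w ?A ?w ?A] by (simp add: map_uminus_signed_words)
  have "F_upper n w = (\<Sum>x\<in>?X. monom 1 (lenB (map uminus ?w) - lenB x))"
    unfolding F_upper_eq_sum[OF w]
  proof (rule sum.reindex_bij_witness[where i = "map uminus" and j = "map uminus"])
    fix x
    assume x: "x \<in> {x \<in> signed_words ?A. leB ?w x}"
    then have len: "length x = n"
      using signed_words_length by fastforce
    show "map uminus (map uminus x) = x"
      by (simp add: comp_def)
    show "map uminus x \<in> ?X"
      using x leB_uminus[of x ?A ?w ?A] len wA by (simp add: map_uminus_signed_words)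
    have "lenB x + lenB (map uminus x) = lenB ?w + lenB (map uminus ?w)"
      using lenB_uminus[of x ?A] lenB_uminus[OF wA] x len by simp
    then show "monom 1 (lenB (map uminus ?w) - lenB (map uminus x)) = (monom 1 (lenB x - lenB ?w) :: int poly)"
      using lenB_mono[of ?w x] x len by (intro arg_cong[where f = "monom 1"]) simp
  next
    fix x
    assume x: "x \<in> ?X"
    then have len: "length x = n"
      using signed_words_length by fastforce
    show mm: "map uminus (map uminus x) = x"
      by (simp add: comp_def)
    show "map uminus x \<in> {x \<in> signed_words ?A. leB ?w x}"
      using x leB_uminus[of "map uminus x" ?A ?w ?A] len wA mm by (simp add: map_uminus_signed_words)
  qed
  also have "\<dots> = reflect_poly (\<Sum>x\<in>?X. monom 1 (lenB x))"
  proof (rule reflect_poly_sum_monom[symmetric, OF _ _ top refl])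
    show "lenB x \<le> lenB (map uminus ?w)" if "x \<in> ?X" for x
      using that signed_words_length[of x ?A] by (intro lenB_mono) auto
  qed simp
  finally show ?thesis
    by (simp add: ZB_def)
qed

section \<open>The tree recursion\<close>

text \<open>The product over Neg in a form that makes sense for words that are not standardized and
  that splits along concatenations.\<close>

definition neg_prod :: "int list \<Rightarrow> int poly" where
  "neg_prod w = (\<Prod>i<length w. if w ! i < 0 then qpar (Suc i) else 1)"

lemma prod_lessThan_add:
  fixes f :: "nat \<Rightarrow> 'a :: comm_monoid_mult"
  shows "(\<Prod>j<p + q. f j) = (\<Prod>j<p. f j) * (\<Prod>j<q. f (p + j))"
  by (induction q) (simp_all add: mult.assoc)

lemma prod_qpar_shift: "(\<Prod>j<q. qpar (Suc (p + j))) = (\<Prod>i\<in>{p + 1..p + q}. qpar i)"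
  by (rule prod.reindex_bij_witness[where i = "\<lambda>i. i - Suc p" and j = "\<lambda>j. Suc (p + j)"]) auto

lemma neg_prod_append_pos:
  assumes "\<forall>b\<in>set v. 0 < b"
  shows "neg_prod (u @ v) = neg_prod u"
proof -
  have "\<not> v ! j < 0" if "j < length v" for j
    using assms that by (meson nth_mem order_less_asym)
  then show ?thesis
    by (simp add: neg_prod_def prod_lessThan_add nth_append)
qed

lemma neg_prod_append_neg:
  assumes "\<forall>b\<in>set v. b < 0"
  shows "neg_prod (u @ v) = neg_prod u * (\<Prod>i\<in>{length u + 1..length u + length v}. qpar i)"
  using assms prod_qpar_shift[where p = "length u" and q = "length v"]
  by (simp add: neg_prod_def prod_lessThan_add nth_append)

lemma neg_prod_Nil [simp]: "neg_prod [] = 1"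
  by (simp add: neg_prod_def)

lemma neg_prod_neq_0 [simp]: "neg_prod w \<noteq> 0"
  by (simp add: neg_prod_def)

lemma gbin_0: "gbin 0 q = 1"
  using gbin_qfact[of 0 q] by simp

text \<open>The splitting lemmas with empty left block. It allows the recursion to carry
  \<open>ZB\<close> only: for a block of constant sign, \<open>ZA\<close> is recovered by cancelling
  the nonzero \<open>neg_prod\<close>.\<close>

lemma ZB_same_sign:
  assumes "(\<forall>b\<in>set v. 0 < b) \<or> (\<forall>b\<in>set v. b < 0)"
  shows "ZB v = ZA v * neg_prod v"
  using assms
proof
  assume "\<forall>b\<in>set v. 0 < b"
  then show ?thesis
    using ZB_append_pos[of v "[]"] neg_prod_append_pos[of v "[]"] by (simp add: ZB_Nil)
next
  assume "\<forall>b\<in>set v. b < 0"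
  then show ?thesis
    using ZB_append_neg[of v "[]"] neg_prod_append_neg[of v "[]"]
    by (simp add: ZB_Nil gbinB_eq gbin_0)
qed

text \<open>\<open>hu\<close> and \<open>hv\<close> stand for the tree polynomials of the blocks.
  Since \<open>v\<close> dominates in absolute value, its sign decides every cross pair, and
  \<open>last u < hd v\<close> tests this sign.\<close>

lemma ZB_append_abs_less:
  assumes v: "(\<forall>b\<in>set v. 0 < b) \<or> (\<forall>b\<in>set v. b < 0)" "u \<noteq> []" "v \<noteq> []"
    and less: "\<forall>a\<in>set u. \<forall>b\<in>set v. \<bar>a\<bar> < \<bar>b\<bar>"
    and hu: "ZB u = hu * neg_prod u" and hv: "ZB v = hv * neg_prod v"
  shows "ZB (u @ v) = hu * hv * (if last u < hd v then 1 else gbin (length u) (length v)) * neg_prod (u @ v)"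
proof -
  have ZA: "ZA v = hv"
    using ZB_same_sign[OF v(1)] hv by simp
  have ends: "\<bar>last u\<bar> < \<bar>hd v\<bar>" "hd v \<in> set v"
    using v(2,3) less by simp_all
  show ?thesis
    using v(1)
  proof
    assume pos: "\<forall>b\<in>set v. 0 < b"
    then have "\<forall>a\<in>set u. \<forall>b\<in>set v. a < b \<and> - a < b"
      using less by fastforce
    moreover have "last u < hd v"
      using pos ends by fastforce
    ultimately show ?thesis
      using ZB_append_pos[OF pos] neg_prod_append_pos[OF pos] ZA hu by (simp add: mult_ac)
  next
    assume neg: "\<forall>b\<in>set v. b < 0"
    then have "\<forall>a\<in>set u. \<forall>b\<in>set v. b < a \<and> b < - a"
      using less by fastforce
    moreover have "\<not> last u < hd v"
      using neg ends by fastforce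
    ultimately show ?thesis
      using ZB_append_neg[OF neg] neg_prod_append_neg[OF neg] ZA hu
      by (simp add: gbinB_eq mult_ac)
  qed
qed

text \<open>With one sign throughout, \<open>ZB_same_sign\<close> reduces everything to type A. The
  sign decides whether the larger absolute values on the left are larger or smaller letters, that
  is, which of the two type A splittings applies.\<close>

lemma ZB_append_abs_greater:
  assumes uv: "(\<forall>b\<in>set (u @ v). 0 < b) \<or> (\<forall>b\<in>set (u @ v). b < 0)" "u \<noteq> []" "v \<noteq> []"
    and less: "\<forall>a\<in>set u. \<forall>b\<in>set v. \<bar>b\<bar> < \<bar>a\<bar>"
    and hu: "ZB u = hu * neg_prod u" and hv: "ZB v = hv * neg_prod v"
  shows "ZB (u @ v) = hu * hv * (if last u < hd v then 1 else gbin (length u) (length v)) * neg_prod (u @ v)"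
proof -
  have "(\<forall>b\<in>set u. 0 < b) \<or> (\<forall>b\<in>set u. b < 0)" "(\<forall>b\<in>set v. 0 < b) \<or> (\<forall>b\<in>set v. b < 0)"
    using uv(1) by auto
  then have ZA: "ZA u = hu" "ZA v = hv"
    using ZB_same_sign hu hv by simp_all
  have ends: "\<bar>hd v\<bar> < \<bar>last u\<bar>" "hd v \<in> set (u @ v)" "last u \<in> set (u @ v)"
    using uv(2,3) less by simp_all
  have "ZA (u @ v) = hu * hv * (if last u < hd v then 1 else gbin (length u) (length v))"
    using uv(1)
  proof
    assume pos: "\<forall>b\<in>set (u @ v). 0 < b"
    have "\<forall>a\<in>set u. \<forall>b\<in>set v. b < a"
    proof (intro ballI)
      fix a b
      assume "a \<in> set u" "b \<in> set v"
      then have "0 < a" "0 < b" "\<bar>b\<bar> < \<bar>a\<bar>"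
        using pos less by simp_all
      then show "b < a" by linarith
    qed
    moreover have "\<not> last u < hd v"
      using pos ends by fastforce
    ultimately show ?thesis
      using ZA_append_above[of u v] ZA by (simp add: mult_ac)
  next
    assume neg: "\<forall>b\<in>set (u @ v). b < 0"
    have "\<forall>a\<in>set u. \<forall>b\<in>set v. a < b"
    proof (intro ballI)
      fix a b
      assume "a \<in> set u" "b \<in> set v"
      then have "a < 0" "b < 0" "\<bar>b\<bar> < \<bar>a\<bar>"
        using neg less by simp_all
      then show "a < b" by linarith
    qed
    moreover have "last u < hd v"
      using neg ends by fastforce
    ultimately show ?thesis
      using ZA_append_below[of u v] ZA by simp
  qed
  then show ?thesis
    using ZB_same_sign[OF uv(1)] by simp
qed

section \<open>Node signs and telescoping\<close>

fun other_sign :: "node_sign \<Rightarrow> node_sign" where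
  "other_sign Oplus = Ominus"
| "other_sign Ominus = Oplus"

lemma other_sign_simps [simp]:
  "other_sign s \<noteq> s" "s \<noteq> other_sign s" "other_sign (other_sign s) = s"
  by (cases s; simp)+

lemma neq_iff_other_sign: "s' \<noteq> s \<longleftrightarrow> s' = other_sign s"
  by (cases s; cases s'; simp)

text \<open>
  The argument \<open>s\<close> is the label of the splits without Gaussian binomial coefficient: \<open>Oplus\<close> for lower
  ideals, \<open>Ominus\<close> for upper ideals.
\<close>

primrec tree_poly :: "node_sign \<Rightarrow> sep_tree \<Rightarrow> int poly" where
  "tree_poly s (Leaf x) = 1"
| "tree_poly s (Node s' l r) =
     tree_poly s l * tree_poly s r * (if s' = s then 1 else gbin (num_leaves l) (num_leaves r))"

lemma num_leaves_relabel [simp]: "num_leaves (relabel t a) = num_leaves t"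
  by (induction t arbitrary: a) simp_all

lemma tree_poly_relabel [simp]: "tree_poly s (relabel t a) = tree_poly s t"
  by (induction t arbitrary: a) simp_all

definition alt_nodes :: "node_sign \<Rightarrow> sep_tree \<Rightarrow> dir list set" where
  "alt_nodes s t = {V. V \<noteq> [] \<and> has_sign t s V \<and> has_sign t (other_sign s) (butlast V)}"

lemma S_plus_eq: "S_plus t = alt_nodes Oplus t" and S_minus_eq: "S_minus t = alt_nodes Ominus t"
  by (simp_all add: S_plus_def S_minus_def alt_nodes_def)

primrec has_root :: "node_sign \<Rightarrow> sep_tree \<Rightarrow> bool" where
  "has_root s (Leaf x) = False"
| "has_root s (Node s' l r) = (s' = s)"

lemma has_sign_Nil [simp]: "has_sign t s [] \<longleftrightarrow> has_root s t"
  by (cases t) (auto simp: has_sign_def)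

lemma has_sign_Leaf [simp]: "has_sign (Leaf x) s V \<longleftrightarrow> False"
  by (cases V) (auto simp: has_sign_def)

lemma has_sign_Cons [simp]:
  "has_sign (Node s' l r) s (Left # V) \<longleftrightarrow> has_sign l s V"
  "has_sign (Node s' l r) s (Right # V) \<longleftrightarrow> has_sign r s V"
  by (simp_all add: has_sign_def)

lemma N_leaves_Cons [simp]:
  "N_leaves (Node s l r) (Left # V) = N_leaves l V"
  "N_leaves (Node s l r) (Right # V) = N_leaves r V"
  "N_leaves t [] = num_leaves t"
  by (simp_all add: N_leaves_def)

lemma alt_nodes_Leaf [simp]: "alt_nodes s (Leaf x) = {}"
  by (simp add: alt_nodes_def)

lemma alt_nodes_Node:
  "alt_nodes s (Node s' l r) =
    Cons Left ` (alt_nodes s l \<union> (if has_root s l \<and> s' = other_sign s then {[]} else {}))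
    \<union> Cons Right ` (alt_nodes s r \<union> (if has_root s r \<and> s' = other_sign s then {[]} else {}))"
proof (rule set_eqI)
  fix V
  show "V \<in> alt_nodes s (Node s' l r) \<longleftrightarrow> V \<in>
    Cons Left ` (alt_nodes s l \<union> (if has_root s l \<and> s' = other_sign s then {[]} else {}))
    \<union> Cons Right ` (alt_nodes s r \<union> (if has_root s r \<and> s' = other_sign s then {[]} else {}))"
  proof (cases V)
    case Nil
    then show ?thesis by (auto simp: alt_nodes_def)
  next
    case (Cons d V')
    then show ?thesis
      by (cases d; cases "V' = []") (auto simp: alt_nodes_def)
  qed
qed

lemma finite_alt_nodes [simp]: "finite (alt_nodes s t)"
  by (induction t) (simp_all add: alt_nodes_Node)

definition alt_prod :: "node_sign \<Rightarrow> sep_tree \<Rightarrow> int poly" where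
  "alt_prod s t = (\<Prod>V\<in>alt_nodes s t. qfact (N_leaves t V))"

lemma alt_prod_Leaf [simp]: "alt_prod s (Leaf x) = 1"
  by (simp add: alt_prod_def)

text \<open>What the root would contribute to \<open>alt_prod\<close> below a parent of the opposite
  sign; a subtree by itself does not know its parent.\<close>

definition root_fact :: "node_sign \<Rightarrow> sep_tree \<Rightarrow> int poly" where
  "root_fact s t = (if has_root s t then qfact (num_leaves t) else 1)"

lemma alt_prod_Node:
  "alt_prod s (Node s' l r) = alt_prod s l * alt_prod s r
     * (if s' = s then 1 else root_fact s l * root_fact s r)"
proof -
  let ?X = "\<lambda>t. alt_nodes s t \<union> (if has_root s t \<and> s' = other_sign s then {[]} else {})"
  have X: "(\<Prod>V\<in>?X t. qfact (N_leaves t V)) = alt_prod s t * (if s' = s then 1 else root_fact s t)" for t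
  proof -
    have "[] \<notin> alt_nodes s t"
      by (simp add: alt_nodes_def)
    then show ?thesis
      by (auto simp: alt_prod_def root_fact_def neq_iff_other_sign)
  qed
  have fin: "finite (?X t)" for t
    by simp
  have "alt_prod s (Node s' l r) = (\<Prod>V\<in>Cons Left ` ?X l. qfact (N_leaves (Node s' l r) V))
      * (\<Prod>V\<in>Cons Right ` ?X r. qfact (N_leaves (Node s' l r) V))"
    unfolding alt_prod_def alt_nodes_Node by (rule prod.union_disjoint) auto
  also have "\<dots> = (\<Prod>V\<in>?X l. qfact (N_leaves l V)) * (\<Prod>V\<in>?X r. qfact (N_leaves r V))"
    by (subst (1 2) prod.reindex) (simp_all add: inj_on_def)
  finally show ?thesis
    unfolding X by (simp add: mult_ac)
qed

text \<open>At a node of sign \<open>s\<close>, a child of the other sign joins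
  \<open>alt_nodes (other_sign s)\<close>, so its \<open>root_fact\<close> is absorbed. At a node of
  the other sign, \<open>gbin\<close> trades the factorials of both children for that of the node; a
  child of sign \<open>s\<close> takes its factorial from \<open>alt_prod s\<close>, a child of the
  other sign from its own \<open>root_fact\<close>.\<close>

lemma tree_poly_alt_prod:
  "tree_poly s t * alt_prod s t = alt_prod (other_sign s) t * root_fact (other_sign s) t"
proof (induction t)
  case (Leaf x)
  then show ?case by (simp add: root_fact_def)
next
  case (Node s' l r)
  \<comment> \<open>A leaf has neither sign, but its factorial is [1]! = 1.\<close>
  have full: "root_fact s t * root_fact (other_sign s) t = qfact (num_leaves t)" for t
    by (cases t) (auto simp: root_fact_def neq_iff_other_sign)
  show ?case
  proof (cases "s' = s")
    case True
    then have "tree_poly s (Node s' l r) * alt_prod s (Node s' l r)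
        = (tree_poly s l * alt_prod s l) * (tree_poly s r * alt_prod s r)"
      by (simp add: alt_prod_Node mult_ac)
    also have "\<dots> = alt_prod (other_sign s) (Node s' l r)"
      unfolding Node.IH using True by (simp add: alt_prod_Node mult_ac)
    also have "\<dots> = alt_prod (other_sign s) (Node s' l r) * root_fact (other_sign s) (Node s' l r)"
      using True by (simp add: root_fact_def)
    finally show ?thesis .
  next
    case False
    then have "tree_poly s (Node s' l r) * alt_prod s (Node s' l r)
        = gbin (num_leaves l) (num_leaves r) * (tree_poly s l * alt_prod s l) * (tree_poly s r * alt_prod s r)
           * (root_fact s l * root_fact s r)"
      by (simp add: alt_prod_Node mult_ac)
    also have "\<dots> = alt_prod (other_sign s) l * alt_prod (other_sign s) r
        * (gbin (num_leaves l) (num_leaves r) * (root_fact s l * root_fact (other_sign s) l)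
            * (root_fact s r * root_fact (other_sign s) r))"
      unfolding Node.IH by (simp add: mult_ac)
    also have "\<dots> = alt_prod (other_sign s) (Node s' l r) * root_fact (other_sign s) (Node s' l r)"
      unfolding full gbin_qfact using False
      by (cases s; cases s') (simp_all add: alt_prod_Node root_fact_def)
    finally show ?thesis .
  qed
qed

section \<open>Separable words split\<close>

lemma abs_image_card:
  assumes "distinct (map abs a)"
  shows "card {y \<in> set a. \<bar>y\<bar> \<le> x} = card {t \<in> abs ` set a. t \<le> (x::int)}"
proof -
  have "{t \<in> abs ` set a. t \<le> x} = abs ` {y \<in> set a. \<bar>y\<bar> \<le> x}"
    by auto
  moreover have "inj_on abs {y \<in> set a. \<bar>y\<bar> \<le> x}"
    using assms by (auto simp: distinct_map intro: inj_on_subset)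
  ultimately show ?thesis
    by (simp add: card_image)
qed

lemma sts_eq_map_rankB:
  assumes "distinct (map abs a)"
  shows "sts a = map (rankB (abs ` set a)) a"
  using abs_image_card[OF assms] by (simp add: sts_def rankB_def)

lemma length_sts [simp]: "length (sts a) = length a"
  by (simp add: sts_def)

definition good_word :: "int list \<Rightarrow> bool" where
  "good_word a \<longleftrightarrow> distinct (map abs a) \<and> 0 \<notin> set a"

lemma good_word_pos: "good_word a \<Longrightarrow> \<forall>t\<in>abs ` set a. 0 < t"
  by (auto simp: good_word_def)

lemma card_abs_good_word: "good_word a \<Longrightarrow> card (abs ` set a) = length a"
  using distinct_card[of "map abs a"] by (simp add: good_word_def)

lemma signed_words_good_word: "a \<in> signed_words {1..n} \<Longrightarrow> good_word a"
  using imageI[of 0 "set a" abs] by (auto simp: good_word_def signed_words_def)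

lemma sts_in_signed_words:
  assumes "good_word a"
  shows "sts a \<in> signed_words {1..int (length a)}"
proof -
  have "a \<in> signed_words (abs ` set a)"
    using assms by (simp add: good_word_def signed_words_def)
  then have "map (rankB (abs ` set a)) a \<in> signed_words {1..int (card (abs ` set a))}"
    unfolding map_rankB_signed_words[OF finite_imageI[OF finite_set] good_word_pos[OF assms], symmetric]
    by (rule imageI)
  then show ?thesis
    using assms sts_eq_map_rankB card_abs_good_word by (simp add: good_word_def)
qed

lemma rankB_interval:
  assumes "\<bar>x\<bar> \<in> {1..int n}"
  shows "rankB {1..int n} x = x"
proof -
  have "{t \<in> {1..int n}. t \<le> \<bar>x\<bar>} = {1..\<bar>x\<bar>}"
    using assms by auto
  then show ?thesis
    by (simp add: rankB_def sgn_mult_abs)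
qed

lemma sts_signed_word:
  assumes "a \<in> signed_words {1..int n}"
  shows "sts a = a"
proof -
  have "abs ` set a = {1..int n}" "distinct (map abs a)"
    using assms by (simp_all add: signed_words_def)
  then show ?thesis
    unfolding sts_eq_map_rankB[OF \<open>distinct _\<close>] by (intro map_idI) (auto intro!: rankB_interval)
qed

text \<open>An increasing relabelling of absolute values that keeps signs does not affect
  standardization; hence patterns of \<open>sts a\<close> already occur in \<open>a\<close>.\<close>

lemma sts_map_rankB:
  assumes "finite A" "\<forall>a\<in>A. 0 < a" "abs ` set b \<subseteq> A"
  shows "sts (map (rankB A) b) = sts b"
proof -
  note less = rankB_less_iffs[OF assms(1,2)]
  have mem: "\<bar>x\<bar> \<in> A" if "x \<in> set b" for x
    using assms(3) that by blast
  have eq: "sgn (rankB A x) * int (card {y \<in> rankB A ` set b. \<bar>y\<bar> \<le> \<bar>rankB A x\<bar>})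
      = sgn x * int (card {y \<in> set b. \<bar>y\<bar> \<le> \<bar>x\<bar>})" if x: "x \<in> set b" for x
  proof -
    have abs_le: "\<bar>rankB A y\<bar> \<le> \<bar>rankB A x\<bar> \<longleftrightarrow> \<bar>y\<bar> \<le> \<bar>x\<bar>" if "y \<in> set b" for y
      unfolding rankB_abs using less(1)[of "\<bar>x\<bar>" "\<bar>y\<bar>"] mem[OF x] mem[OF that] by auto
    have "{y \<in> rankB A ` set b. \<bar>y\<bar> \<le> \<bar>rankB A x\<bar>} = rankB A ` {y \<in> set b. \<bar>y\<bar> \<le> \<bar>x\<bar>}"
      using abs_le by auto
    moreover have "inj_on (rankB A) (set b)"
    proof (rule inj_onI)
      fix s t
      assume "s \<in> set b" "t \<in> set b" "rankB A s = rankB A t"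
      then show "s = t"
        using less(1)[of s t] less(1)[of t s] mem by fastforce
    qed
    then have "inj_on (rankB A) {y \<in> set b. \<bar>y\<bar> \<le> \<bar>x\<bar>}"
      by (rule inj_on_subset) auto
    moreover have "sgn (rankB A x) = sgn x"
    proof -
      have "0 < card {t \<in> A. t \<le> \<bar>x\<bar>}"
        using mem[OF x] assms(1) by (auto simp: card_gt_0_iff)
      then show ?thesis
        by (simp add: rankB_def sgn_mult)
    qed
    ultimately show ?thesis
      by (simp add: card_image)
  qed
  then show ?thesis
    by (simp add: sts_def)
qed

lemma contains_pattern_subseq: "contains_pattern b u \<Longrightarrow> subseq b a \<Longrightarrow> contains_pattern a u"
  unfolding contains_pattern_def using subseq_order.order_trans by blast

lemma contains_pattern_sts:
  assumes "good_word a" "contains_pattern (sts a) u"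
  shows "contains_pattern a u"
proof -
  let ?f = "rankB (abs ` set a)"
  obtain c where c: "subseq c (map ?f a)" "sts c = u"
    using assms sts_eq_map_rankB by (auto simp: contains_pattern_def good_word_def)
  then obtain I where "c = nths (map ?f a) I"
    by (auto simp: subseq_conv_nths)
  then have "c = map ?f (nths a I)"
    by (simp add: nths_map)
  moreover have "abs ` set (nths a I) \<subseteq> abs ` set a"
    by (intro image_mono set_nths_subset)
  ultimately have "sts (nths a I) = u"
    using c(2) sts_map_rankB[of "abs ` set a" "nths a I"] good_word_pos[OF assms(1)] by simp
  then show ?thesis
    unfolding contains_pattern_def subseq_conv_nths by blast
qed

lemma separable_word_iff:
  "separable_word a \<longleftrightarrow> a \<in> signed_words {1..int (length a)}
    \<and> (\<forall>u\<in>separable_patterns. \<not> contains_pattern a u)"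
proof
  assume "separable_word a"
  then obtain w where "w \<in> K (length a)" "a = one_line (length a) w"
    unfolding separable_word_def by blast
  then show "a \<in> signed_words {1..int (length a)} \<and> (\<forall>u\<in>separable_patterns. \<not> contains_pattern a u)"
    unfolding K_def using one_line_in_signed_words[of w "length a"] by auto
next
  assume a: "a \<in> signed_words {1..int (length a)} \<and> (\<forall>u\<in>separable_patterns. \<not> contains_pattern a u)"
  then obtain w where "w \<in> signed_perms (length a)" "one_line (length a) w = a"
    using signed_word_is_one_line by blast
  with a have "w \<in> K (length a)"
    by (simp add: K_def)
  then show "separable_word a"
    unfolding separable_word_def using \<open>one_line (length a) w = a\<close> by (metis imageI)
qed

lemma separable_word_good: "separable_word a \<Longrightarrow> good_word a"
  using separable_word_iff signed_words_good_word by blast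

lemma separable_word_sts: "separable_word a \<Longrightarrow> sts a = a"
  using separable_word_iff sts_signed_word by blast

lemma good_word_subseq:
  assumes "good_word a" "subseq b a"
  shows "good_word b"
proof -
  obtain I where "b = nths a I"
    using assms(2) by (auto simp: subseq_conv_nths)
  then show ?thesis
    using assms(1) set_nths_subset[of a I]
    by (auto simp: good_word_def simp flip: nths_map intro: distinct_nthsI)
qed

lemma separable_word_sts_subseq:
  assumes "separable_word a" "subseq b a"
  shows "separable_word (sts b)"
proof -
  have b: "good_word b"
    using assms separable_word_good good_word_subseq by blast
  have "\<not> contains_pattern (sts b) u" if "u \<in> separable_patterns" for u
    using contains_pattern_sts[OF b] contains_pattern_subseq[OF _ assms(2)] assms(1) that
    by (auto simp: separable_word_iff)
  then show ?thesis
    using sts_in_signed_words[OF b] by (simp add: separable_word_iff)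
qed

lemma subseq_take: "subseq (take p a) a" and subseq_drop: "subseq (drop p a) a"
  by (auto intro: prefix_imp_subseq suffix_imp_subseq take_is_prefix suffix_drop)

section \<open>Split positions as domination in absolute value\<close>

lemma signed_word_take_sts:
  assumes w: "w \<in> signed_words {1..int (length w)}"
    and less: "\<forall>x\<in>set (take p w). \<forall>y\<in>set (drop p w). \<bar>x\<bar> < \<bar>y\<bar>"
    and p: "p \<le> length w"
  shows "sts (take p w) = take p w" "w = osum (take p w) (sts (drop p w))"
proof -
  let ?c = "\<lambda>b x. int (card {y \<in> set b. \<bar>y\<bar> \<le> \<bar>x\<bar>})"
  have sts: "sgn x * ?c w x = x" if "x \<in> set w" for x
  proof -
    have "map (\<lambda>x. sgn x * ?c w x) w = map (\<lambda>x. x) w"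
      using sts_signed_word[OF w] unfolding sts_def by simp
    then show ?thesis
      using that unfolding map_eq_conv by blast
  qed
  have set_w: "set w = set (take p w) \<union> set (drop p w)"
    by (metis append_take_drop_id set_append)
  have "distinct w"
    using w distinct_map_absD by (auto simp: signed_words_def)
  then have card_take: "card (set (take p w)) = p"
    using p by (simp add: distinct_card)
  show "sts (take p w) = take p w"
    unfolding sts_def
  proof (rule map_idI)
    fix x
    assume x: "x \<in> set (take p w)"
    have "{y \<in> set (take p w). \<bar>y\<bar> \<le> \<bar>x\<bar>} = {y \<in> set w. \<bar>y\<bar> \<le> \<bar>x\<bar>}"
      unfolding set_w using less x by fastforce
    then show "sgn x * ?c (take p w) x = x"
      using sts[of x] x set_w by simp
  qed
  have "map (\<lambda>x. x + sgn x * int p) (sts (drop p w)) = drop p w"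
    unfolding sts_def map_map
  proof (rule map_idI)
    fix x
    assume x: "x \<in> set (drop p w)"
    have "{y \<in> set w. \<bar>y\<bar> \<le> \<bar>x\<bar>} = set (take p w) \<union> {y \<in> set (drop p w). \<bar>y\<bar> \<le> \<bar>x\<bar>}"
      unfolding set_w using less x by fastforce
    moreover have "set (take p w) \<inter> {y \<in> set (drop p w). \<bar>y\<bar> \<le> \<bar>x\<bar>} = {}"
      using less by fastforce
    ultimately have "?c w x = int p + ?c (drop p w) x"
      using card_take by (simp add: card_Un_disjoint)
    then have "sgn x * ?c (drop p w) x + sgn x * int p = x"
      using sts[of x] x set_w by (simp add: distrib_left)
    moreover have "sgn (sgn x * ?c (drop p w) x) = sgn x"
    proof -
      have "0 < card {y \<in> set (drop p w). \<bar>y\<bar> \<le> \<bar>x\<bar>}"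
        using x by (auto simp: card_gt_0_iff)
      then show ?thesis
        by (simp add: sgn_mult)
    qed
    ultimately show "((\<lambda>x. x + sgn x * int p) \<circ> (\<lambda>x. sgn x * ?c (drop p w) x)) x = x"
      by simp
  qed
  then show "w = osum (take p w) (sts (drop p w))"
    using p by (simp add: osum_def min_absorb2)
qed

lemma signed_word_drop_sts:
  assumes w: "w \<in> signed_words {1..int (length w)}"
    and less: "\<forall>x\<in>set (take p w). \<forall>y\<in>set (drop p w). \<bar>y\<bar> < \<bar>x\<bar>"
    and p: "p \<le> length w"
  shows "sts (drop p w) = drop p w" "w = ominus (sts (take p w)) (drop p w)"
proof -
  let ?c = "\<lambda>b x. int (card {y \<in> set b. \<bar>y\<bar> \<le> \<bar>x\<bar>})"
  have sts: "sgn x * ?c w x = x" if "x \<in> set w" for x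
  proof -
    have "map (\<lambda>x. sgn x * ?c w x) w = map (\<lambda>x. x) w"
      using sts_signed_word[OF w] unfolding sts_def by simp
    then show ?thesis
      using that unfolding map_eq_conv by blast
  qed
  have set_w: "set w = set (take p w) \<union> set (drop p w)"
    by (metis append_take_drop_id set_append)
  have "distinct w"
    using w distinct_map_absD by (auto simp: signed_words_def)
  then have card_drop: "card (set (drop p w)) = length w - p"
    using p by (simp add: distinct_card)
  show "sts (drop p w) = drop p w"
    unfolding sts_def
  proof (rule map_idI)
    fix x
    assume x: "x \<in> set (drop p w)"
    have "{y \<in> set (drop p w). \<bar>y\<bar> \<le> \<bar>x\<bar>} = {y \<in> set w. \<bar>y\<bar> \<le> \<bar>x\<bar>}"
      unfolding set_w using less x by fastforce
    then show "sgn x * ?c (drop p w) x = x"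
      using sts[of x] x set_w by simp
  qed
  have "map (\<lambda>x. x + sgn x * int (length w - p)) (sts (take p w)) = take p w"
    unfolding sts_def map_map
  proof (rule map_idI)
    fix x
    assume x: "x \<in> set (take p w)"
    have "{y \<in> set w. \<bar>y\<bar> \<le> \<bar>x\<bar>} = set (drop p w) \<union> {y \<in> set (take p w). \<bar>y\<bar> \<le> \<bar>x\<bar>}"
      unfolding set_w using less x by fastforce
    moreover have "set (drop p w) \<inter> {y \<in> set (take p w). \<bar>y\<bar> \<le> \<bar>x\<bar>} = {}"
      using less by fastforce
    ultimately have "?c w x = int (length w - p) + ?c (take p w) x"
      using card_drop by (simp add: card_Un_disjoint)
    then have "sgn x * ?c (take p w) x + sgn x * int (length w - p) = x"
      using sts[of x] x set_w by (simp add: distrib_left)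
    moreover have "sgn (sgn x * ?c (take p w) x) = sgn x"
    proof -
      have "0 < card {y \<in> set (take p w). \<bar>y\<bar> \<le> \<bar>x\<bar>}"
        using x by (auto simp: card_gt_0_iff)
      then show ?thesis
        by (simp add: sgn_mult)
    qed
    ultimately show "((\<lambda>x. x + sgn x * int (length w - p)) \<circ> (\<lambda>x. sgn x * ?c (take p w) x)) x = x"
      by simp
  qed
  then show "w = ominus (sts (take p w)) (drop p w)"
    by (simp add: ominus_def)
qed

text \<open>The shifts in \<open>osum\<close> and \<open>ominus\<close> mean that one block
  dominates the other in absolute value. Both blocks can be given in standardized form, as a
  separable word is its own standardization.\<close>

lemma split_positions_cases:
  assumes p: "p \<in> split_positions w" and good: "good_word w"
  shows "1 \<le> p" "p < length w" "same_sign (drop p w)"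
    "separable_word (sts (take p w))" "separable_word (sts (drop p w))"
    "(\<forall>x\<in>set (take p w). \<forall>y\<in>set (drop p w). \<bar>x\<bar> < \<bar>y\<bar>)
      \<or> same_sign w \<and> (\<forall>x\<in>set (take p w). \<forall>y\<in>set (drop p w). \<bar>y\<bar> < \<bar>x\<bar>)"
proof -
  show len: "1 \<le> p" "p < length w" and "same_sign (drop p w)"
    using p by (auto simp: split_positions_def)
  let ?u = "take p w" and ?v = "drop p w"
  have bound: "\<bar>x\<bar> \<le> int (length a)" if "separable_word a" "x \<in> set a" for a x
  proof -
    have "\<bar>x\<bar> \<in> {1..int (length a)}"
      using that unfolding separable_word_iff signed_words_def by blast
    then show ?thesis by simp
  qed
  have shift: "k < \<bar>x + sgn x * k\<bar>" if "x \<noteq> 0" "0 \<le> k" for x k :: int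
    using that by (auto simp: sgn_if)
  have nz: "x \<noteq> 0" if "separable_word a" "x \<in> set a" for a x
    using separable_word_good[OF that(1)] that(2) by (auto simp: good_word_def)
  consider "w = osum ?u (sts ?v)" "separable_word ?u" "separable_word (sts ?v)"
    | "same_sign w" "w = ominus (sts ?u) ?v" "separable_word (sts ?u)" "separable_word ?v"
    using p by (auto simp: split_positions_def)
  then have "separable_word (sts ?u) \<and> separable_word (sts ?v)
      \<and> ((\<forall>x\<in>set ?u. \<forall>y\<in>set ?v. \<bar>x\<bar> < \<bar>y\<bar>)
         \<or> same_sign w \<and> (\<forall>x\<in>set ?u. \<forall>y\<in>set ?v. \<bar>y\<bar> < \<bar>x\<bar>))"
  proof cases
    case 1
    have "drop p (osum ?u (sts ?v)) = map (\<lambda>x. x + sgn x * int p) (sts ?v)"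
      using len by (simp add: osum_def min_absorb2)
    then have v: "?v = map (\<lambda>x. x + sgn x * int p) (sts ?v)"
      using 1(1) by metis
    have "\<bar>x\<bar> < \<bar>y\<bar>" if x: "x \<in> set ?u" and y: "y \<in> set ?v" for x y
    proof -
      obtain e where e: "e \<in> set (sts ?v)" "y = e + sgn e * int p"
        using y by (subst (asm) v) auto
      have "\<bar>x\<bar> \<le> int p"
        using bound[OF 1(2) x] len by (simp add: min_absorb2)
      then show ?thesis
        using shift[of e "int p"] nz[OF 1(3) e(1)] e(2) by simp
    qed
    then show ?thesis
      using 1 separable_word_sts[OF 1(2)] by simp
  next
    case 2
    have "take p (ominus (sts ?u) ?v) = map (\<lambda>x. x + sgn x * int (length ?v)) (sts ?u)"
      using len by (simp add: ominus_def min_absorb2)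
    then have u: "?u = map (\<lambda>x. x + sgn x * int (length ?v)) (sts ?u)"
      using 2(2) by metis
    have "\<bar>y\<bar> < \<bar>x\<bar>" if x: "x \<in> set ?u" and y: "y \<in> set ?v" for x y
    proof -
      obtain e where e: "e \<in> set (sts ?u)" "x = e + sgn e * int (length ?v)"
        using x by (subst (asm) u) auto
      show ?thesis
        using shift[of e "int (length ?v)"] nz[OF 2(3) e(1)] e(2) bound[OF 2(4) y] by simp
    qed
    then show ?thesis
      using 2 separable_word_sts[OF 2(4)] by simp
  qed
  then show "separable_word (sts ?u)" "separable_word (sts ?v)"
    "(\<forall>x\<in>set ?u. \<forall>y\<in>set ?v. \<bar>x\<bar> < \<bar>y\<bar>)
      \<or> same_sign w \<and> (\<forall>x\<in>set ?u. \<forall>y\<in>set ?v. \<bar>y\<bar> < \<bar>x\<bar>)"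
    by blast+
qed

lemma split_positionsI_less:
  assumes "separable_word w" "1 \<le> p" "p < length w" "same_sign (drop p w)"
    "\<forall>x\<in>set (take p w). \<forall>y\<in>set (drop p w). \<bar>x\<bar> < \<bar>y\<bar>"
  shows "p \<in> split_positions w"
proof -
  have "w \<in> signed_words {1..int (length w)}"
    using assms(1) by (simp add: separable_word_iff)
  note s = signed_word_take_sts[OF this assms(5)]
  have "separable_word (take p w)" "separable_word (sts (drop p w))"
    using separable_word_sts_subseq[OF assms(1) subseq_take, of p]
      separable_word_sts_subseq[OF assms(1) subseq_drop, of p] s(1) assms(3) by simp_all
  then show ?thesis
    using s(2) assms by (simp add: split_positions_def)
qed

lemma split_positionsI_greater:
  assumes "separable_word w" "1 \<le> p" "p < length w" "same_sign w"
    "\<forall>x\<in>set (take p w). \<forall>y\<in>set (drop p w). \<bar>y\<bar> < \<bar>x\<bar>"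
  shows "p \<in> split_positions w"
proof -
  have "w \<in> signed_words {1..int (length w)}"
    using assms(1) by (simp add: separable_word_iff)
  note s = signed_word_drop_sts[OF this assms(5)]
  have "separable_word (drop p w)" "separable_word (sts (take p w))"
    using separable_word_sts_subseq[OF assms(1) subseq_take, of p]
      separable_word_sts_subseq[OF assms(1) subseq_drop, of p] s(1) assms(3) by simp_all
  moreover have "same_sign (drop p w)"
    using assms(4) by (auto simp: same_sign_def dest: in_set_dropD)
  ultimately show ?thesis
    using s(2) assms by (simp add: split_positions_def)
qed

text \<open>
  The pattern \<open>c d m y\<close> is 3142 for \<open>R = (<)\<close> and 2413 for \<open>R = (>)\<close>. If it is avoided, the letters of \<open>u\<close>
  before \<open>y\<close> in the order \<open>R\<close> form an initial segment of \<open>u\<close>, and the word splits after it; if that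
  segment is empty, \<open>y\<close> itself splits off.
\<close>

lemma split_before_last:
  fixes a :: "'a list"
  assumes R: "\<And>x y z. R x y \<Longrightarrow> R y z \<Longrightarrow> R x z"
    and total: "\<And>x. x \<in> set (u @ v) \<Longrightarrow> R x y \<or> R y x"
    and uv: "u \<noteq> []" "v \<noteq> []" "\<forall>c\<in>set u. \<forall>d\<in>set v. R c d"
    and avoid: "\<And>c d m. subseq [c, d, m, y] (u @ v @ [y]) \<Longrightarrow> \<not> (R d y \<and> R y c \<and> R c m)"
  shows "\<exists>u' v'. u @ v @ [y] = u' @ v' \<and> u' \<noteq> [] \<and> v' \<noteq> []
    \<and> ((\<forall>c\<in>set u'. \<forall>d\<in>set v'. R c d) \<or> (\<forall>c\<in>set u'. \<forall>d\<in>set v'. R d c))"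
proof -
  define u1 u2 where "u1 = takeWhile (\<lambda>c. R c y) u" and "u2 = dropWhile (\<lambda>c. R c y) u"
  have u: "u = u1 @ u2"
    by (simp add: u1_def u2_def)
  have u1: "R c y" if "c \<in> set u1" for c
    using that by (auto simp: u1_def dest: set_takeWhileD)
  have u2: "R y c" if c: "c \<in> set u2" for c
  proof (rule ccontr)
    assume "\<not> R y c"
    then have "R c y"
      using total[of c] c u by auto
    have ne: "u2 \<noteq> []"
      using c by auto
    \<comment> \<open>\<open>h\<close> is the first letter of \<open>u\<close> that \<open>y\<close>
      precedes in the order \<open>R\<close>. With the later letter \<open>c\<close> and any
      \<open>m\<close> of \<open>v\<close> it forms the forbidden configuration
      \<open>h c m y\<close>.\<close>
    then obtain h t where ht: "u2 = h # t"
      by (cases u2) auto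
    have "\<not> R h y"
      using hd_dropWhile[of "\<lambda>c. R c y" u] ne ht by (simp add: u2_def)
    then have "R y h"
      using total[of h] u ht by auto
    have "c \<in> set t"
      using c ht \<open>R c y\<close> \<open>\<not> R h y\<close> by auto
    obtain m where m: "m \<in> set v"
      using uv(2) hd_in_set by blast
    have "subseq ([h] @ [c]) ([h] @ t)"
      using \<open>c \<in> set t\<close> by (simp add: subseq_singleton_left)
    then have "subseq [h, c] u"
      unfolding u ht using subseq_drop_many by fastforce
    moreover have "subseq [m] v"
      using m by (simp add: subseq_singleton_left)
    ultimately have "subseq ([h, c] @ [m] @ [y]) (u @ v @ [y])"
      by (intro list_emb_append_mono) auto
    moreover have "R h m"
      using uv(3) m u ht by simp
    ultimately show False
      using avoid[of h c m] \<open>R c y\<close> \<open>R y h\<close> by simp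
  qed
  show ?thesis
  proof (cases "u1 = []")
    case True
    \<comment> \<open>For \<open>c\<close> in \<open>v\<close> use transitivity through a letter of
      \<open>u\<close>.\<close>
    then have "R y c" if "c \<in> set (u @ v)" for c
      using that u u2 uv R by (cases u) (auto, metis list.set_intros(1))
    then show ?thesis
      using uv by (intro exI[of _ "u @ v"] exI[of _ "[y]"]) auto
  next
    case False
    have "\<forall>c\<in>set u1. \<forall>d\<in>set (u2 @ v @ [y]). R c d"
      using u1 u2 uv(3) u R by auto blast
    then show ?thesis
      using False u by (intro exI[of _ u1] exI[of _ "u2 @ v @ [y]"]) auto
  qed
qed

text \<open>The split of the word without its last letter may be of either kind, and
  \<open>split_before_last\<close> is applied with \<open>R\<close> or its converse accordingly; so
  the avoidance is assumed for both orders.\<close>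

lemma separable_order_split:
  fixes a :: "int list"
  assumes "distinct a" "2 \<le> length a"
    and "\<And>R c d m y. R \<in> {(<), (>)} \<Longrightarrow> subseq [c, d, m, y] a \<Longrightarrow> \<not> (R d y \<and> R y c \<and> R c m)"
  shows "\<exists>u v. a = u @ v \<and> u \<noteq> [] \<and> v \<noteq> []
    \<and> ((\<forall>c\<in>set u. \<forall>d\<in>set v. c < d) \<or> (\<forall>c\<in>set u. \<forall>d\<in>set v. d < c))"
  using assms
proof (induction a rule: rev_induct)
  case Nil
  then show ?case by simp
next
  case (snoc y b)
  show ?case
  proof (cases "length b = 1")
    case True
    then obtain x where "b = [x]"
      by (auto simp: length_Suc_conv)
    then show ?thesis
      using snoc.prems(1) by (intro exI[of _ "[x]"] exI[of _ "[y]"]) auto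
  next
    case False
    have "\<exists>u v. b = u @ v \<and> u \<noteq> [] \<and> v \<noteq> []
        \<and> ((\<forall>c\<in>set u. \<forall>d\<in>set v. c < d) \<or> (\<forall>c\<in>set u. \<forall>d\<in>set v. d < c))"
    proof (rule snoc.IH)
      show "\<not> (R d t \<and> R t c \<and> R c m)" if "R \<in> {(<), (>)}" "subseq [c, d, m, t] b" for R c d m t
        using snoc.prems(3)[OF that(1)] subseq_rev_drop_many[OF that(2)] by blast
    qed (use snoc.prems False in auto)
    then obtain u v where uv: "b = u @ v" "u \<noteq> []" "v \<noteq> []"
      "(\<forall>c\<in>set u. \<forall>d\<in>set v. c < d) \<or> (\<forall>c\<in>set u. \<forall>d\<in>set v. d < c)"
      by blast
    have y: "x < y \<or> y < x" if "x \<in> set (u @ v)" for x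
      using that snoc.prems(1) uv(1) by auto
    have avoid: "\<not> (R d y \<and> R y c \<and> R c m)"
      if "R \<in> {(<), (>)}" "subseq [c, d, m, y] (u @ v @ [y])" for R c d m
      using snoc.prems(3)[OF that(1)] that(2) uv(1) by simp
    from uv(4) have "\<exists>u' v'. u @ v @ [y] = u' @ v' \<and> u' \<noteq> [] \<and> v' \<noteq> []
        \<and> ((\<forall>c\<in>set u'. \<forall>d\<in>set v'. c < d) \<or> (\<forall>c\<in>set u'. \<forall>d\<in>set v'. d < c))"
    proof
      assume "\<forall>c\<in>set u. \<forall>d\<in>set v. c < d"
      then show ?thesis
        by (intro split_before_last uv y avoid) auto
    next
      assume less: "\<forall>c\<in>set u. \<forall>d\<in>set v. d < c"
      have "y < x \<or> x < y" if "x \<in> set (u @ v)" for x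
        using y[OF that] by blast
      then have "\<exists>u' v'. u @ v @ [y] = u' @ v' \<and> u' \<noteq> [] \<and> v' \<noteq> []
          \<and> ((\<forall>c\<in>set u'. \<forall>d\<in>set v'. d < c) \<or> (\<forall>c\<in>set u'. \<forall>d\<in>set v'. c < d))"
        using less by (intro split_before_last[where R = "\<lambda>x y. y < x"] uv avoid) auto
      then show ?thesis
        by blast
    qed
    then show ?thesis
      using uv(1) by simp
  qed
qed

lemma sts_eq_filter:
  assumes "distinct b"
  shows "sts b = map (\<lambda>x. sgn x * int (length (filter (\<lambda>y. \<bar>y\<bar> \<le> \<bar>x\<bar>) b))) b"
proof -
  have "{y \<in> set b. \<bar>y\<bar> \<le> \<bar>x\<bar>} = {y. \<bar>y\<bar> \<le> \<bar>x\<bar>} \<inter> set b" for x :: int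
    by auto
  then show ?thesis
    using assms by (simp add: sts_def distinct_length_filter)
qed

lemma separable_sign_change:
  assumes w: "separable_word w" "subseq [x, y] w" and "sgn x \<noteq> sgn y"
  shows "\<bar>x\<bar> < \<bar>y\<bar>"
proof (rule ccontr)
  assume "\<not> \<bar>x\<bar> < \<bar>y\<bar>"
  moreover have good: "good_word [x, y]"
    using w separable_word_good good_word_subseq by blast
  ultimately have less: "\<bar>y\<bar> < \<bar>x\<bar>" and nz: "x \<noteq> 0" "y \<noteq> 0" "x \<noteq> y"
    by (auto simp: good_word_def)
  have "sts [x, y] = [sgn x * 2, sgn y * 1]"
    using less nz by (subst sts_eq_filter) auto
  then have "sts [x, y] \<in> separable_patterns"
    using nz \<open>sgn x \<noteq> sgn y\<close> by (auto simp: separable_patterns_def sgn_if split: if_splits)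
  then show False
    using w unfolding separable_word_iff contains_pattern_def by blast
qed

text \<open>On letters of one sign, \<open>R\<close> is the order of absolute values or its
  converse. The four letters thus standardize to 3142 or 2413 up to a common sign, and all four
  resulting words are forbidden.\<close>

lemma separable_same_sign_avoid:
  assumes w: "separable_word w" "subseq [c, d, m, y] w" and "same_sign w"
    and R: "R \<in> {(<), (>)}"
  shows "\<not> (R d y \<and> R y c \<and> R c m)"
proof
  assume r: "R d y \<and> R y c \<and> R c m"
  have good: "good_word [c, d, m, y]"
    using w separable_word_good good_word_subseq by blast
  obtain I where "[c, d, m, y] = nths w I"
    using w(2) by (auto simp only: subseq_conv_nths)
  then have "set [c, d, m, y] \<subseteq> set w"
    by (simp only: set_nths_subset)
  then have mem: "c \<in> set w" "d \<in> set w" "m \<in> set w" "y \<in> set w"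
    by auto
  then have sgn: "sgn d = sgn c" "sgn m = sgn c" "sgn y = sgn c"
    using \<open>same_sign w\<close> unfolding same_sign_def by blast+
  have dist: "distinct [c, d, m, y]"
    using good by (auto simp: good_word_def)
  have nz: "c \<noteq> 0"
    using good by (auto simp: good_word_def)
  have sts: "sts [c, d, m, y] =
      map (\<lambda>x. sgn c * int (length (filter (\<lambda>y. \<bar>y\<bar> \<le> \<bar>x\<bar>) [c, d, m, y]))) [c, d, m, y]"
    using sts_eq_filter[OF dist] sgn by simp
  consider "\<bar>d\<bar> < \<bar>y\<bar>" "\<bar>y\<bar> < \<bar>c\<bar>" "\<bar>c\<bar> < \<bar>m\<bar>" | "\<bar>m\<bar> < \<bar>c\<bar>" "\<bar>c\<bar> < \<bar>y\<bar>" "\<bar>y\<bar> < \<bar>d\<bar>"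
    using r R sgn nz by (auto simp: sgn_if split: if_splits)
  then have "sts [c, d, m, y] \<in> {map ((*) (sgn c)) [3, 1, 4, 2], map ((*) (sgn c)) [2, 4, 1, 3]}"
  proof cases
    case 1
    then show ?thesis unfolding sts by simp
  next
    case 2
    then show ?thesis unfolding sts by simp
  qed
  then have "sts [c, d, m, y] \<in> separable_patterns"
    using nz by (auto simp: separable_patterns_def sgn_if split: if_splits)
  then show False
    using w unfolding separable_word_iff contains_pattern_def by blast
qed

lemma same_sign_cases:
  assumes "same_sign w" "0 \<notin> set w"
  shows "(\<forall>x\<in>set w. 0 < x) \<or> (\<forall>x\<in>set w. x < 0)"
proof (cases w)
  case (Cons a w')
  have "sgn x = sgn a" if "x \<in> set w" for x
    using assms(1)[unfolded same_sign_def, rule_format, of x a] that Cons by simp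
  moreover have "a \<noteq> 0"
    using assms(2) Cons by auto
  ultimately show ?thesis
    by (metis sgn_less sgn_greater linorder_neqE)
qed simp

lemma split_positions_nonempty:
  assumes w: "separable_word w" and len: "2 \<le> length w"
  shows "split_positions w \<noteq> {}"
proof (cases "same_sign w")
  case True
  have good: "good_word w"
    using w by (rule separable_word_good)
  then have "distinct w"
    by (simp add: good_word_def distinct_map_absD)
  then obtain u v where uv: "w = u @ v" "u \<noteq> []" "v \<noteq> []"
    and less: "(\<forall>c\<in>set u. \<forall>d\<in>set v. c < d) \<or> (\<forall>c\<in>set u. \<forall>d\<in>set v. d < c)"
    using separable_order_split[OF _ len] separable_same_sign_avoid[OF w _ True] by metis
  have p: "1 \<le> length u" "length u < length w" "take (length u) w = u" "drop (length u) w = v"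
    using uv by (auto simp: Suc_le_eq)
  have "(\<forall>x\<in>set (u @ v). 0 < x) \<or> (\<forall>x\<in>set (u @ v). x < 0)"
    using same_sign_cases[OF True] good uv(1) by (simp add: good_word_def)
  then have "(\<forall>c\<in>set u. \<forall>d\<in>set v. \<bar>c\<bar> < \<bar>d\<bar>) \<or> (\<forall>c\<in>set u. \<forall>d\<in>set v. \<bar>d\<bar> < \<bar>c\<bar>)"
  proof
    assume "\<forall>x\<in>set (u @ v). 0 < x"
    then have "\<bar>c\<bar> = c" if "c \<in> set u \<or> c \<in> set v" for c
      using that by (intro abs_of_pos) auto
    then show ?thesis
      using less by simp
  next
    assume "\<forall>x\<in>set (u @ v). x < 0"
    then have "\<bar>c\<bar> = - c" if "c \<in> set u \<or> c \<in> set v" for c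
      using that by (intro abs_of_neg) auto
    then show ?thesis
      using less by auto
  qed
  then consider "\<forall>c\<in>set u. \<forall>d\<in>set v. \<bar>c\<bar> < \<bar>d\<bar>" | "\<forall>c\<in>set u. \<forall>d\<in>set v. \<bar>d\<bar> < \<bar>c\<bar>"
    by blast
  then show ?thesis
  proof cases
    case 1
    have "same_sign v"
      using True uv(1) by (auto simp: same_sign_def)
    with 1 show ?thesis
      using split_positionsI_less[OF w p(1,2)] p by auto
  next
    case 2
    then show ?thesis
      using split_positionsI_greater[OF w p(1,2) True] p by auto
  qed
next
  case False
  \<comment> \<open>The last maximal block of constant sign splits off.\<close>
  define p where "p = (LEAST p. same_sign (drop p w))"
  have ss: "same_sign (drop (length w - 1) w)"
  proof -
    have "length (drop (length w - 1) w) = Suc 0"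
      using len by simp
    then obtain x where "drop (length w - 1) w = [x]"
      unfolding length_Suc_conv by auto
    then show ?thesis by (simp add: same_sign_def)
  qed
  have p: "same_sign (drop p w)" "p \<le> length w - 1"
    unfolding p_def using ss by (auto intro: LeastI Least_le)
  have "p \<noteq> 0"
    using p(1) False by (cases p) auto
  then have "\<not> same_sign (drop (p - 1) w)"
    using not_less_Least[of "p - 1" "\<lambda>p. same_sign (drop p w)"] by (simp add: p_def)
  have plen: "1 \<le> p" "p < length w"
    using p(2) len \<open>p \<noteq> 0\<close> by auto
  let ?z = "w ! (p - 1)"
  have drop_p1: "drop (p - 1) w = ?z # drop p w"
    using plen Cons_nth_drop_Suc[of "p - 1" w] by simp
  have opp: "sgn ?z \<noteq> sgn y" if y: "y \<in> set (drop p w)" for y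
  proof
    assume z: "sgn ?z = sgn y"
    have "sgn x = sgn y" if x: "x \<in> set (?z # drop p w)" for x
      using x p(1)[unfolded same_sign_def, rule_format, OF _ y, of x] z by auto
    then have "same_sign (?z # drop p w)"
      unfolding same_sign_def by simp
    then show False
      using \<open>\<not> same_sign (drop (p - 1) w)\<close> drop_p1 by simp
  qed
  have two: "\<bar>x\<bar> < \<bar>y\<bar>" if "w = a @ b" "x \<in> set a" "y \<in> set b" "sgn x \<noteq> sgn y" for a b x y
  proof -
    have "subseq ([x] @ [y]) (a @ b)"
      using that by (intro list_emb_append_mono) (simp_all add: subseq_singleton_left)
    then show ?thesis
      using separable_sign_change[OF w] that by simp
  qed
  have "\<bar>x\<bar> < \<bar>y\<bar>" if x: "x \<in> set (take p w)" and y: "y \<in> set (drop p w)" for x y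
  proof (cases "sgn x = sgn y")
    case False
    then show ?thesis
      using two[of "take p w" "drop p w"] x y by simp
  next
    case True
    \<comment> \<open>A letter with the sign of \<open>y\<close> is compared through
      \<open>?z\<close>, the last letter before the final block, whose sign is opposite.\<close>
    have "take p w = take (p - 1) w @ [?z]"
      using plen take_Suc_conv_app_nth[of "p - 1" w] by simp
    then have "x \<in> set (take (p - 1) w)"
      using x opp[OF y] True by auto
    then have "\<bar>x\<bar> < \<bar>?z\<bar>"
      using two[of "take (p - 1) w" "drop (p - 1) w" x ?z] drop_p1 opp[OF y] True by simp
    moreover have "?z \<in> set (take p w)"
      using \<open>take p w = _\<close> by simp
    then have "\<bar>?z\<bar> < \<bar>y\<bar>"
      using two[of "take p w" "drop p w"] y opp[OF y] by simp
    ultimately show ?thesis by simp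
  qed
  then show ?thesis
    using split_positionsI_less[OF w plen p(1)] by auto
qed

section \<open>The main theorem\<close>

text \<open>One induction then serves lower ideals, by \<open>w\<close> itself with
  \<open>Oplus\<close>, and upper ideals, by its negative with \<open>Ominus\<close>.\<close>

definition signed_copy :: "node_sign \<Rightarrow> int list \<Rightarrow> int list" where
  "signed_copy s w = (if s = Oplus then w else map uminus w)"

lemma signed_copy_simps [simp]:
  "length (signed_copy s w) = length w"
  "signed_copy s (u @ v) = signed_copy s u @ signed_copy s v"
  "signed_copy s w = [] \<longleftrightarrow> w = []"
  by (simp_all add: signed_copy_def)

lemma ZB_map_rankB:
  assumes "finite A" "\<forall>a\<in>A. 0 < a" "abs ` set w \<subseteq> A"
  shows "ZB (map (rankB A) w) = ZB w"
proof -
  have "leB x (map (rankB A) w) \<longleftrightarrow> leB x w" if "x \<in> signed_words {1..int (length w)}" for x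
    using leB_map_rankB_right[OF assms] signed_words_length[OF that] by simp
  then show ?thesis
    unfolding ZB_def length_map by (intro sum.cong) auto
qed

lemma neg_prod_map_rankB:
  assumes "finite A" "abs ` set w \<subseteq> A"
  shows "neg_prod (map (rankB A) w) = neg_prod w"
proof -
  have "rankB A (w ! i) < 0 \<longleftrightarrow> w ! i < 0" if "i < length w" for i
    using that assms by (intro rankB_neg_iff) auto
  then show ?thesis
    by (simp add: neg_prod_def)
qed

lemma signed_copy_sts:
  assumes "good_word w"
  shows "ZB (signed_copy s (sts w)) = ZB (signed_copy s w)"
    and "neg_prod (signed_copy s (sts w)) = neg_prod (signed_copy s w)"
proof -
  let ?A = "abs ` set w"
  have sts: "sts w = map (rankB ?A) w"
    using assms by (intro sts_eq_map_rankB) (simp add: good_word_def)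
  have copy: "signed_copy s (sts w) = map (rankB ?A) (signed_copy s w)"
    unfolding sts by (simp add: signed_copy_def rankB_minus comp_def)
  have sub: "abs ` set (signed_copy s w) \<subseteq> ?A"
    by (simp add: signed_copy_def image_image)
  show "ZB (signed_copy s (sts w)) = ZB (signed_copy s w)"
    unfolding copy by (intro ZB_map_rankB good_word_pos assms sub) simp
  show "neg_prod (signed_copy s (sts w)) = neg_prod (signed_copy s w)"
    unfolding copy by (intro neg_prod_map_rankB sub) simp
qed

lemma signed_copy_same_sign:
  assumes "same_sign w" "0 \<notin> set w"
  shows "(\<forall>x\<in>set (signed_copy s w). 0 < x) \<or> (\<forall>x\<in>set (signed_copy s w). x < 0)"
  using same_sign_cases[OF assms] by (auto simp: signed_copy_def)

text \<open>Domination in absolute value and the constant sign of the dominating block decide all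
  cross comparisons alike. So the ends of a word compare like the letters next to the split, which
  give the root label.\<close>

lemma split_compare:
  assumes "same_sign v" "0 \<notin> set (u @ v)"
    and less: "(\<forall>x\<in>set u. \<forall>y\<in>set v. \<bar>x\<bar> < \<bar>y\<bar>)
      \<or> same_sign (u @ v) \<and> (\<forall>x\<in>set u. \<forall>y\<in>set v. \<bar>y\<bar> < \<bar>x\<bar>)"
    and mem: "a \<in> set u" "c \<in> set u" "b \<in> set v" "d \<in> set v"
  shows "a < b \<longleftrightarrow> c < d"
  using less
proof
  assume *: "\<forall>x\<in>set u. \<forall>y\<in>set v. \<bar>x\<bar> < \<bar>y\<bar>"
  have "(0 < b \<and> 0 < d) \<or> (b < 0 \<and> d < 0)"
    using same_sign_cases[OF assms(1)] assms(2) mem by auto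
  moreover have "\<bar>a\<bar> < \<bar>b\<bar>" "\<bar>c\<bar> < \<bar>d\<bar>"
    using * mem by blast+
  ultimately show ?thesis by linarith
next
  assume *: "same_sign (u @ v) \<and> (\<forall>x\<in>set u. \<forall>y\<in>set v. \<bar>y\<bar> < \<bar>x\<bar>)"
  have "(0 < a \<and> 0 < b \<and> 0 < c \<and> 0 < d) \<or> (a < 0 \<and> b < 0 \<and> c < 0 \<and> d < 0)"
    using same_sign_cases[of "u @ v"] * assms(2) mem by auto
  moreover have "\<bar>b\<bar> < \<bar>a\<bar>" "\<bar>d\<bar> < \<bar>c\<bar>"
    using * mem by blast+
  ultimately show ?thesis by linarith
qed

text \<open>The leaf count supplies the parameters of \<open>gbin\<close>, and the root label
  decides about [n]! in the final formulas. Like the tree, the induction passes to standardized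
  blocks; \<open>signed_copy_sts\<close> leads back to the blocks themselves.\<close>

lemma separating_tree_ZB:
  assumes "separable_word w" "w \<noteq> []"
  shows "num_leaves (separating_tree w) = length w
    \<and> (\<forall>s. ZB (signed_copy s w) = tree_poly s (separating_tree w) * neg_prod (signed_copy s w))
    \<and> (2 \<le> length w \<longrightarrow>
        has_root (if hd w < last w then Oplus else Ominus) (separating_tree w))"
  using assms
proof (induction "length w" arbitrary: w rule: less_induct)
  case less
  have good: "good_word w"
    using less.prems separable_word_good by blast
  show ?case
  proof (cases "length w \<le> 1")
    case True
    then obtain x where x: "w = [x]"
      using less.prems(2) by (cases w) auto
    have "ZB (signed_copy s w) = neg_prod (signed_copy s w)" for s
    proof -
      have "\<exists>z. signed_copy s w = [z] \<and> z \<noteq> 0"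
        using good x by (auto simp: signed_copy_def good_word_def)
      then obtain z where "signed_copy s w = [z]" "z \<noteq> 0"
        by blast
      then show ?thesis
        using ZB_same_sign[of "[z]"] ZA_single by (auto simp: linorder_neq_iff)
    qed
    then show ?thesis
      using x by (simp add: separating_tree.simps)
  next
    case False
    define p where "p = Max (split_positions w)"
    define u v where "u = take p w" and "v = drop p w"
    have "finite (split_positions w)"
      by (rule finite_subset[of _ "{1..<length w}"]) (auto simp: split_positions_def)
    moreover have ne: "split_positions w \<noteq> {}"
      using split_positions_nonempty less.prems(1) False by simp
    ultimately have "p \<in> split_positions w"
      unfolding p_def by (rule Max_in)
    note split = split_positions_cases[OF this good, folded u_def v_def]
    have w: "w = u @ v" and len: "length u = p" "length v = length w - p"
      using split(2) by (simp_all add: u_def v_def)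
    have uv: "u \<noteq> []" "v \<noteq> []"
      using len split(1,2) by auto
    have good_uv: "good_word u" "good_word v"
      unfolding u_def v_def using good good_word_subseq subseq_take subseq_drop by blast+
    let ?tu = "relabel (separating_tree (sts u)) u" and ?tv = "relabel (separating_tree (sts v)) v"
    let ?s = "if last u < hd v then Oplus else Ominus"
    have ends: "last u = w ! (p - 1)" "hd v = w ! p"
      using uv len split(1,2) unfolding w
      by (simp_all add: last_conv_nth nth_append hd_conv_nth)
    have T: "separating_tree w = Node ?s ?tu ?tv"
      using False ne by (subst separating_tree.simps) (simp add: Let_def ends flip: p_def u_def v_def)
    have shorter: "length (sts u) < length w" "length (sts v) < length w"
      using len split(1,2) by auto
    have "sts u \<noteq> []" "sts v \<noteq> []"
      using uv by (simp_all add: sts_def)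
    note hyps = less.hyps[OF shorter(1) split(4) this(1)] less.hyps[OF shorter(2) split(5) this(2)]
    have IH: "num_leaves ?tu = length u" "num_leaves ?tv = length v"
      "ZB (signed_copy s u) = tree_poly s ?tu * neg_prod (signed_copy s u)"
      "ZB (signed_copy s v) = tree_poly s ?tv * neg_prod (signed_copy s v)" for s
      using hyps unfolding signed_copy_sts[OF good_uv(1)] signed_copy_sts[OF good_uv(2)]
        length_sts num_leaves_relabel tree_poly_relabel by blast+
    have nz: "0 \<notin> set (u @ v)"
      using good w by (simp add: good_word_def)
    have ZB: "ZB (signed_copy s w) = tree_poly s (separating_tree w) * neg_prod (signed_copy s w)" for s
    proof -
      let ?u = "signed_copy s u" and ?v = "signed_copy s v"
      \<comment> \<open>With equality excluded, negating the word turns the comparison at the split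
        into its opposite, as \<open>s = Ominus\<close> demands.\<close>
      have "last u \<noteq> hd v"
      proof
        assume "last u = hd v"
        then have "\<bar>last u\<bar> \<in> abs ` set u \<inter> abs ` set v"
          using last_in_set[OF uv(1)] hd_in_set[OF uv(2)] by simp
        moreover have "abs ` set u \<inter> abs ` set v = {}"
          using good unfolding w good_word_def by simp
        ultimately show False by blast
      qed
      then have sign: "last ?u < hd ?v \<longleftrightarrow> ?s = s"
        using uv by (cases s) (auto simp: signed_copy_def last_map hd_map)
      have "ZB (?u @ ?v) = tree_poly s ?tu * tree_poly s ?tv
          * (if last ?u < hd ?v then 1 else gbin (length ?u) (length ?v)) * neg_prod (?u @ ?v)"
        using split(6)
      proof
        assume "\<forall>x\<in>set u. \<forall>y\<in>set v. \<bar>x\<bar> < \<bar>y\<bar>"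
        then have "\<forall>x\<in>set ?u. \<forall>y\<in>set ?v. \<bar>x\<bar> < \<bar>y\<bar>"
          by (auto simp: signed_copy_def)
        then show ?thesis
          using uv nz split(3) by (intro ZB_append_abs_less signed_copy_same_sign IH) auto
      next
        assume *: "same_sign w \<and> (\<forall>x\<in>set u. \<forall>y\<in>set v. \<bar>y\<bar> < \<bar>x\<bar>)"
        then have "\<forall>x\<in>set ?u. \<forall>y\<in>set ?v. \<bar>y\<bar> < \<bar>x\<bar>"
          by (auto simp: signed_copy_def)
        moreover have "(\<forall>x\<in>set (?u @ ?v). 0 < x) \<or> (\<forall>x\<in>set (?u @ ?v). x < 0)"
          using signed_copy_same_sign[of "u @ v" s] * nz w by simp
        ultimately show ?thesis
          using uv by (intro ZB_append_abs_greater IH) auto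
      qed
      then show ?thesis
        unfolding T sign using IH(1,2) by (simp add: w)
    qed
    have "hd w < last w \<longleftrightarrow> last u < hd v"
      using split_compare[OF split(3) nz, of "hd w" "last u" "last w" "hd v"] split(6) uv
      by (simp add: w)
    then show ?thesis
      using ZB IH(1,2) len split(2) by (simp add: T)
  qed
qed

lemma neg_prod_one_line: "neg_prod (one_line n w) = (\<Prod>i\<in>Neg n w. qpar i)"
proof -
  have "neg_prod (one_line n w) = (\<Prod>i\<in>{1..n}. if w (int i) < 0 then qpar i else 1)"
    unfolding neg_prod_def length_one_line
    by (rule prod.reindex_bij_witness[where i = "\<lambda>i. i - 1" and j = Suc]) (auto simp: add.commute)
  also have "\<dots> = (\<Prod>i\<in>Neg n w. qpar i)"
    unfolding Neg_def by (rule prod.inter_filter[symmetric]) simp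
  finally show ?thesis .
qed

lemma neg_prod_uminus_one_line:
  assumes w: "w \<in> signed_perms n"
  shows "neg_prod (map uminus (one_line n w)) = (\<Prod>i\<in>{1..n} - Neg n w. qpar i)"
proof -
  have "neg_prod (map uminus (one_line n w)) = (\<Prod>i\<in>{1..n}. if 0 < w (int i) then qpar i else 1)"
    unfolding neg_prod_def length_map length_one_line
    by (rule prod.reindex_bij_witness[where i = "\<lambda>i. i - 1" and j = Suc]) (auto simp: add.commute)
  also have "\<dots> = (\<Prod>i\<in>{i \<in> {1..n}. 0 < w (int i)}. qpar i)"
    by (rule prod.inter_filter[symmetric]) simp
  also have "{i \<in> {1..n}. 0 < w (int i)} = {1..n} - Neg n w"
  proof -
    have "0 < w (int i) \<longleftrightarrow> \<not> w (int i) < 0" if "i \<in> {1..n}" for i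
      using signed_perms_eq_0[OF w, of "int i"] that by auto
    then show ?thesis
      unfolding Neg_def by blast
  qed
  finally show ?thesis .
qed

section \<open>Palindromic factors\<close>

lemma reflect_qint: "reflect_poly (qint n) = qint n"
proof (cases n)
  case (Suc k)
  have "reflect_poly (\<Sum>j<n. monom (1::int) j) = (\<Sum>j<n. monom 1 (k - j))"
    using Suc by (intro reflect_poly_sum_monom[where ?x0.0 = k]) auto
  also have "\<dots> = (\<Sum>j<n. monom 1 j)"
    using sum.nat_diff_reindex[of "monom 1" n] unfolding Suc by (simp del: sum.lessThan_Suc)
  finally show ?thesis
    by (simp add: qint_def)
qed (simp add: qint_def)

lemma reflect_qfact: "reflect_poly (qfact n) = qfact n"
  by (simp add: qfact_def reflect_poly_prod reflect_qint)

lemma reflect_qpar: "reflect_poly (qpar (Suc n)) = qpar (Suc n)"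
proof -
  have "qpar (Suc n) = (\<Sum>j\<in>{0, Suc n}. monom 1 j)"
    by (simp add: qpar_def monom_0 flip: one_pCons)
  moreover have "reflect_poly (\<Sum>j\<in>{0, Suc n}. monom (1::int) j) = (\<Sum>j\<in>{0, Suc n}. monom 1 (Suc n - j))"
    by (rule reflect_poly_sum_monom[where ?x0.0 = "Suc n"]) auto
  ultimately show ?thesis
    by (simp add: add.commute)
qed

lemma reflect_neg_prod: "reflect_poly (neg_prod w) = neg_prod w"
  by (simp add: neg_prod_def reflect_poly_prod reflect_qpar if_distrib cong: if_cong)

lemma reflect_alt_prod: "reflect_poly (alt_prod s t) = alt_prod s t"
  by (simp add: alt_prod_def reflect_poly_prod reflect_qfact)

lemma alt_prod_neq_0 [simp]: "alt_prod s t \<noteq> 0"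
  by (simp add: alt_prod_def)

text \<open>In the telescoped identity all other factors are products of q-factorials and hence
  palindromic; cancelling \<open>alt_prod s t\<close> leaves the claim.\<close>

lemma reflect_tree_poly: "reflect_poly (tree_poly s t) = tree_poly s t"
proof -
  have "reflect_poly (root_fact (other_sign s) t) = root_fact (other_sign s) t"
    by (simp add: root_fact_def reflect_qfact)
  note r = this
  have "reflect_poly (tree_poly s t) * alt_prod s t = reflect_poly (tree_poly s t * alt_prod s t)"
    by (simp only: reflect_poly_mult reflect_alt_prod)
  also have "\<dots> = alt_prod (other_sign s) t * root_fact (other_sign s) t"
    by (simp only: tree_poly_alt_prod reflect_poly_mult reflect_alt_prod r)
  also have "\<dots> = tree_poly s t * alt_prod s t"
    by (simp only: tree_poly_alt_prod)
  finally show ?thesis by simp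
qed

lemma to_fract_tree_poly:
  "to_fract (tree_poly s t) = to_fract (alt_prod (other_sign s) t) / to_fract (alt_prod s t)
     * to_fract (root_fact (other_sign s) t)"
proof -
  have "to_fract (tree_poly s t) * to_fract (alt_prod s t)
      = to_fract (alt_prod (other_sign s) t) * to_fract (root_fact (other_sign s) t)"
    using arg_cong[OF tree_poly_alt_prod[of s t], of to_fract] by simp
  moreover have "to_fract (alt_prod s t) \<noteq> 0"
    by simp
  ultimately show ?thesis
    by (simp add: field_simps)
qed

theorem theorem5p9:
  fixes n :: nat and w :: "int \<Rightarrow> int" and T :: sep_tree
  assumes "n \<ge> 1" and "w \<in> K n"
    and "T = separating_tree (one_line n w)"
  shows "(w 1 < w (int n) \<longrightarrow>
        to_fract (F_lower n w) =
          qfact_prod T (S_minus T) / qfact_prod T (S_plus T)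
            * to_fract (\<Prod>i \<in> Neg n w. qpar i) \<and>
        to_fract (F_upper n w) =
          qfact_prod T (S_plus T) / qfact_prod T (S_minus T)
            * to_fract (qfact n) * to_fract (\<Prod>i \<in> {1..n} - Neg n w. qpar i)) \<and>
     (w 1 > w (int n) \<longrightarrow>
        to_fract (F_lower n w) =
          qfact_prod T (S_minus T) / qfact_prod T (S_plus T)
            * to_fract (qfact n) * to_fract (\<Prod>i \<in> Neg n w. qpar i) \<and>
        to_fract (F_upper n w) =
          qfact_prod T (S_plus T) / qfact_prod T (S_minus T)
            * to_fract (\<Prod>i \<in> {1..n} - Neg n w. qpar i))"
proof -
  let ?a = "one_line n w"
  have w: "w \<in> signed_perms n"
    using assms(2) by (simp add: K_def)
  have a: "separable_word ?a" "?a \<noteq> []"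
    using assms(1,2) by (auto simp: separable_word_def one_line_def)
  note main = separating_tree_ZB[OF a, folded assms(3)]
  have lower: "F_lower n w = tree_poly Oplus T * (\<Prod>i\<in>Neg n w. qpar i)"
    using main F_lower_eq_ZB[OF w] neg_prod_one_line[of n w]
    by (auto simp: signed_copy_def dest!: spec[of _ Oplus])
  have "ZB (map uminus ?a) = tree_poly Ominus T * neg_prod (map uminus ?a)"
    using main by (auto simp: signed_copy_def dest!: spec[of _ Ominus])
  then have upper: "F_upper n w = tree_poly Ominus T * (\<Prod>i\<in>{1..n} - Neg n w. qpar i)"
    unfolding neg_prod_uminus_one_line[OF w, symmetric] F_upper_eq_reflect[OF w]
    by (simp only: reflect_poly_mult reflect_tree_poly reflect_neg_prod)
  have ends: "hd ?a = w 1" "last ?a = w (int n)"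
    using assms(1) a(2) by (simp_all add: hd_conv_nth last_conv_nth)
  have root: "root_fact s T = (if s = (if w 1 < w (int n) then Oplus else Ominus) then qfact n else 1)"
    if "w 1 \<noteq> w (int n)" for s
  proof -
    \<comment> \<open>A single letter would be both first and last; from \<open>2 \<le> n\<close>
      on, the root is an inner node with a label.\<close>
    have "n \<noteq> 1"
      using that by auto
    then have "has_root (if w 1 < w (int n) then Oplus else Ominus) T" "num_leaves T = n"
      using main assms(1) unfolding ends by auto
    then show ?thesis
      by (cases T) (auto simp: root_fact_def)
  qed
  have qfact_prod: "qfact_prod T (S_plus T) = to_fract (alt_prod Oplus T)"
      "qfact_prod T (S_minus T) = to_fract (alt_prod Ominus T)"
    by (simp_all add: qfact_prod_def S_plus_eq S_minus_eq alt_prod_def)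
  \<comment> \<open>For lower ideals the surviving root factor is that of \<open>Ominus\<close>, for
    upper ideals that of \<open>Oplus\<close>; the comparison of the end letters makes one of them
    [n]! and the other 1.\<close>
  show ?thesis
    unfolding lower upper qfact_prod to_fract_mult to_fract_tree_poly other_sign.simps
    using root by auto
qed

end
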